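(* Let $\mathcal{M}$ be a separable factor with $\dim\mathcal{M}>4$ and let $N$ be a normal operator in $\mathcal{M}$. Then $N$ is similar to an irreducible operator in $\mathcal{M}$ (that is, there is an invertible $X\in\mathcal{M}$ such that $XNX^{-1}$ is irreducible in $\mathcal{M}$) if and only if the following two conditions are satisfied: (1) $R(\lambda I-N)\succsim I-R(\lambda I-N)$ for every scalar $\lambda$ in $\mathbb{C}$; (2) the set $\{I,N,N^2\}$ is linearly independent over $\mathbb{C}$.
   Context: A separable factor is a von Neumann algebra with trivial center and separable predual; $I$ is its identity. For $T\in\mathcal{M}$, $W^*(T)$ is the von Neumann subalgebra (containing $I$) generated by $T$, and $R(T)$ is the range projection of $T$ (the projection onto the closure of the range of $T$). $T\in\mathcal{M}$ is irreducible in $\mathcal{M}$ if $W^*(T)'\cap\mathcal{M}=\mathbb{C}I$. For projections $P,Q\in\mathcal{M}$: $P\sim Q$ means $V^*V=P$, $VV^*=Q$ for some partial isometry $V\in\mathcal{M}$; $P\precsim Q$ (equivalently $Q\succsim P$) means $P\sim Q_0\leqslant Q$ for some projection $Q_0\in\mathcal{M}$. *)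

theory Defs
  imports "HOL-Analysis.Analysis"
begin

section \<open>Complex Hilbert spaces\<close>

text \<open>
  The norm, metric and topology are those of the underlying real Hilbert space, whose inner
  product is the real part of the complex one. The complex inner product is linear in the first
  argument and conjugate-linear in the second. Neither separability nor infinite dimension is
  assumed.
\<close>

class complex_hilbert_space = real_inner + complete_space +
  fixes scaleC :: "complex \<Rightarrow> 'a \<Rightarrow> 'a"  (infixr "*\<^sub>C" 75)
    and cinner :: "'a \<Rightarrow> 'a \<Rightarrow> complex"
  assumes scaleC_add_right: "c *\<^sub>C (x + y) = c *\<^sub>C x + c *\<^sub>C y"
    and scaleC_add_left: "(c + d) *\<^sub>C x = c *\<^sub>C x + d *\<^sub>C x"
    and scaleC_scaleC: "c *\<^sub>C (d *\<^sub>C x) = (c * d) *\<^sub>C x"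
    and scaleR_eq_scaleC: "r *\<^sub>R x = complex_of_real r *\<^sub>C x"
    and cinner_commute: "cinner x y = cnj (cinner y x)"
    and cinner_add_left: "cinner (x + y) z = cinner x z + cinner y z"
    and cinner_scaleC_left: "cinner (c *\<^sub>C x) y = c * cinner x y"
    and inner_eq_Re_cinner: "inner x y = Re (cinner x y)"

lemma cinner_scaleC_right:
  fixes x y :: "'h::complex_hilbert_space"
  shows "cinner x (c *\<^sub>C y) = cnj c * cinner x y"
  by (metis cinner_commute cinner_scaleC_left complex_cnj_mult)

lemma norm_scaleC:
  fixes x :: "'h::complex_hilbert_space"
  shows "norm (c *\<^sub>C x) = cmod c * norm x"
proof -
  have "cinner (c *\<^sub>C x) (c *\<^sub>C x) = complex_of_real ((cmod c)\<^sup>2) * cinner x x"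
    by (simp add: cinner_scaleC_left cinner_scaleC_right complex_norm_square
        mult.assoc mult.left_commute del: of_real_power)
  then have "inner (c *\<^sub>C x) (c *\<^sub>C x) = (cmod c)\<^sup>2 * inner x x"
    unfolding inner_eq_Re_cinner by (simp del: of_real_power)
  then show ?thesis
    by (simp add: norm_eq_sqrt_inner real_sqrt_mult)
qed

lemma bounded_linear_scaleC:
  "bounded_linear (scaleC c :: 'h::complex_hilbert_space \<Rightarrow> 'h)"
proof (rule bounded_linear_intro[where K = "cmod c"])
  show "c *\<^sub>C (x + y) = c *\<^sub>C x + c *\<^sub>C y" for x y :: 'h
    by (rule scaleC_add_right)
  show "c *\<^sub>C (r *\<^sub>R x) = r *\<^sub>R (c *\<^sub>C x)" for r and x :: 'h
    by (simp add: scaleR_eq_scaleC scaleC_scaleC mult.commute)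
  show "norm (c *\<^sub>C x) \<le> norm x * cmod c" for x :: 'h
    by (simp add: norm_scaleC mult.commute)
qed


section \<open>Bounded operators\<close>

text \<open>
  The type \<open>'h \<Rightarrow>\<^sub>L 'h\<close> consists of the bounded real-linear operators, with the operator norm;
  the algebra of bounded operators on the complex Hilbert space is the subset \<open>bounded_ops\<close>.
\<close>

definition bounded_ops :: "('h::complex_hilbert_space \<Rightarrow>\<^sub>L 'h) set" where
  "bounded_ops = {T. \<forall>c x. blinfun_apply T (c *\<^sub>C x) = c *\<^sub>C blinfun_apply T x}"

lift_definition scalar_op :: "complex \<Rightarrow> 'h::complex_hilbert_space \<Rightarrow>\<^sub>L 'h" is scaleC
  by (rule bounded_linear_scaleC)

definition scaleC_op ::
    "complex \<Rightarrow> ('h::complex_hilbert_space \<Rightarrow>\<^sub>L 'h) \<Rightarrow> 'h \<Rightarrow>\<^sub>L 'h" where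
  "scaleC_op c T = scalar_op c o\<^sub>L T"

text \<open>Provides \<open>cop.independent\<close>, linear independence of sets of operators over the complex numbers.\<close>

global_interpretation cop:
  vector_space "scaleC_op :: complex \<Rightarrow> ('h::complex_hilbert_space \<Rightarrow>\<^sub>L 'h) \<Rightarrow> 'h \<Rightarrow>\<^sub>L 'h"
proof
  fix a b :: complex and S T :: "'h \<Rightarrow>\<^sub>L 'h"
  show "scaleC_op a (S + T) = scaleC_op a S + scaleC_op a T"
    by (rule blinfun_eqI)
      (simp add: scaleC_op_def scalar_op.rep_eq blinfun.add_left scaleC_add_right)
  show "scaleC_op (a + b) T = scaleC_op a T + scaleC_op b T"
    by (rule blinfun_eqI)
      (simp add: scaleC_op_def scalar_op.rep_eq blinfun.add_left scaleC_add_left)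
  show "scaleC_op a (scaleC_op b T) = scaleC_op (a * b) T"
    by (rule blinfun_eqI) (simp add: scaleC_op_def scalar_op.rep_eq scaleC_scaleC)
  show "scaleC_op 1 T = T"
    by (rule blinfun_eqI)
      (use scaleR_eq_scaleC[of 1, where 'a = 'h] in
        \<open>simp add: scaleC_op_def scalar_op.rep_eq\<close>)
qed

text \<open>The adjoint; it exists and is unique for operators in \<open>bounded_ops\<close>.\<close>

definition adj :: "('h::complex_hilbert_space \<Rightarrow>\<^sub>L 'h) \<Rightarrow> 'h \<Rightarrow>\<^sub>L 'h" where
  "adj T = (THE S. \<forall>x y. cinner (blinfun_apply T x) y = cinner x (blinfun_apply S y))"

definition normal_op :: "('h::complex_hilbert_space \<Rightarrow>\<^sub>L 'h) \<Rightarrow> bool" where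
  "normal_op T \<longleftrightarrow> T \<in> bounded_ops \<and> adj T o\<^sub>L T = T o\<^sub>L adj T"

definition projection :: "('h::complex_hilbert_space \<Rightarrow>\<^sub>L 'h) \<Rightarrow> bool" where
  "projection P \<longleftrightarrow> P \<in> bounded_ops \<and> P o\<^sub>L P = P \<and> adj P = P"

definition op_le ::
    "('h::complex_hilbert_space \<Rightarrow>\<^sub>L 'h) \<Rightarrow> ('h \<Rightarrow>\<^sub>L 'h) \<Rightarrow> bool" where
  "op_le S T \<longleftrightarrow> (\<forall>x. cinner (blinfun_apply (T - S) x) x \<in> \<real>\<^sub>\<ge>\<^sub>0)"

definition range_projection ::
    "('h::complex_hilbert_space \<Rightarrow>\<^sub>L 'h) \<Rightarrow> 'h \<Rightarrow>\<^sub>L 'h" where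
  "range_projection T =
     (THE P. projection P \<and> range (blinfun_apply P) = closure (range (blinfun_apply T)))"

text \<open>Isometric on the orthogonal complement of the kernel.\<close>

definition partial_isometry :: "('h::complex_hilbert_space \<Rightarrow>\<^sub>L 'h) \<Rightarrow> bool" where
  "partial_isometry V \<longleftrightarrow> V \<in> bounded_ops \<and>
     (\<forall>x. (\<forall>z. blinfun_apply V z = 0 \<longrightarrow> cinner x z = 0) \<longrightarrow>
        norm (blinfun_apply V x) = norm x)"


section \<open>Von Neumann algebras\<close>

definition von_neumann_algebra :: "('h::complex_hilbert_space \<Rightarrow>\<^sub>L 'h) set \<Rightarrow> bool" where
  "von_neumann_algebra M \<longleftrightarrow>
     M \<subseteq> bounded_ops \<and> id_blinfun \<in> M \<and>
     (\<forall>S\<in>M. \<forall>T\<in>M. S + T \<in> M \<and> S o\<^sub>L T \<in> M) \<and>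
     (\<forall>c. \<forall>T\<in>M. scaleC_op c T \<in> M) \<and>
     (\<forall>T\<in>M. adj T \<in> M) \<and>
     closedin strong_operator_topology M"

definition generated_vna ::
    "('h::complex_hilbert_space \<Rightarrow>\<^sub>L 'h) \<Rightarrow> ('h \<Rightarrow>\<^sub>L 'h) set" where
  "generated_vna T = \<Inter>{A. von_neumann_algebra A \<and> T \<in> A}"

definition commutant ::
    "('h::complex_hilbert_space \<Rightarrow>\<^sub>L 'h) set \<Rightarrow> ('h \<Rightarrow>\<^sub>L 'h) set" where
  "commutant A = {T \<in> bounded_ops. \<forall>S\<in>A. T o\<^sub>L S = S o\<^sub>L T}"

definition factor :: "('h::complex_hilbert_space \<Rightarrow>\<^sub>L 'h) set \<Rightarrow> bool" where
  "factor M \<longleftrightarrow> von_neumann_algebra M \<and> commutant M \<inter> M = range scalar_op"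

text \<open>
  The predual consists of the ultraweakly continuous functionals on \<open>M\<close>, i.e. of the functionals
  \<open>T \<mapsto> \<Sum>n. \<langle>T x\<^sub>n, y\<^sub>n\<rangle>\<close> with \<open>(x\<^sub>n)\<close> and \<open>(y\<^sub>n)\<close> square-summable. Functionals are represented by
  functions on the whole operator type of which only the values on \<open>M\<close> matter. Its norm is that
  of the dual of \<open>M\<close>, and \<open>separable_predual\<close> is separability in that norm.
\<close>

definition predual ::
    "('h::complex_hilbert_space \<Rightarrow>\<^sub>L 'h) set \<Rightarrow> (('h \<Rightarrow>\<^sub>L 'h) \<Rightarrow> complex) set" where
  "predual M = {\<phi>. \<exists>x y :: nat \<Rightarrow> 'h.
     summable (\<lambda>n. (norm (x n))\<^sup>2) \<and> summable (\<lambda>n. (norm (y n))\<^sup>2) \<and>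
     (\<forall>T\<in>M. (\<lambda>n. cinner (blinfun_apply T (x n)) (y n)) sums \<phi> T)}"

definition separable_predual :: "('h::complex_hilbert_space \<Rightarrow>\<^sub>L 'h) set \<Rightarrow> bool" where
  "separable_predual M \<longleftrightarrow>
     (\<exists>D. countable D \<and> D \<subseteq> predual M \<and>
        (\<forall>\<phi>\<in>predual M. \<forall>e>0. \<exists>\<psi>\<in>D. \<forall>T\<in>M. cmod (\<phi> T - \<psi> T) \<le> e * norm T))"

definition separable_factor :: "('h::complex_hilbert_space \<Rightarrow>\<^sub>L 'h) set \<Rightarrow> bool" where
  "separable_factor M \<longleftrightarrow> factor M \<and> separable_predual M"

definition irreducible_in ::
    "('h::complex_hilbert_space \<Rightarrow>\<^sub>L 'h) set \<Rightarrow> ('h \<Rightarrow>\<^sub>L 'h) \<Rightarrow> bool" where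
  "irreducible_in M T \<longleftrightarrow> T \<in> M \<and> commutant (generated_vna T) \<inter> M = range scalar_op"

definition mvn_equiv ::
    "('h::complex_hilbert_space \<Rightarrow>\<^sub>L 'h) set \<Rightarrow> ('h \<Rightarrow>\<^sub>L 'h) \<Rightarrow> ('h \<Rightarrow>\<^sub>L 'h) \<Rightarrow> bool" where
  "mvn_equiv M P Q \<longleftrightarrow> (\<exists>V\<in>M. partial_isometry V \<and> adj V o\<^sub>L V = P \<and> V o\<^sub>L adj V = Q)"

definition mvn_le ::
    "('h::complex_hilbert_space \<Rightarrow>\<^sub>L 'h) set \<Rightarrow> ('h \<Rightarrow>\<^sub>L 'h) \<Rightarrow> ('h \<Rightarrow>\<^sub>L 'h) \<Rightarrow> bool" where
  "mvn_le M P Q \<longleftrightarrow> (\<exists>Q0\<in>M. projection Q0 \<and> op_le Q0 Q \<and> mvn_equiv M P Q0)"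

end

theory Submission
  imports Defs "HOL-Complex_Analysis.Complex_Analysis"
begin

text \<open>
  If \<open>X N X\<^sup>-\<^sup>1\<close> is irreducible, then \<open>A = \<lambda>I - X N X\<^sup>-\<^sup>1\<close> and \<open>A\<^sup>*\<close> have no common kernel, since the
  projection onto it would commute with both. Hence the kernel projection of \<open>A\<close> is subequivalent
  to \<open>R(A)\<close>, and the similarity carries both over to \<open>\<lambda>I - N\<close>, which gives (1). For (2), an operator with
  a quadratic minimal polynomial is an affine function of an idempotent, and an irreducible idempotent
  generates \<open>2 \<times> 2\<close> matrix units which span \<open>M\<close>.

  Conversely, (1) and (2) allow one to split \<open>I\<close> into three nonzero spectral projections of \<open>N\<close>, each
  subequivalent to its complement. There is a self-adjoint \<open>K\<close> with vanishing diagonal blocks such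
  that only scalars commute with \<open>K\<close> and these projections; the similarity by \<open>(I + \<epsilon>K)\<^sup>1\<^sup>/\<^sup>2\<close> is
  then irreducible, since the diagonal and off-diagonal parts of the commutation relation separate.
\<close>

section \<open>Riesz representation and adjoints\<close>

text \<open>Two blocks would not do: there \<open>K\<close> has a single entry \<open>k\<close>, and
  any pair of projections intertwined by \<open>k\<close> commutes with \<open>K\<close>; such pairs
  are trivial only if the corners are one-dimensional, that is in dimension 4. Condition (1) makes
  every eigenprojection subequivalent to its complement, which no further cutting of the spectrum
  could achieve; condition (2) says that the spectrum is not carried by two points, so that a third
  piece is available. The operator \<open>X\<^sup>-\<^sup>1 R X\<close> commutes with
  \<open>N\<close> but is not known to be self-adjoint, and so the spectral projections must commute
  with the whole commutant of \<open>N\<close>, not only with its self-adjoint part. Membership in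
  \<open>M\<close> is always obtained from limits of sequences, which is why kernel projections,
  polar parts and suprema are built from explicit sequences. Separability lets one operator encode a
  whole maximal commuting family, so that a single entry of \<open>K\<close> can control it.\<close>

instance complex_hilbert_space \<subseteq> banach ..

text \<open>The representing vector minimises the strictly convex functional \<open>g\<close>: the
  parallelogram law makes a minimising sequence Cauchy, and the vanishing derivative at the minimum
  is the representation.\<close>

lemma riesz_representation:
  fixes f :: "'a::{real_inner, complete_space} \<Rightarrow> real"
  assumes "bounded_linear f"
  shows "\<exists>z. \<forall>x. f x = inner x z"
proof -
  interpret f: bounded_linear f by fact
  define g where "g x = (norm x)\<^sup>2 / 2 - f x" for x
  obtain B where B: "\<And>x. \<bar>f x\<bar> \<le> norm x * B"
    using f.bounded by auto
  have g_lower: "g x \<ge> - B\<^sup>2 / 2" for x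
  proof -
    have "0 \<le> (norm x - B)\<^sup>2" by simp
    then have "norm x * B \<le> (norm x)\<^sup>2 / 2 + B\<^sup>2 / 2"
      by (simp add: power2_diff)
    then show ?thesis using B[of x] by (simp add: g_def)
  qed
  define m where "m = Inf (range g)"
  have bdd: "bdd_below (range g)"
    using g_lower by (intro bdd_belowI2) auto
  have m_le: "m \<le> g x" for x
    unfolding m_def by (rule cInf_lower) (use bdd in auto)
  have "\<exists>x. g x < m + 1 / real (Suc n)" for n
  proof -
    have "Inf (range g) < m + 1 / real (Suc n)" by (simp add: m_def)
    then show ?thesis using cInf_lessD[of "range g"] by blast
  qed
  then obtain X where X: "\<And>n. g (X n) < m + 1 / real (Suc n)" by metis
  have par: "(norm (x - y))\<^sup>2 / 4 = g x + g y - 2 * g ((1/2) *\<^sub>R (x + y))" for x y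
    unfolding g_def f.scaleR f.add power2_norm_eq_inner
    by (simp add: inner_add_left inner_add_right inner_diff_left inner_diff_right inner_commute field_simps)
  have close: "(norm (X i - X j))\<^sup>2 \<le> 4 * (1 / real (Suc i) + 1 / real (Suc j))" for i j
  proof -
    have "N \<le> 4 * (a + b)"
      if "N / 4 = p + q - 2 * r" "p < m + a" "q < m + b" "m \<le> r" for N p q r a b :: real
      using that by (simp add: field_simps)
    from this[OF par X X m_le] show ?thesis .
  qed
  have "Cauchy X"
  proof (rule CauchyI)
    fix e :: real assume "e > 0"
    obtain n :: nat where n: "8 / e\<^sup>2 < real n" using reals_Archimedean2 by blast
    have "norm (X i - X j) < e" if "i \<ge> n" "j \<ge> n" for i j
    proof -
      have "0 < n" using n \<open>e > 0\<close> by (metis divide_pos_pos gr0I less_asym' of_nat_0 zero_less_numeral zero_less_power)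
      have "1 / real (Suc i) \<le> 1 / real n" "1 / real (Suc j) \<le> 1 / real n"
        using that \<open>0 < n\<close> by (auto simp: frac_le)
      then have "(norm (X i - X j))\<^sup>2 \<le> 8 / real n" using close[of i j] by simp
      also have "\<dots> < e\<^sup>2" using n \<open>e > 0\<close> \<open>0 < n\<close> by (simp add: field_simps)
      finally show ?thesis using \<open>e > 0\<close> power2_less_imp_less by fastforce
    qed
    then show "\<exists>M. \<forall>m\<ge>M. \<forall>n\<ge>M. norm (X m - X n) < e" by blast
  qed
  then obtain z where z: "X \<longlonglongrightarrow> z" using Cauchy_convergent convergent_def by blast
  have "(\<lambda>n. g (X n)) \<longlonglongrightarrow> g z"
    unfolding g_def by (intro tendsto_intros z f.tendsto) simp
  moreover have "(\<lambda>n. m + 1 / real (Suc n)) \<longlonglongrightarrow> m + 0"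
    using LIMSEQ_inverse_real_of_nat by (intro tendsto_intros) (simp add: inverse_eq_divide)
  ultimately have "g z \<le> m + 0"
    by (rule LIMSEQ_le) (use X less_imp_le in blast)
  then have gz: "g z \<le> g x" for x using m_le[of x] by simp
  have "f x = inner x z" for x
  proof -
    define a where "a = inner x z - f x"
    have expand: "g (z + t *\<^sub>R x) = g z + t * a + t\<^sup>2 * (norm x)\<^sup>2 / 2" for t
      unfolding g_def f.scaleR f.add power2_norm_eq_inner a_def
      by (simp add: inner_add_left inner_add_right inner_commute power2_eq_square field_simps)
    have nn: "0 \<le> t * a + t\<^sup>2 * (norm x)\<^sup>2 / 2" for t
      using gz[of "z + t *\<^sub>R x"] expand[of t] by simp
    have "a = 0"
    proof (rule ccontr)
      assume "a \<noteq> 0"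
      \<comment> \<open>The parabola \<open>t * a + t\<^sup>2 * s / 2\<close> has its minimum at
        \<open>- a / s\<close>; the added 1 keeps \<open>s\<close> positive when
        \<open>x = 0\<close>.\<close>
      define s where "s = (norm x)\<^sup>2 + 1"
      have "s > 0" by (simp add: s_def add_nonneg_pos)
      have "(- a / s) * a + (- a / s)\<^sup>2 * (norm x)\<^sup>2 / 2 \<le> (- a / s) * a + (- a / s)\<^sup>2 * s / 2"
        by (simp add: s_def mult_left_mono divide_right_mono)
      also have "\<dots> = - a\<^sup>2 / (2 * s)"
        using \<open>s > 0\<close> by (simp add: field_simps power2_eq_square)
      also have "\<dots> < 0" using \<open>s > 0\<close> \<open>a \<noteq> 0\<close> by (simp add: divide_neg_pos)
      finally show False using nn[of "- a / s"] by simp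
    qed
    then show ?thesis by (simp add: a_def)
  qed
  then show ?thesis by blast
qed

text \<open>The imaginary part of \<open>c\<close> is the real part of \<open>- \<i> * c\<close>, so
  the real inner product determines the complex one. This carries the real Riesz theorem over to
  complex adjoints.\<close>

lemma cinner_eq_inner:
  fixes x y :: "'h::complex_hilbert_space"
  shows "cinner x y = Complex (inner x y) (inner ((- \<i>) *\<^sub>C x) y)"
  by (simp add: complex_eq_iff inner_eq_Re_cinner cinner_scaleC_left)

lemma cinner_add_right: "cinner x (y + z) = cinner x y + cinner (x::'h::complex_hilbert_space) z"
  by (metis cinner_add_left cinner_commute complex_cnj_add)

lemma scaleC_zero_left [simp]: "0 *\<^sub>C x = (0::'h::complex_hilbert_space)"
  using scaleR_eq_scaleC[of 0 x] by simp

lemma scaleC_zero_right [simp]: "c *\<^sub>C 0 = (0::'h::complex_hilbert_space)"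
  by (metis mult_zero_right scaleC_scaleC scaleC_zero_left)

lemma scaleC_one [simp]: "1 *\<^sub>C x = (x::'h::complex_hilbert_space)"
  using scaleR_eq_scaleC[of 1 x] by simp

lemma scaleC_minus_one: "(- 1) *\<^sub>C x = - (x::'h::complex_hilbert_space)"
  using scaleR_eq_scaleC[of "-1" x] by simp

lemma cinner_zero_left [simp]: "cinner 0 (y::'h::complex_hilbert_space) = 0"
  using cinner_scaleC_left[of 0 0 y] by simp

lemma cinner_zero_right [simp]: "cinner (y::'h::complex_hilbert_space) 0 = 0"
  by (metis cinner_zero_left cinner_commute complex_cnj_zero)

lemma cinner_minus_left: "cinner (- x) (y::'h::complex_hilbert_space) = - cinner x y"
  using cinner_scaleC_left[of "-1" x y] by (simp add: scaleC_minus_one)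

lemma cinner_minus_right: "cinner x (- y::'h::complex_hilbert_space) = - cinner x y"
  using cinner_scaleC_right[of x "-1" y] by (simp add: scaleC_minus_one)

lemma cinner_diff_left: "cinner (x - z) (y::'h::complex_hilbert_space) = cinner x y - cinner z y"
  using cinner_add_left[of x "- z" y] by (simp add: cinner_minus_left)

lemma cinner_diff_right: "cinner x (y - z::'h::complex_hilbert_space) = cinner x y - cinner x z"
  using cinner_add_right[of x y "- z"] by (simp add: cinner_minus_right)

lemmas cinner_simps = cinner_add_left cinner_add_right cinner_diff_left cinner_diff_right
  cinner_minus_left cinner_minus_right cinner_scaleC_left cinner_scaleC_right

lemma cinner_self: "cinner x x = complex_of_real ((norm (x::'h::complex_hilbert_space))\<^sup>2)"
proof -
  have "Im (cinner x x) = 0" using cinner_commute[of x x] by (simp add: complex_eq_iff)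
  then show ?thesis
    by (simp add: complex_eq_iff power2_norm_eq_inner inner_eq_Re_cinner del: of_real_power)
qed

text \<open>Rotating \<open>x\<close> by the unimodular \<open>c\<close> makes the product real and
  nonnegative, which reduces the bound to the real Cauchy-Schwarz inequality.\<close>

lemma cmod_cinner_le: "cmod (cinner x y) \<le> norm x * norm (y::'h::complex_hilbert_space)"
proof (cases "cinner x y = 0")
  case False
  define c where "c = cnj (cinner x y) / cmod (cinner x y)"
  have c: "cmod c = 1" using False by (simp add: c_def norm_divide)
  have "c * cinner x y = cmod (cinner x y)"
    using False complex_norm_square[of "cinner x y"]
    by (simp add: c_def field_simps power2_eq_square)
  then have "cmod (cinner x y) = inner (c *\<^sub>C x) y"
    by (simp add: inner_eq_Re_cinner cinner_scaleC_left)
  also have "\<dots> \<le> norm (c *\<^sub>C x) * norm y" by (rule norm_cauchy_schwarz)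
  finally show ?thesis by (simp add: norm_scaleC c)
qed simp

lemma cinner_ext:
  assumes "\<And>x. cinner x y = cinner x (z::'h::complex_hilbert_space)"
  shows "y = z"
proof -
  have "cinner (y - z) (y - z) = 0" using assms[of "y - z"] by (simp add: cinner_diff_right)
  then show ?thesis by (simp add: cinner_self)
qed

lemma bounded_bilinear_cinner:
  "bounded_bilinear (cinner :: 'h::complex_hilbert_space \<Rightarrow> 'h \<Rightarrow> complex)"
proof
  show "\<exists>K. \<forall>a b::'h. norm (cinner a b) \<le> norm a * norm b * K"
    by (rule exI[of _ 1]) (simp add: cmod_cinner_le)
qed (simp_all add: cinner_simps scaleR_eq_scaleC scaleR_conv_of_real)

lemmas tendsto_cinner = bounded_bilinear.tendsto[OF bounded_bilinear_cinner]

lemma blinfun_adjoint_exists: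
  fixes T :: "'h::complex_hilbert_space \<Rightarrow>\<^sub>L 'h"
  assumes T: "T \<in> bounded_ops"
  shows "\<exists>S\<in>bounded_ops. \<forall>x y. cinner (blinfun_apply T x) y = cinner x (blinfun_apply S y)"
proof -
  have Tc: "blinfun_apply T (c *\<^sub>C x) = c *\<^sub>C blinfun_apply T x" for c x
    using T by (simp add: bounded_ops_def)
  have "\<exists>z. \<forall>x. inner (blinfun_apply T x) y = inner x z" for y
    by (rule riesz_representation)
      (auto intro: bounded_linear_compose[OF bounded_linear_inner_left] blinfun.bounded_linear_right)
  then obtain S where S: "\<And>x y. inner (blinfun_apply T x) y = inner x (S y)" by metis
  have SC: "cinner (blinfun_apply T x) y = cinner x (S y)" for x y
    unfolding cinner_eq_inner by (simp add: S flip: Tc)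
  have lin: "S (x + y) = S x + S y" "S (c *\<^sub>C x) = c *\<^sub>C S x" for x y c
    by (rule cinner_ext, simp add: cinner_simps flip: SC)+
  \<comment> \<open>Testing the adjoint identity at \<open>S y\<close> itself bounds
    \<open>S\<close> by the norm of \<open>T\<close>.\<close>
  have bd: "norm (S y) \<le> norm y * norm T" for y
  proof -
    have "norm (S y) * norm (S y) = inner (blinfun_apply T (S y)) y"
      by (simp add: S dot_square_norm power2_eq_square)
    also have "\<dots> \<le> norm (blinfun_apply T (S y)) * norm y" by (rule norm_cauchy_schwarz)
    also have "\<dots> \<le> norm T * norm (S y) * norm y"
      by (intro mult_right_mono norm_blinfun) simp
    finally show ?thesis
      by (cases "norm (S y) = 0") (simp_all add: mult.commute mult.left_commute)
  qed
  have "bounded_linear S"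
    by (rule bounded_linear_intro[where K = "norm T"]) (simp_all add: lin bd scaleR_eq_scaleC)
  then have *: "blinfun_apply (Blinfun S) = S" by (rule bounded_linear_Blinfun_apply)
  show ?thesis
    by (rule bexI[of _ "Blinfun S"]) (simp_all add: * SC bounded_ops_def lin)
qed

lemma adj_unique:
  fixes T :: "'h::complex_hilbert_space \<Rightarrow>\<^sub>L 'h"
  assumes "\<And>x y. cinner (blinfun_apply T x) y = cinner x (blinfun_apply S y)"
  shows "adj T = S"
  unfolding adj_def
proof (rule the_equality)
  fix S' assume "\<forall>x y. cinner (blinfun_apply T x) y = cinner x (blinfun_apply S' y)"
  then show "S' = S" by (intro blinfun_eqI cinner_ext) (simp flip: assms)
qed (use assms in blast)

lemma adj_props:
  fixes T :: "'h::complex_hilbert_space \<Rightarrow>\<^sub>L 'h"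
  assumes "T \<in> bounded_ops"
  shows "adj T \<in> bounded_ops"
    and "cinner (blinfun_apply T x) y = cinner x (blinfun_apply (adj T) y)"
  using blinfun_adjoint_exists[OF assms] adj_unique[of T] by metis+

section \<open>The algebra of bounded operators\<close>

text \<open>A type of their own makes the complex-linear operators a Banach algebra, so that ring
  simplification and norm convergent series apply directly.\<close>

typedef (overloaded) 'h cop = "bounded_ops :: ('h::complex_hilbert_space \<Rightarrow>\<^sub>L 'h) set"
  morphisms op_of Cop
  by (rule exI[of _ id_blinfun]) (simp add: bounded_ops_def)

setup_lifting type_definition_cop

definition app :: "'h::complex_hilbert_space cop \<Rightarrow> 'h \<Rightarrow> 'h" (infixr "\<cdot>" 75) where
  "app T x = blinfun_apply (op_of T) x"

lemma cop_eqI: "(\<And>x. S \<cdot> x = T \<cdot> x) \<Longrightarrow> S = T"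
  by (simp add: app_def blinfun_eqI op_of_inject[symmetric])

text \<open>The unit is added through \<open>monoid_mult\<close> because the zero space is allowed:
  there \<open>1 = 0\<close>, which contradicts \<open>norm 1 = 1\<close> in
  \<open>real_normed_algebra_1\<close>.\<close>

instantiation cop :: (complex_hilbert_space) "{real_normed_algebra, monoid_mult}"
begin
lift_definition zero_cop :: "'a cop" is 0 by (simp add: bounded_ops_def)
lift_definition one_cop :: "'a cop" is id_blinfun by (simp add: bounded_ops_def)
lift_definition plus_cop :: "'a cop \<Rightarrow> 'a cop \<Rightarrow> 'a cop" is "(+)"
  by (simp add: bounded_ops_def blinfun.add_left scaleC_add_right)
lift_definition uminus_cop :: "'a cop \<Rightarrow> 'a cop" is uminus
  by (simp add: bounded_ops_def blinfun.minus_left) (metis scaleC_minus_one scaleC_scaleC mult.commute)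
lift_definition minus_cop :: "'a cop \<Rightarrow> 'a cop \<Rightarrow> 'a cop" is "(-)"
  by (simp add: bounded_ops_def blinfun.diff_left)
    (metis (no_types, opaque_lifting) add_diff_cancel diff_add_cancel scaleC_add_right)
lift_definition times_cop :: "'a cop \<Rightarrow> 'a cop \<Rightarrow> 'a cop" is "(o\<^sub>L)"
  by (simp add: bounded_ops_def)
lift_definition scaleR_cop :: "real \<Rightarrow> 'a cop \<Rightarrow> 'a cop" is "(*\<^sub>R)"
  by (simp add: bounded_ops_def blinfun.scaleR_left scaleR_eq_scaleC scaleC_scaleC mult.commute)
lift_definition norm_cop :: "'a cop \<Rightarrow> real" is norm .
definition dist_cop :: "'a cop \<Rightarrow> 'a cop \<Rightarrow> real" where "dist_cop S T = norm (S - T)"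
definition sgn_cop :: "'a cop \<Rightarrow> 'a cop" where "sgn_cop T = scaleR (inverse (norm T)) T"
definition uniformity_cop :: "('a cop \<times> 'a cop) filter" where
  "uniformity_cop = (INF e\<in>{0<..}. principal {(S, T). dist S T < e})"
definition open_cop :: "'a cop set \<Rightarrow> bool" where
  "open_cop U = (\<forall>S\<in>U. \<forall>\<^sub>F (S', T) in uniformity. S' = S \<longrightarrow> T \<in> U)"
instance
proof
  fix a b c :: "'a cop" and r s :: real
  show "dist a b = norm (a - b)" by (rule dist_cop_def)
  show "sgn a = scaleR (inverse (norm a)) a" by (rule sgn_cop_def)
  show "uniformity = (INF e\<in>{0<..}. principal {(S::'a cop, T). dist S T < e})"
    by (rule uniformity_cop_def)
  show "open U = (\<forall>S\<in>U. \<forall>\<^sub>F (S', T) in uniformity. S' = S \<longrightarrow> T \<in> U)" for U :: "'a cop set"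
    by (rule open_cop_def)
  note rep = op_of_inject[symmetric] zero_cop.rep_eq one_cop.rep_eq plus_cop.rep_eq
    minus_cop.rep_eq uminus_cop.rep_eq times_cop.rep_eq scaleR_cop.rep_eq norm_cop.rep_eq
  note ext = blinfun.add_left blinfun.add_right blinfun.scaleR_left blinfun.scaleR_right
  show "a + b + c = a + (b + c)" "a + b = b + a" "0 + a = a" "- a + a = 0" "a - b = a + - b"
    "r *\<^sub>R (a + b) = r *\<^sub>R a + r *\<^sub>R b" "(r + s) *\<^sub>R a = r *\<^sub>R a + s *\<^sub>R a"
    "r *\<^sub>R s *\<^sub>R a = (r * s) *\<^sub>R a" "1 *\<^sub>R a = a"
    by (simp_all add: rep scaleR_add_right scaleR_add_left)
  show "norm (a + b) \<le> norm a + norm b" "norm (r *\<^sub>R a) = \<bar>r\<bar> * norm a" "norm a = 0 \<longleftrightarrow> a = 0"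
    by (simp_all add: rep norm_triangle_ineq)
  show "norm (a * b) \<le> norm a * norm b" by (simp add: rep norm_blinfun_compose)
  show "a * b * c = a * (b * c)" "(a + b) * c = a * c + b * c" "a * (b + c) = a * b + a * c"
    "1 * a = a" "a * 1 = a" "r *\<^sub>R a * b = r *\<^sub>R (a * b)" "a * r *\<^sub>R b = r *\<^sub>R (a * b)"
    unfolding rep by (rule blinfun_eqI, simp add: ext)+
qed
end

lemma closed_bounded_ops: "closed (bounded_ops :: ('h::complex_hilbert_space \<Rightarrow>\<^sub>L 'h) set)"
proof -
  have "bounded_ops = (\<Inter>c x. {T :: 'h \<Rightarrow>\<^sub>L 'h. blinfun_apply T (c *\<^sub>C x) = c *\<^sub>C blinfun_apply T x})"
    by (auto simp: bounded_ops_def)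
  also have "closed \<dots>"
    by (intro closed_INT ballI closed_Collect_eq continuous_intros
        bounded_linear.continuous_on[OF bounded_linear_scaleC])
  finally show ?thesis .
qed

instance cop :: (complex_hilbert_space) banach
proof
  fix X :: "nat \<Rightarrow> 'a cop" assume X: "Cauchy X"
  have d: "norm (S - T) = norm (op_of S - op_of T)" for S T :: "'a cop"
    by (simp only: minus_cop.rep_eq norm_cop.rep_eq)
  have cau: "Cauchy (\<lambda>n. op_of (X n))"
    using X unfolding Cauchy_def dist_norm d .
  obtain L where L: "(\<lambda>n. op_of (X n)) \<longlonglongrightarrow> L"
    using Cauchy_convergent[OF cau] by (auto simp only: convergent_def)
  then have "L \<in> bounded_ops"
    by (rule closed_sequentially[OF closed_bounded_ops, rotated]) (rule op_of)
  then have "op_of (Cop L) = L" by (rule Cop_inverse)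
  then have "X \<longlonglongrightarrow> Cop L"
    using L unfolding LIMSEQ_iff d by (simp only:)
  then show "convergent X" by (rule convergentI)
qed

lemma app_simps [simp]:
  "0 \<cdot> x = 0" "1 \<cdot> x = x" "(S + T) \<cdot> x = S \<cdot> x + T \<cdot> x" "(S - T) \<cdot> x = S \<cdot> x - T \<cdot> x"
  "(- T) \<cdot> x = - (T \<cdot> x)" "(S * T) \<cdot> x = S \<cdot> T \<cdot> x" "(r *\<^sub>R T) \<cdot> x = r *\<^sub>R (T \<cdot> x)"
  by (simp_all add: app_def zero_cop.rep_eq one_cop.rep_eq plus_cop.rep_eq minus_cop.rep_eq
      uminus_cop.rep_eq times_cop.rep_eq scaleR_cop.rep_eq blinfun.add_left blinfun.diff_left
      blinfun.minus_left blinfun.scaleR_left)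

lemma bounded_linear_app: "bounded_linear ((\<cdot>) T)"
  unfolding app_def by (rule blinfun.bounded_linear_right)

lemma app_add: "T \<cdot> (x + y) = T \<cdot> x + T \<cdot> y"
  and app_diff: "T \<cdot> (x - y) = T \<cdot> x - T \<cdot> y"
  and app_minus: "T \<cdot> (- x) = - (T \<cdot> x)"
  and app_zero [simp]: "T \<cdot> 0 = 0"
  and app_scaleR: "T \<cdot> (r *\<^sub>R x) = r *\<^sub>R (T \<cdot> x)"
  by (simp_all add: app_def blinfun.add_right blinfun.diff_right blinfun.minus_right blinfun.scaleR_right)

lemma app_scaleC: "T \<cdot> (c *\<^sub>C x) = c *\<^sub>C (T \<cdot> x)"
  using op_of[of T] by (simp add: app_def bounded_ops_def)

lemma tendsto_app: "(X \<longlongrightarrow> x) F \<Longrightarrow> ((\<lambda>n. T \<cdot> X n) \<longlongrightarrow> T \<cdot> x) F"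
  by (rule bounded_linear.tendsto[OF bounded_linear_app])

lemma bounded_bilinear_app: "bounded_bilinear (\<cdot>)"
proof
  show "\<exists>K. \<forall>(a::'a cop) b. norm (a \<cdot> b) \<le> norm a * norm b * K"
    by (rule exI[of _ 1]) (simp add: app_def norm_cop.rep_eq norm_blinfun)
qed (simp_all add: app_add app_scaleR)

lemma tendsto_app_norm: "(X \<longlongrightarrow> T) F \<Longrightarrow> ((\<lambda>n. X n \<cdot> x) \<longlongrightarrow> T \<cdot> x) F"
  by (rule bounded_bilinear.tendsto[OF bounded_bilinear_app]) auto

lemma norm_app: "norm (T \<cdot> x) \<le> norm T * norm x"
  by (simp add: app_def norm_cop.rep_eq norm_blinfun)

lemma norm_cop_le: "0 \<le> b \<Longrightarrow> (\<And>x. norm (T \<cdot> x) \<le> b * norm x) \<Longrightarrow> norm T \<le> b"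
  by (simp add: app_def norm_cop.rep_eq norm_blinfun_bound)

lemma cop_of_linear:
  assumes "\<And>x y. f (x + y) = f x + f y" "\<And>c x. f (c *\<^sub>C x) = c *\<^sub>C f x"
    and "\<And>x. norm (f x) \<le> b * norm (x::'h::complex_hilbert_space)"
  shows "\<exists>T. \<forall>x. T \<cdot> x = f x"
proof -
  have "bounded_linear f"
    by (rule bounded_linear_intro[where K = b]) (use assms in \<open>simp_all add: scaleR_eq_scaleC mult.commute\<close>)
  then have *: "blinfun_apply (Blinfun f) = f" by (rule bounded_linear_Blinfun_apply)
  then have "Blinfun f \<in> bounded_ops" by (simp add: bounded_ops_def assms)
  then have "op_of (Cop (Blinfun f)) = Blinfun f" by (rule Cop_inverse)
  then show ?thesis by (intro exI[of _ "Cop (Blinfun f)"]) (simp add: app_def *)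
qed

lift_definition csc :: "complex \<Rightarrow> 'h::complex_hilbert_space cop" is scalar_op
  by (simp add: bounded_ops_def scalar_op.rep_eq scaleC_scaleC mult.commute)

lift_definition star :: "'h::complex_hilbert_space cop \<Rightarrow> 'h cop" is adj
  by (rule adj_props)

lemma csc_app [simp]: "csc c \<cdot> x = c *\<^sub>C x"
  by (simp add: app_def csc.rep_eq scalar_op.rep_eq)

lemma star_cinner: "cinner (T \<cdot> x) y = cinner x (star T \<cdot> y)"
  by (simp add: app_def star.rep_eq adj_props(2)[OF op_of])

lemma star_cinner': "cinner x (T \<cdot> y) = cinner (star T \<cdot> x) y"
  by (metis star_cinner cinner_commute)

lemma star_eqI: "(\<And>x y. cinner (T \<cdot> x) y = cinner x (S \<cdot> y)) \<Longrightarrow> star T = S"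
  by (intro cop_eqI cinner_ext) (simp flip: star_cinner)

lemma star_star [simp]: "star (star T) = T"
  by (rule star_eqI) (simp add: star_cinner')

lemma star_simps [simp]:
  "star 0 = 0" "star 1 = 1" "star (S + T) = star S + star T" "star (S - T) = star S - star T"
  "star (- T) = - star T" "star (S * T) = star T * star S" "star (r *\<^sub>R T) = r *\<^sub>R star T"
  "star (csc c) = csc (cnj c)"
  by (rule star_eqI; simp add: cinner_simps star_cinner scaleR_eq_scaleC)+

lemma star_power [simp]: "star (T ^ n) = star T ^ n"
  by (induction n) (simp_all add: power_commutes)

lemma star_eq_iff: "star S = star T \<longleftrightarrow> S = T"
  by (metis star_star)

lemma scaleC_minus_left: "(- c) *\<^sub>C x = - (c *\<^sub>C (x::'h::complex_hilbert_space))"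
  using scaleC_scaleC[of "-1" c x] by (simp add: scaleC_minus_one)

lemma csc_mult: "csc a * csc b = csc (a * b)"
  by (rule cop_eqI) (simp add: scaleC_scaleC)

lemma csc_add: "csc a + csc b = csc (a + b)"
  by (rule cop_eqI) (simp add: scaleC_add_left)

lemma csc_minus: "- csc a = csc (- a)"
  by (rule cop_eqI) (simp add: scaleC_minus_left)

lemma csc_diff: "csc a - csc b = csc (a - b)"
  using csc_add[of a "- b"] by (simp add: csc_minus[symmetric])

lemma csc_0 [simp]: "csc 0 = 0" and csc_1 [simp]: "csc 1 = 1"
  by (rule cop_eqI, simp)+

lemma csc_commute: "T * csc a = csc a * T"
  by (rule cop_eqI) (simp add: app_scaleC)

lemma csc_of_real: "csc (of_real r) = r *\<^sub>R 1"
  by (rule cop_eqI) (simp add: scaleR_eq_scaleC)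

lemma norm_star [simp]: "norm (star T) = norm T"
proof -
  have "norm (star S) \<le> norm S" for S :: "'a cop"
  proof (rule norm_cop_le)
    fix y
    have "norm (star S \<cdot> y) * norm (star S \<cdot> y) = cmod (cinner (S \<cdot> star S \<cdot> y) y)"
      by (simp add: star_cinner cinner_self power2_eq_square norm_mult)
    also have "\<dots> \<le> norm (S \<cdot> star S \<cdot> y) * norm y" by (rule cmod_cinner_le)
    also have "\<dots> \<le> norm S * norm (star S \<cdot> y) * norm y" by (intro mult_right_mono norm_app) simp
    finally show "norm (star S \<cdot> y) \<le> norm S * norm y"
      by (cases "norm (star S \<cdot> y) = 0") (simp_all add: mult.commute mult.left_commute)
  qed simp
  from this[of T] this[of "star T"] show ?thesis by simp
qed

lemma bounded_linear_star: "bounded_linear star"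
  by (rule bounded_linear_intro[where K = 1]) simp_all

lemmas tendsto_star = bounded_linear.tendsto[OF bounded_linear_star]

lemma norm_app_sq: "(norm (T \<cdot> x))\<^sup>2 = Re (cinner (star T \<cdot> T \<cdot> x) x)"
  by (simp add: power2_norm_eq_inner inner_eq_Re_cinner star_cinner')

lemma cop_eq_0_iff_star_mult: "star T * T = 0 \<longleftrightarrow> T = 0"
proof
  assume "star T * T = 0"
  then have "star T \<cdot> T \<cdot> x = 0" for x by (metis app_simps(1,6))
  then have "norm (T \<cdot> x) = 0" for x using norm_app_sq[of T x] by simp
  then show "T = 0" by (intro cop_eqI) simp
qed simp

section \<open>Strong limits and von Neumann algebras\<close>

definition slim :: "(nat \<Rightarrow> 'h::complex_hilbert_space cop) \<Rightarrow> 'h cop \<Rightarrow> bool" where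
  "slim X L \<longleftrightarrow> (\<forall>x. (\<lambda>n. X n \<cdot> x) \<longlonglongrightarrow> L \<cdot> x)"

lemma slimD: "slim X L \<Longrightarrow> (\<lambda>n. X n \<cdot> x) \<longlonglongrightarrow> L \<cdot> x"
  by (simp add: slim_def)

lemma slim_const: "slim (\<lambda>n. T) T"
  by (simp add: slim_def)

lemma slim_norm: "X \<longlonglongrightarrow> L \<Longrightarrow> slim X L"
  by (simp add: slim_def tendsto_app_norm)

lemma slim_unique: "slim X L \<Longrightarrow> slim X L' \<Longrightarrow> L = L'"
  by (rule cop_eqI) (metis slimD LIMSEQ_unique)

lemma slim_add: "slim X L \<Longrightarrow> slim Y K \<Longrightarrow> slim (\<lambda>n. X n + Y n) (L + K)"
  by (simp add: slim_def tendsto_add)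

lemma slim_diff: "slim X L \<Longrightarrow> slim Y K \<Longrightarrow> slim (\<lambda>n. X n - Y n) (L - K)"
  by (simp add: slim_def tendsto_diff)

lemma slim_mult_left: "slim X L \<Longrightarrow> slim (\<lambda>n. T * X n) (T * L)"
  by (simp add: slim_def tendsto_app)

lemma slim_mult_right: "slim X L \<Longrightarrow> slim (\<lambda>n. X n * T) (L * T)"
  by (simp add: slim_def)

lemma slim_subseq: "slim X L \<Longrightarrow> strict_mono f \<Longrightarrow> slim (\<lambda>n. X (f n)) L"
  unfolding slim_def using LIMSEQ_subseq_LIMSEQ[of _ _ f] by (fastforce simp: o_def)

lemma slim_commute:
  assumes "slim X L" "\<And>n. S * X n = X n * S"
  shows "S * L = L * S"
  using slim_unique[OF slim_mult_left[OF assms(1), of S]] slim_mult_right[OF assms(1), of S]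
  by (simp add: assms(2))

text \<open>Taking adjoints is not strongly continuous, so the limit of the adjoints has to be
  supplied; the identity then passes to the limit weakly.\<close>

lemma slim_star_eq:
  assumes X: "slim X L" and Y: "slim Y K" and eq: "\<And>n. star (X n) = Y n"
  shows "star L = K"
proof (rule star_eqI)
  fix x y
  have "(\<lambda>n. cinner (X n \<cdot> x) y) \<longlonglongrightarrow> cinner (L \<cdot> x) y"
    by (intro tendsto_cinner slimD X tendsto_const)
  moreover have "(\<lambda>n. cinner x (Y n \<cdot> y)) \<longlonglongrightarrow> cinner x (K \<cdot> y)"
    by (intro tendsto_cinner slimD Y tendsto_const)
  ultimately show "cinner (L \<cdot> x) y = cinner x (K \<cdot> y)"
    by (simp add: star_cinner eq LIMSEQ_unique)
qed

lemma slim_exists: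
  assumes conv: "\<And>x. convergent (\<lambda>n. X n \<cdot> x)" and bd: "\<And>n x. norm (X n \<cdot> x) \<le> b * norm x"
  shows "\<exists>L. slim X L"
proof -
  obtain f where f: "\<And>x. (\<lambda>n. X n \<cdot> x) \<longlonglongrightarrow> f x"
    using conv unfolding convergent_def by metis
  have "\<exists>T. \<forall>x. T \<cdot> x = f x"
  proof (rule cop_of_linear)
    show "f (x + y) = f x + f y" for x y
      using tendsto_add[OF f f, of x y] f[of "x + y"] by (simp add: app_add LIMSEQ_unique)
    show "f (c *\<^sub>C x) = c *\<^sub>C f x" for c x
      using bounded_linear.tendsto[OF bounded_linear_scaleC f, of c x] f[of "c *\<^sub>C x"]
      by (simp add: app_scaleC LIMSEQ_unique)
    show "norm (f x) \<le> b * norm x" for x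
      by (rule Lim_bounded[OF tendsto_norm[OF f]]) (use bd in auto)
  qed
  then obtain T where "\<And>x. T \<cdot> x = f x" by blast
  then have "slim X T" using f by (simp add: slim_def)
  then show ?thesis by blast
qed

text \<open>Topological closure enters only through strong limits of sequences, so later
  constructions exhibit explicit sequences in \<open>M\<close>.\<close>

locale vn =
  fixes M :: "'h::complex_hilbert_space cop set"
  assumes one_in: "1 \<in> M"
    and add_in: "S \<in> M \<Longrightarrow> T \<in> M \<Longrightarrow> S + T \<in> M"
    and mult_in: "S \<in> M \<Longrightarrow> T \<in> M \<Longrightarrow> S * T \<in> M"
    and csc_mult_in: "T \<in> M \<Longrightarrow> csc c * T \<in> M"
    and star_in: "T \<in> M \<Longrightarrow> star T \<in> M"
    and slim_in: "(\<And>n. X n \<in> M) \<Longrightarrow> slim X L \<Longrightarrow> L \<in> M"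
begin

lemma csc_in: "csc c \<in> M"
  using csc_mult_in[OF one_in] by simp

lemma zero_in: "0 \<in> M"
  using csc_in[of 0] by simp

lemma scaleR_in: "T \<in> M \<Longrightarrow> r *\<^sub>R T \<in> M"
  using csc_mult_in[of T "of_real r"] by (simp add: csc_of_real)

lemma minus_in: "T \<in> M \<Longrightarrow> - T \<in> M"
  using scaleR_in[of T "-1"] by simp

lemma diff_in: "S \<in> M \<Longrightarrow> T \<in> M \<Longrightarrow> S - T \<in> M"
  using add_in[OF _ minus_in] by force

lemma power_in: "T \<in> M \<Longrightarrow> T ^ n \<in> M"
  by (induction n) (auto intro: one_in mult_in)

lemma sum_in: "(\<And>i. i \<in> I \<Longrightarrow> f i \<in> M) \<Longrightarrow> sum f I \<in> M"
  by (induction I rule: infinite_finite_induct) (auto intro: zero_in add_in)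

lemma lim_in: "(\<And>n. X n \<in> M) \<Longrightarrow> X \<longlonglongrightarrow> L \<Longrightarrow> L \<in> M"
  using slim_in slim_norm by blast

lemma suminf_in: "(\<And>n. f n \<in> M) \<Longrightarrow> summable f \<Longrightarrow> suminf f \<in> M"
  by (rule lim_in[of "\<lambda>n. sum f {..<n}"]) (auto intro: sum_in summable_LIMSEQ)

lemmas ins = one_in zero_in add_in diff_in mult_in minus_in star_in csc_in csc_mult_in scaleR_in
  power_in sum_in

end

lemma mult_sum_right: "(T::'h::complex_hilbert_space cop) * sum f I = (\<Sum>i\<in>I. T * f i)"
  by (rule sum_distrib_left)

section \<open>Projections\<close>

definition pr :: "'h::complex_hilbert_space cop \<Rightarrow> bool" where
  "pr P \<longleftrightarrow> P * P = P \<and> star P = P"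

lemma pr_idem: "pr P \<Longrightarrow> P * P = P"
  and pr_star: "pr P \<Longrightarrow> star P = P"
  and pr_idem': "pr P \<Longrightarrow> P * (P * T) = P * T"
  by (auto simp: pr_def mult.assoc[symmetric])

lemma pr_app_idem: "pr P \<Longrightarrow> P \<cdot> P \<cdot> x = P \<cdot> x"
  by (metis app_simps(6) pr_idem)

lemma pr_0 [simp]: "pr 0" and pr_1 [simp]: "pr 1"
  by (simp_all add: pr_def)

lemma pr_compl: "pr P \<Longrightarrow> pr (1 - P)"
  by (simp add: pr_def algebra_simps)

lemma pr_mult: "pr P \<Longrightarrow> pr Q \<Longrightarrow> P * Q = Q * P \<Longrightarrow> pr (P * Q)"
  unfolding pr_def by (metis mult.assoc star_simps(6))

lemma pr_add:
  assumes "pr P" "pr Q" "P * Q = 0" shows "pr (P + Q)"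
proof -
  have "Q * P = 0" using assms by (metis pr_star star_simps(1,6))
  then show ?thesis using assms by (simp add: pr_def algebra_simps)
qed

lemma pr_diff:
  assumes "pr P" "pr Q" "P * Q = Q" shows "pr (P - Q)"
proof -
  have "Q * P = Q" using assms by (metis pr_star star_simps(6))
  then show ?thesis using assms by (simp add: pr_def algebra_simps)
qed

lemma pr_norm_sq:
  assumes "pr P" shows "(norm (P \<cdot> x))\<^sup>2 = Re (cinner (P \<cdot> x) x)"
  using norm_app_sq[of P x] assms by (simp add: pr_star pr_app_idem)

lemma pr_pythagoras:
  assumes "pr P" shows "(norm x)\<^sup>2 = (norm (P \<cdot> x))\<^sup>2 + (norm (x - P \<cdot> x))\<^sup>2"
proof -
  have "(norm (x - P \<cdot> x))\<^sup>2 = Re (cinner (x - P \<cdot> x) x)"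
    using pr_norm_sq[OF pr_compl[OF assms], of x] by simp
  then show ?thesis
    by (simp add: pr_norm_sq[OF assms] cinner_simps power2_norm_eq_inner[of x] inner_eq_Re_cinner)
qed

lemma pr_norm_le:
  assumes "pr P" shows "norm (P \<cdot> x) \<le> norm x"
  by (rule power2_le_imp_le) (simp_all add: pr_pythagoras[OF assms, of x])

lemma pr_norm: "pr P \<Longrightarrow> norm P \<le> 1"
  by (rule norm_cop_le) (simp_all add: pr_norm_le)

lemma pr_le_sym: "pr P \<Longrightarrow> pr Q \<Longrightarrow> P * Q = Q \<longleftrightarrow> Q * P = Q"
  by (metis pr_star star_simps(6))

lemma pr_orth_sym: "pr P \<Longrightarrow> pr Q \<Longrightarrow> P * Q = 0 \<longleftrightarrow> Q * P = 0"
  by (metis pr_star star_simps(1,6))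

lemma pr_eqI:
  assumes P: "pr P" and Q: "pr Q" and fx: "\<And>x. P \<cdot> x = x \<longleftrightarrow> Q \<cdot> x = x"
  shows "P = Q"
proof -
  have "Q * P = P" by (rule cop_eqI) (simp add: fx[symmetric] pr_app_idem[OF P])
  moreover have "P * Q = Q" by (rule cop_eqI) (simp add: fx pr_app_idem[OF Q])
  ultimately show ?thesis using P Q by (metis pr_le_sym)
qed

lemma pr_slim:
  assumes "slim X L" "\<And>n. pr (X n)"
  shows "pr L"
proof -
  have s: "star L = L" by (rule slim_star_eq[OF assms(1) assms(1)]) (simp add: assms(2) pr_star)
  have "cinner (L \<cdot> L \<cdot> x) y = cinner (L \<cdot> x) y" for x y
  proof -
    have "(\<lambda>n. cinner (X n \<cdot> x) (X n \<cdot> y)) \<longlonglongrightarrow> cinner (L \<cdot> x) (L \<cdot> y)"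
      by (intro tendsto_cinner slimD assms(1))
    moreover have "cinner (X n \<cdot> x) (X n \<cdot> y) = cinner (X n \<cdot> x) y" for n
      using assms(2)[of n] by (simp add: star_cinner' pr_star pr_app_idem)
    moreover have "(\<lambda>n. cinner (X n \<cdot> x) y) \<longlonglongrightarrow> cinner (L \<cdot> x) y"
      by (intro tendsto_cinner slimD assms(1) tendsto_const)
    ultimately have "cinner (L \<cdot> x) (L \<cdot> y) = cinner (L \<cdot> x) y"
      by (simp add: LIMSEQ_unique)
    then show ?thesis by (simp add: star_cinner' s)
  qed
  then have "star (L * L) = star L" by (intro star_eqI) (simp add: star_cinner)
  then show ?thesis using s by (simp add: pr_def)
qed

lemma norm_power_app_le:
  assumes "norm (D :: 'h::complex_hilbert_space cop) \<le> 1"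
  shows "norm (D ^ n \<cdot> x) \<le> norm x"
proof (induction n)
  case (Suc n)
  have "norm (D \<cdot> D ^ n \<cdot> x) \<le> norm D * norm (D ^ n \<cdot> x)" by (rule norm_app)
  also have "\<dots> \<le> 1 * norm x" by (intro mult_mono assms Suc) auto
  finally show ?case by simp
qed simp

text \<open>
  Even powers are used because \<open>n \<mapsto> \<langle>D\<^sup>2\<^sup>n x, x\<rangle> = \<parallel>D\<^sup>n x\<parallel>\<^sup>2\<close> is decreasing for every self-adjoint
  contraction.
\<close>

lemma even_powers_slim:
  fixes D :: "'h::complex_hilbert_space cop"
  assumes sa: "star D = D" and n1: "norm D \<le> 1" and n2: "norm (1 - D) \<le> 1"
  shows "\<exists>L. pr L \<and> slim (\<lambda>n. D ^ (2 * n)) L \<and> (\<forall>x. L \<cdot> x = x \<longleftrightarrow> D \<cdot> x = x)"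
proof -
  have inner_pow: "Re (cinner (D ^ (i + j) \<cdot> x) x) = Re (cinner (D ^ i \<cdot> x) (D ^ j \<cdot> x))" for i j x
    unfolding add.commute[of i j] power_add by (simp add: star_cinner sa)
  have "\<exists>L. slim (\<lambda>n. D ^ (2 * n)) L"
  proof (rule slim_exists[where b = 1])
    fix x
    define a where "a n = (norm (D ^ n \<cdot> x))\<^sup>2" for n
    have "decseq a"
      using norm_power_app_le[OF n1, of 1] by (intro decseq_SucI) (simp add: a_def power_mono)
    then obtain l where "a \<longlonglongrightarrow> l"
      using decseq_convergent[of a 0] by (auto simp: a_def)
    then have ca: "Cauchy a" by (rule LIMSEQ_imp_Cauchy)
    have a: "Re (cinner (D ^ (2 * n) \<cdot> x) x) = a n" for n
      using inner_pow[of n n x] by (simp add: a_def power2_norm_eq_inner inner_eq_Re_cinner mult_2)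
    have diff: "(norm (D ^ (2 * m) \<cdot> x - D ^ (2 * n) \<cdot> x))\<^sup>2 = a (2 * m) + a (2 * n) - 2 * a (m + n)" for m n
    proof -
      have cross: "Re (cinner (D ^ (2 * m) \<cdot> x) (D ^ (2 * n) \<cdot> x)) = a (m + n)" for m n
        using a[of "m + n"] inner_pow[of "2 * m" "2 * n" x] by (simp add: algebra_simps)
      have "(norm (D ^ (2 * m) \<cdot> x - D ^ (2 * n) \<cdot> x))\<^sup>2 =
          Re (cinner (D ^ (2 * m) \<cdot> x) (D ^ (2 * m) \<cdot> x)) + Re (cinner (D ^ (2 * n) \<cdot> x) (D ^ (2 * n) \<cdot> x))
          - Re (cinner (D ^ (2 * m) \<cdot> x) (D ^ (2 * n) \<cdot> x)) - Re (cinner (D ^ (2 * n) \<cdot> x) (D ^ (2 * m) \<cdot> x))"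
        by (simp add: power2_norm_eq_inner inner_eq_Re_cinner cinner_simps)
      then show ?thesis unfolding cross by (simp add: add.commute[of n m] flip: mult_2)
    qed
    have "Cauchy (\<lambda>n. D ^ (2 * n) \<cdot> x)"
    proof (rule CauchyI)
      fix e :: real assume "e > 0"
      then obtain N where N: "\<And>m n. m \<ge> N \<Longrightarrow> n \<ge> N \<Longrightarrow> norm (a m - a n) < e\<^sup>2 / 2"
        using CauchyD[OF ca, of "e\<^sup>2 / 2"] by auto
      have "norm (D ^ (2 * m) \<cdot> x - D ^ (2 * n) \<cdot> x) < e" if "m \<ge> N" "n \<ge> N" for m n
      proof -
        have "norm (a (2 * m) - a (m + n)) < e\<^sup>2 / 2" "norm (a (2 * n) - a (m + n)) < e\<^sup>2 / 2"
          using N[of "2 * m" "m + n"] N[of "2 * n" "m + n"] that by simp_all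
        then have "a (2 * m) + a (2 * n) - 2 * a (m + n) < e\<^sup>2"
          unfolding real_norm_def by arith
        then show ?thesis
          unfolding diff[symmetric] using \<open>e > 0\<close> power2_less_imp_less by fastforce
      qed
      then show "\<exists>M. \<forall>m\<ge>M. \<forall>n\<ge>M. norm (D ^ (2 * m) \<cdot> x - D ^ (2 * n) \<cdot> x) < e" by blast
    qed
    then show "convergent (\<lambda>n. D ^ (2 * n) \<cdot> x)" by (rule Cauchy_convergent)
  qed (simp add: norm_power_app_le[OF n1])
  then obtain L where L: "slim (\<lambda>n. D ^ (2 * n)) L" by blast
  have Ls: "star L = L" by (rule slim_star_eq[OF L L]) (simp add: sa)
  have fix1: "L \<cdot> x = x" if "D \<cdot> x = x" for x
  proof -
    have "D ^ k \<cdot> x = x" for k by (induction k) (simp_all add: that power_Suc2 del: power_Suc)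
    then show ?thesis using slimD[OF L, of x] by (simp add: LIMSEQ_const_iff)
  qed
  have DL: "D * (D * L) = L"
  proof -
    have "slim (\<lambda>n. D ^ (2 * Suc n)) L"
      using slim_subseq[OF L, of Suc] by (simp add: strict_mono_def)
    moreover have "slim (\<lambda>n. D ^ (2 * Suc n)) (D * (D * L))"
      using slim_mult_left[OF slim_mult_left[OF L, of D], of D] by simp
    ultimately show ?thesis using slim_unique by blast
  qed
  \<comment> \<open>So far only \<open>D\<^sup>2\<close> is known to fix the range of
    \<open>L\<close>. The vector \<open>y\<close> lies in the eigenspace of \<open>D\<close> for -1,
    which \<open>norm (1 - D) \<le> 1\<close> excludes.\<close>
  have DL1: "D \<cdot> L \<cdot> x = L \<cdot> x" for x
  proof -
    define y where "y = L \<cdot> x - D \<cdot> L \<cdot> x"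
    have "D \<cdot> D \<cdot> L \<cdot> x = L \<cdot> x" using DL by (metis app_simps(6))
    then have "(1 - D) \<cdot> y = 2 *\<^sub>R y" by (simp add: y_def app_diff algebra_simps scaleR_2)
    then have "2 * norm y \<le> norm (1 - D) * norm y" using norm_app[of "1 - D" y] by simp
    also have "\<dots> \<le> norm y" using n2 by (simp add: mult_left_le_one_le)
    finally show ?thesis by (simp add: y_def)
  qed
  then have "L \<cdot> L \<cdot> x = L \<cdot> x" for x by (rule fix1)
  then have "pr L" using Ls by (auto simp: pr_def intro: cop_eqI)
  moreover have "L \<cdot> x = x \<longleftrightarrow> D \<cdot> x = x" for x using fix1 DL1[of x] by auto
  ultimately show ?thesis using L by blast
qed

section \<open>Kernel and range projections\<close>

lemma scaled_square_contraction:
  fixes T :: "'h::complex_hilbert_space cop"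
  assumes c: "c > 0" "c * (norm T)\<^sup>2 \<le> 1"
  shows "norm (1 - c *\<^sub>R (star T * T)) \<le> 1" and "norm (c *\<^sub>R (star T * T)) \<le> 1"
proof -
  let ?A = "c *\<^sub>R (star T * T)"
  have "norm ?A \<le> c * (norm T * norm T)"
    using c norm_mult_ineq[of "star T" T] by (simp add: mult_left_mono)
  also have "\<dots> \<le> 1" using c by (simp add: power2_eq_square)
  finally show "norm ?A \<le> 1" .
  show "norm (1 - ?A) \<le> 1"
  proof (rule norm_cop_le)
    fix x
    have "norm (star T \<cdot> T \<cdot> x) \<le> norm T * norm (T \<cdot> x)"
      using norm_app[of "star T" "T \<cdot> x"] by simp
    then have "(norm (star T \<cdot> T \<cdot> x))\<^sup>2 \<le> (norm T)\<^sup>2 * (norm (T \<cdot> x))\<^sup>2"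
      by (metis norm_ge_zero power_mono power_mult_distrib)
    then have "c * (c * (norm (star T \<cdot> T \<cdot> x))\<^sup>2) \<le> c * (c * ((norm T)\<^sup>2 * (norm (T \<cdot> x))\<^sup>2))"
      using c by (intro mult_left_mono) auto
    also have "\<dots> = (c * (norm T)\<^sup>2) * (c * (norm (T \<cdot> x))\<^sup>2)" by simp
    also have "\<dots> \<le> 1 * (c * (norm (T \<cdot> x))\<^sup>2)"
      using c by (intro mult_right_mono) auto
    \<comment> \<open>This is the form version of \<open>?A * ?A \<le> ?A\<close>; it absorbs half
      of the cross term in the expansion of the squared norm of
      \<open>x - ?A \<cdot> x\<close>.\<close>
    finally have *: "c\<^sup>2 * (norm (star T \<cdot> T \<cdot> x))\<^sup>2 \<le> c * (norm (T \<cdot> x))\<^sup>2"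
      by (simp add: power2_eq_square mult.assoc)
    have "inner (star T \<cdot> T \<cdot> x) x = (norm (T \<cdot> x))\<^sup>2"
      unfolding norm_app_sq inner_eq_Re_cinner ..
    moreover have "(norm (u - c *\<^sub>R v))\<^sup>2 = (norm u)\<^sup>2 - 2 * (c * inner v u) + c\<^sup>2 * (norm v)\<^sup>2" for u v :: 'h
      unfolding power2_norm_eq_inner
      by (simp add: inner_diff_left inner_diff_right inner_commute power2_eq_square)
    ultimately have "(norm ((1 - ?A) \<cdot> x))\<^sup>2 =
        (norm x)\<^sup>2 - 2 * (c * (norm (T \<cdot> x))\<^sup>2) + c\<^sup>2 * (norm (star T \<cdot> T \<cdot> x))\<^sup>2"
      by simp
    also have "\<dots> \<le> (norm x)\<^sup>2 - c * (norm (T \<cdot> x))\<^sup>2" using * by simp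
    also have "\<dots> \<le> (norm x)\<^sup>2" using c by simp
    finally show "norm ((1 - ?A) \<cdot> x) \<le> 1 * norm x"
      unfolding mult_1 by (rule power2_le_imp_le) simp
  qed simp
qed

text \<open>With \<open>D = 1 - c T\<^sup>* T\<close> the kernel of \<open>T\<close> is the fixed
  space of \<open>D\<close>, and the projection onto it is the strong limit of even powers of
  \<open>D\<close>. Commutation and membership are inherited from these powers.\<close>

lemma kernel_projection_exists:
  fixes T :: "'h::complex_hilbert_space cop"
  shows "\<exists>P. pr P \<and> (\<forall>x. P \<cdot> x = x \<longleftrightarrow> T \<cdot> x = 0) \<and>
    (\<forall>S. S * (star T * T) = star T * T * S \<longrightarrow> S * P = P * S) \<and>
    (\<exists>W. slim (\<lambda>n. star T * W n) (1 - P)) \<and> (\<forall>M. vn M \<longrightarrow> T \<in> M \<longrightarrow> P \<in> M)"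
proof -
  define c where "c = 1 / (1 + (norm T)\<^sup>2)"
  have "1 + (norm T)\<^sup>2 > 0" by (simp add: add_pos_nonneg)
  then have c: "c > 0" "c * (norm T)\<^sup>2 \<le> 1"
    by (auto simp: c_def divide_simps)
  define A where "A = c *\<^sub>R (star T * T)"
  define D where "D = 1 - A"
  have "star D = D" by (simp add: D_def A_def)
  moreover have "norm D \<le> 1" "norm (1 - D) \<le> 1"
    using scaled_square_contraction[OF c] by (simp_all add: D_def A_def)
  ultimately obtain P where P: "pr P" "slim (\<lambda>n. D ^ (2 * n)) P" "\<And>x. P \<cdot> x = x \<longleftrightarrow> D \<cdot> x = x"
    using even_powers_slim by blast
  have "D \<cdot> x = x \<longleftrightarrow> T \<cdot> x = 0" for x
  proof -
    have "D \<cdot> x = x \<longleftrightarrow> star T \<cdot> T \<cdot> x = 0" using c by (simp add: D_def A_def)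
    also have "\<dots> \<longleftrightarrow> T \<cdot> x = 0" using norm_app_sq[of T x] by auto
    finally show ?thesis .
  qed
  moreover have "S * P = P * S" if "S * (star T * T) = star T * T * S" for S
  proof (rule slim_commute[OF P(2)])
    have SD: "S * D = D * S" using that by (simp add: D_def A_def algebra_simps)
    show "S * D ^ (2 * n) = D ^ (2 * n) * S" for n
      using power_commuting_commutes[of S D] SD power_commuting_commutes[OF SD[symmetric]] by metis
  qed
  \<comment> \<open>Each \<open>1 - D ^ k\<close> has \<open>star T\<close> as a left factor, so
    \<open>1 - P\<close> is a strong limit of operators with range in that of
    \<open>star T\<close>.\<close>
  moreover have "\<exists>W. slim (\<lambda>n. star T * W n) (1 - P)"
  proof -
    have "\<exists>W. 1 - D ^ k = star T * W" for k
    proof (induction k)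
      case (Suc k)
      then obtain W where W: "1 - D ^ k = star T * W" by blast
      have "1 - D ^ Suc k = (1 - D ^ k) + A * D ^ k" by (simp add: D_def algebra_simps)
      also have "\<dots> = star T * (W + c *\<^sub>R (T * D ^ k))" by (simp add: W A_def algebra_simps)
      finally show ?case by blast
    qed (auto intro: exI[of _ 0])
    then obtain W where W: "\<And>k. 1 - D ^ k = star T * W k" by metis
    have "slim (\<lambda>n. 1 - D ^ (2 * n)) (1 - P)" by (intro slim_diff slim_const P)
    then show ?thesis unfolding W by (rule exI[of _ "\<lambda>n. W (2 * n)"])
  qed
  moreover have "P \<in> M" if "vn M" "T \<in> M" for M
  proof -
    interpret vn M by fact
    show ?thesis by (rule slim_in[OF _ P(2)]) (auto simp: D_def A_def intro!: ins that)
  qed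
  ultimately show ?thesis using P by blast
qed

definition kp :: "'h::complex_hilbert_space cop \<Rightarrow> 'h cop" where
  "kp T = (SOME P. pr P \<and> (\<forall>x. P \<cdot> x = x \<longleftrightarrow> T \<cdot> x = 0) \<and>
    (\<forall>S. S * (star T * T) = star T * T * S \<longrightarrow> S * P = P * S) \<and>
    (\<exists>W. slim (\<lambda>n. star T * W n) (1 - P)) \<and> (\<forall>M. vn M \<longrightarrow> T \<in> M \<longrightarrow> P \<in> M))"

lemma
  shows pr_kp: "pr (kp T)"
    and kp_iff: "kp T \<cdot> x = x \<longleftrightarrow> T \<cdot> x = 0"
    and kp_commute: "S * (star T * T) = star T * T * S \<Longrightarrow> S * kp T = kp T * S"
    and kp_compl_slim: "\<exists>W. slim (\<lambda>n. star T * W n) (1 - kp T)"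
    and kp_in_vn: "vn M \<Longrightarrow> T \<in> M \<Longrightarrow> kp T \<in> M"
  using someI_ex[OF kernel_projection_exists[of T]] unfolding kp_def[symmetric] by auto

lemma kp_right: "T * kp T = 0"
  by (rule cop_eqI) (simp add: kp_iff[symmetric] pr_app_idem[OF pr_kp])

lemma kp_eqI:
  assumes "pr P" "\<And>x. P \<cdot> x = x \<longleftrightarrow> T \<cdot> x = 0"
  shows "kp T = P"
  by (rule pr_eqI) (simp_all add: assms pr_kp kp_iff)

lemma kp_absorb:
  assumes "T * Q = 0" shows "kp T * Q = Q"
proof (rule cop_eqI)
  fix x
  have "T \<cdot> Q \<cdot> x = 0" using assms by (metis app_simps(1,6))
  then show "(kp T * Q) \<cdot> x = Q \<cdot> x" by (simp add: kp_iff)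
qed

text \<open>The closure of the range of \<open>T\<close> is the orthogonal complement of the kernel
  of \<open>star T\<close>.\<close>

definition rp :: "'h::complex_hilbert_space cop \<Rightarrow> 'h cop" where
  "rp T = 1 - kp (star T)"

lemma pr_rp: "pr (rp T)"
  by (simp add: rp_def pr_compl pr_kp)

lemma rp_left: "rp T * T = T"
proof -
  have "star (star T * kp (star T)) = 0" by (simp add: kp_right)
  then show ?thesis by (simp add: rp_def algebra_simps pr_star[OF pr_kp])
qed

text \<open>\<open>rp T\<close> is a strong limit of products \<open>T * W n\<close>, and
  \<open>S\<close> kills each of them.\<close>

lemma rp_absorb:
  assumes "S * T = 0" shows "S * rp T = 0"
proof -
  obtain W where W: "slim (\<lambda>n. T * W n) (rp T)"
    using kp_compl_slim[of "star T"] by (auto simp: rp_def)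
  have "slim (\<lambda>n. 0) (S * rp T)"
    using slim_mult_left[OF W, of S] assms by (simp add: mult.assoc[symmetric])
  then show ?thesis using slim_unique[OF slim_const] by metis
qed

lemma range_rp: "range ((\<cdot>) (rp T)) = closure (range ((\<cdot>) T))"
proof
  obtain W where W: "slim (\<lambda>n. T * W n) (rp T)"
    using kp_compl_slim[of "star T"] by (auto simp: rp_def)
  show "range ((\<cdot>) (rp T)) \<subseteq> closure (range ((\<cdot>) T))"
  proof
    fix y assume "y \<in> range ((\<cdot>) (rp T))"
    then obtain x where y: "y = rp T \<cdot> x" by auto
    have "(\<lambda>n. T \<cdot> W n \<cdot> x) \<longlonglongrightarrow> y" using slimD[OF W, of x] by (simp add: y)
    then show "y \<in> closure (range ((\<cdot>) T))"
      by (auto simp: closure_sequential intro!: exI[of _ "\<lambda>n. T \<cdot> W n \<cdot> x"])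
  qed
  have "range ((\<cdot>) (rp T)) = {y. rp T \<cdot> y = y}"
    using pr_app_idem[OF pr_rp] by (auto simp: image_iff) metis
  moreover have "closed {y. rp T \<cdot> y = y}"
    by (intro closed_Collect_eq bounded_linear.continuous_on[OF bounded_linear_app]) (auto intro: continuous_intros)
  moreover have "range ((\<cdot>) T) \<subseteq> range ((\<cdot>) (rp T))"
    by (metis app_simps(6) image_subset_iff rangeI rp_left)
  ultimately show "closure (range ((\<cdot>) T)) \<subseteq> range ((\<cdot>) (rp T))"
    by (simp add: closure_minimal)
qed

section \<open>Square roots, polar decomposition and spectral projections\<close>

text \<open>The root is \<open>1 - Z\<close>, where \<open>Z\<close> solves
  \<open>2 Z = C + Z\<^sup>2\<close> with \<open>C = 1 - A\<close>. The increments of the iteration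
  \<open>Y\<close> are dominated by those of the scalar iteration \<open>y\<close> for
  \<open>C = 1\<close>, which is increasing and bounded. This gives norm convergence even when
  \<open>norm C = 1\<close>, that is for non-invertible \<open>A\<close>.\<close>

lemma sqrt_exists:
  fixes A :: "'h::complex_hilbert_space cop"
  assumes sa: "star A = A" and n1: "norm (1 - A) \<le> 1"
  shows "\<exists>B. star B = B \<and> B * B = A \<and> norm (1 - B) \<le> 1 \<and>
    (\<forall>S. S * A = A * S \<longrightarrow> S * B = B * S) \<and> (\<forall>M. vn M \<longrightarrow> A \<in> M \<longrightarrow> B \<in> M)"
proof -
  define C where "C = 1 - A"
  define Y where "Y n = ((\<lambda>T. (1/2) *\<^sub>R (C + T * T)) ^^ n) 0" for n
  define y where "y n = ((\<lambda>t::real. (1/2) * (1 + t * t)) ^^ n) 0" for n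
  have Y0: "Y 0 = 0" and YS: "Y (Suc n) = (1/2) *\<^sub>R (C + Y n * Y n)" for n
    by (simp_all add: Y_def)
  have y0: "y 0 = 0" and yS: "y (Suc n) = (1/2) * (1 + y n * y n)" for n
    by (simp_all add: y_def)
  have y_bd: "0 \<le> y n \<and> y n \<le> 1" for n
  proof (induction n)
    case (Suc n)
    then have "y n * y n \<le> 1" by (simp add: mult_le_one)
    then show ?case by (simp add: yS)
  qed (simp add: y0)
  have nY: "norm (Y n) \<le> y n" for n
  proof (induction n)
    case (Suc n)
    have "norm (C + Y n * Y n) \<le> norm C + norm (Y n) * norm (Y n)"
      by (meson add_left_mono norm_mult_ineq norm_triangle_ineq order_trans)
    also have "\<dots> \<le> 1 + y n * y n"
      using n1 Suc y_bd[of n] by (intro add_mono mult_mono) (auto simp: C_def)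
    finally show ?case by (simp add: YS yS)
  qed (simp add: Y0 y0)
  have comm: "S * Y n = Y n * S" if "S * C = C * S" for S n
  proof (induction n)
    case (Suc n)
    have "S * (Y n * Y n) = Y n * Y n * S" using Suc by (metis mult.assoc)
    then show ?case using that by (simp add: YS algebra_simps)
  qed (simp add: Y0)
  have YC: "Y n * C = C * Y n" for n using comm[of C n] by simp
  have YY: "Y m * Y n = Y n * Y m" for m n by (rule comm[OF YC])
  have step: "norm (Y (Suc n) - Y n) \<le> y (Suc n) - y n" for n
  proof (induction n)
    case 0 then show ?case using n1 by (simp add: YS yS Y0 y0 C_def)
  next
    case (Suc n)
    \<comment> \<open>The iterates commute, so the difference of squares factorises and the
      induction hypothesis bounds one factor.\<close>
    have "Y (Suc (Suc n)) - Y (Suc n) = (1/2) *\<^sub>R ((Y (Suc n) - Y n) * (Y (Suc n) + Y n))"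
    proof -
      have "Y (Suc (Suc n)) - Y (Suc n) =
          (1/2) *\<^sub>R (C + Y (Suc n) * Y (Suc n)) - (1/2) *\<^sub>R (C + Y n * Y n)"
        by (rule arg_cong2[where f = minus, OF YS YS])
      then show ?thesis using YY[of n "Suc n"] by (simp add: algebra_simps)
    qed
    then have "norm (Y (Suc (Suc n)) - Y (Suc n)) = (1/2) * norm ((Y (Suc n) - Y n) * (Y (Suc n) + Y n))"
      by simp
    also have "norm ((Y (Suc n) - Y n) * (Y (Suc n) + Y n)) \<le> norm (Y (Suc n) - Y n) * norm (Y (Suc n) + Y n)"
      by (rule norm_mult_ineq)
    also have "\<dots> \<le> (y (Suc n) - y n) * (y (Suc n) + y n)"
      using Suc nY[of n] nY[of "Suc n"] norm_triangle_ineq[of "Y (Suc n)" "Y n"] norm_ge_zero[of "Y (Suc n) - Y n"]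
      by (intro mult_mono) (linarith | simp)+
    also have "(1/2) * ((y (Suc n) - y n) * (y (Suc n) + y n)) = y (Suc (Suc n)) - y (Suc n)"
    proof -
      have "y (Suc (Suc n)) - y (Suc n) = (1/2) * (1 + y (Suc n) * y (Suc n)) - (1/2) * (1 + y n * y n)"
        by (rule arg_cong2[where f = minus, OF yS yS])
      then show ?thesis by (simp add: algebra_simps)
    qed
    finally show ?case by simp
  qed
  have "incseq y"
    using order_trans[OF norm_ge_zero step] by (intro incseq_SucI) simp
  then obtain l where "y \<longlonglongrightarrow> l"
    using incseq_convergent[OF \<open>incseq y\<close>, of 1] y_bd by blast
  then have cy: "Cauchy y" by (rule LIMSEQ_imp_Cauchy)
  have tele: "norm (Y (n + k) - Y n) \<le> y (n + k) - y n" for n k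
  proof (induction k)
    case (Suc k)
    have "norm (Y (n + Suc k) - Y n) \<le> norm (Y (Suc (n + k)) - Y (n + k)) + norm (Y (n + k) - Y n)"
      using norm_triangle_ineq[of "Y (Suc (n + k)) - Y (n + k)" "Y (n + k) - Y n"] by simp
    then show ?case using Suc step[of "n + k"] by simp
  qed simp
  have "Cauchy Y"
  proof (rule CauchyI')
    fix e :: real assume "e > 0"
    then obtain N where N: "\<And>m n. m \<ge> N \<Longrightarrow> n \<ge> N \<Longrightarrow> norm (y m - y n) < e"
      using CauchyD[OF cy] by blast
    have "dist (Y m) (Y n) < e" if "m \<ge> N" "n > m" for m n
    proof -
      have "norm (Y n - Y m) \<le> y n - y m" using tele[of m "n - m"] that by simp
      also have "\<dots> < e" using N[of n m] that by simp
      finally show ?thesis by (simp add: dist_norm norm_minus_commute)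
    qed
    then show "\<exists>M. \<forall>m\<ge>M. \<forall>n>m. dist (Y m) (Y n) < e" by blast
  qed
  then obtain Z where Z: "Y \<longlonglongrightarrow> Z" by (auto simp: convergent_def dest!: Cauchy_convergent)
  have "(\<lambda>n. Y (Suc n)) \<longlonglongrightarrow> (1/2) *\<^sub>R (C + Z * Z)"
    unfolding YS by (intro tendsto_intros tendsto_mult Z)
  then have ZZ: "Z = (1/2) *\<^sub>R (C + Z * Z)" using LIMSEQ_Suc[OF Z] LIMSEQ_unique by blast
  have "star (Y n) = Y n" for n
    by (induction n) (simp_all add: Y0 YS C_def sa)
  then have Zs: "star Z = Z" using tendsto_star[OF Z] Z by (simp add: LIMSEQ_unique)
  have "norm Z \<le> 1"
    by (rule Lim_bounded[OF tendsto_norm[OF Z]]) (meson nY y_bd order_trans)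
  moreover have "(1 - Z) * (1 - Z) = A"
  proof -
    have "2 *\<^sub>R Z = C + Z * Z" by (subst ZZ) simp
    then have "Z + Z = 1 - A + Z * Z" by (simp add: C_def scaleR_2)
    then show ?thesis by (simp add: algebra_simps)
  qed
  moreover have "S * (1 - Z) = (1 - Z) * S" if "S * A = A * S" for S
  proof -
    have "S * C = C * S" using that by (simp add: C_def algebra_simps)
    then have "S * Z = Z * S" by (intro slim_commute[OF slim_norm[OF Z]] comm)
    then show ?thesis by (simp add: algebra_simps)
  qed
  moreover have "1 - Z \<in> M" if "vn M" "A \<in> M" for M
  proof -
    interpret vn M by fact
    have "Y n \<in> M" for n by (induction n) (auto simp: Y0 YS C_def intro!: ins that)
    then have "Z \<in> M" by (rule lim_in[OF _ Z])
    then show ?thesis by (intro diff_in one_in)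
  qed
  moreover have "star (1 - Z) = 1 - Z" "norm (1 - (1 - Z)) \<le> 1" using Zs \<open>norm Z \<le> 1\<close> by simp_all
  ultimately show ?thesis by (intro exI[of _ "1 - Z"] conjI allI impI)
qed

text \<open>The last clause, a root of \<open>B\<close>, records the positivity of \<open>B\<close>.\<close>

lemma abs_exists:
  fixes T :: "'h::complex_hilbert_space cop"
  shows "\<exists>B. star B = B \<and> B * B = star T * T \<and>
    (\<forall>S. S * (star T * T) = star T * T * S \<longrightarrow> S * B = B * S) \<and>
    (\<forall>M. vn M \<longrightarrow> T \<in> M \<longrightarrow> B \<in> M) \<and> (\<exists>R. star R = R \<and> R * R = B)"
proof -
  define c where "c = 1 / (1 + (norm T)\<^sup>2)"
  have "1 + (norm T)\<^sup>2 > 0" by (simp add: add_pos_nonneg)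
  then have c: "c > 0" "c * (norm T)\<^sup>2 \<le> 1" by (auto simp: c_def divide_simps)
  define A where "A = c *\<^sub>R (star T * T)"
  have "star A = A" by (simp add: A_def)
  moreover have "norm (1 - A) \<le> 1" using scaled_square_contraction[OF c] by (simp add: A_def)
  ultimately obtain B where B: "star B = B" "B * B = A" "norm (1 - B) \<le> 1"
    "\<And>S. S * A = A * S \<Longrightarrow> S * B = B * S" "\<And>M. vn M \<Longrightarrow> A \<in> M \<Longrightarrow> B \<in> M"
    using sqrt_exists by blast
  obtain R where R: "star R = R" "R * R = B" using sqrt_exists[OF B(1,3)] by blast
  \<comment> \<open>\<open>B\<close> is a root of \<open>c *\<^sub>R (star T * T)\<close>; the
    factor \<open>r\<close> undoes the scaling that made \<open>sqrt_exists\<close>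
    applicable.\<close>
  define r where "r = 1 / sqrt c"
  have r: "r \<ge> 0" "r * (r * c) = 1" using c by (auto simp: r_def field_simps)
  have rr: "sqrt r * sqrt r = r" using r by simp
  show ?thesis
  proof (intro exI conjI allI impI)
    show "star (r *\<^sub>R B) = r *\<^sub>R B" by (simp add: B)
    show "(r *\<^sub>R B) * (r *\<^sub>R B) = star T * T" by (simp add: B A_def r)
    show "S * (r *\<^sub>R B) = (r *\<^sub>R B) * S" if "S * (star T * T) = star T * T * S" for S
      using B(4)[of S] that by (simp add: A_def)
    show "r *\<^sub>R B \<in> M" if "vn M" "T \<in> M" for M
    proof -
      interpret vn M by fact
      show ?thesis using B(5)[OF that(1)] that by (auto simp: A_def intro!: ins)
    qed
    show "star (sqrt r *\<^sub>R R) = sqrt r *\<^sub>R R" by (simp add: R)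
    show "(sqrt r *\<^sub>R R) * (sqrt r *\<^sub>R R) = r *\<^sub>R B" using r by (simp add: R)
  qed
qed

text \<open>\<open>B\<close> is the absolute value of the scaled operator \<open>U\<close>, and the
  partial Neumann sums \<open>G n\<close> invert it approximately:
  \<open>B * G n = 1 - D ^ (2 * n)\<close>. Since \<open>U\<close> and \<open>B\<close> have the
  same norm on every vector, \<open>U * G n\<close> converges strongly because the even powers of
  \<open>D\<close> do, and its limit is the partial isometry.\<close>

lemma polar_exists:
  fixes T :: "'h::complex_hilbert_space cop"
  shows "\<exists>V. star V * V = 1 - kp T \<and> (\<forall>M. vn M \<longrightarrow> T \<in> M \<longrightarrow> V \<in> M) \<and>
    (\<forall>Q. Q * T = T \<longrightarrow> Q * V = V)"
proof -
  define c where "c = 1 / (1 + (norm T)\<^sup>2)"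
  have "1 + (norm T)\<^sup>2 > 0" by (simp add: add_pos_nonneg)
  then have c: "c > 0" "c * (norm T)\<^sup>2 \<le> 1" by (auto simp: c_def divide_simps)
  define A where "A = c *\<^sub>R (star T * T)"
  have "star A = A" by (simp add: A_def)
  moreover have A1: "norm (1 - A) \<le> 1" using scaled_square_contraction[OF c] by (simp add: A_def)
  ultimately obtain B where B: "star B = B" "B * B = A" "norm (1 - B) \<le> 1"
    "\<And>M. vn M \<Longrightarrow> A \<in> M \<Longrightarrow> B \<in> M"
    using sqrt_exists by blast
  define U where "U = sqrt c *\<^sub>R T"
  have BU: "cinner (B \<cdot> x) (B \<cdot> y) = cinner (U \<cdot> x) (U \<cdot> y)" for x y
  proof -
    have "star B * B = star U * U" using c by (simp add: U_def B A_def)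
    then have "star B \<cdot> B \<cdot> y = star U \<cdot> U \<cdot> y" by (metis app_simps(6))
    then show ?thesis by (simp add: star_cinner)
  qed
  have nBU: "norm (B \<cdot> x) = norm (U \<cdot> x)" for x
    using BU[of x x] by (simp add: norm_eq_sqrt_inner inner_eq_Re_cinner)
  define D where "D = 1 - B"
  have "norm (U \<cdot> x) \<le> 1 * norm x" for x
  proof -
    have "(sqrt c * norm T)\<^sup>2 \<le> 1\<^sup>2" using c by (simp add: power_mult_distrib)
    then have "sqrt c * norm T \<le> 1" by (rule power2_le_imp_le) simp
    then have "norm U \<le> 1" using c by (simp add: U_def)
    then show ?thesis using norm_app[of U x] by (meson mult_right_mono norm_ge_zero order_trans)
  qed
  then have "norm B \<le> 1" by (intro norm_cop_le) (simp_all add: nBU)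
  then obtain L where L: "pr L" "slim (\<lambda>n. D ^ (2 * n)) L" "\<And>x. L \<cdot> x = x \<longleftrightarrow> D \<cdot> x = x"
    using even_powers_slim[of D] B by (auto simp: D_def)
  have "kp T = L"
  proof (rule kp_eqI[OF L(1)])
    fix x
    have "L \<cdot> x = x \<longleftrightarrow> B \<cdot> x = 0" by (simp add: L D_def)
    also have "\<dots> \<longleftrightarrow> T \<cdot> x = 0" using nBU[of x] c by (metis U_def app_simps(7) norm_eq_zero
          real_sqrt_eq_zero_cancel_iff less_irrefl scaleR_eq_0_iff)
    finally show "L \<cdot> x = x \<longleftrightarrow> T \<cdot> x = 0" .
  qed
  define G where "G n = (\<Sum>k<2 * n. D ^ k)" for n
  have BG: "B * G n = 1 - D ^ (2 * n)" for n
  proof -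
    have "B * (\<Sum>k<m. D ^ k) = 1 - D ^ m" for m
      by (induction m) (simp_all add: algebra_simps D_def)
    then show ?thesis by (simp add: G_def)
  qed
  define V where "V n = U * G n" for n
  have diffV: "norm (V m \<cdot> x - V n \<cdot> x) = norm (D ^ (2 * m) \<cdot> x - D ^ (2 * n) \<cdot> x)" for m n x
  proof -
    have "V m \<cdot> x - V n \<cdot> x = U \<cdot> (G m \<cdot> x - G n \<cdot> x)" by (simp add: V_def app_diff)
    then have "norm (V m \<cdot> x - V n \<cdot> x) = norm (B \<cdot> (G m \<cdot> x - G n \<cdot> x))" by (simp add: nBU)
    also have "B \<cdot> (G m \<cdot> x - G n \<cdot> x) = (B * G m) \<cdot> x - (B * G n) \<cdot> x" by (simp add: app_diff)
    finally show ?thesis by (simp add: BG norm_minus_commute)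
  qed
  have "\<exists>W. slim V W"
  proof (rule slim_exists[where b = 2])
    fix x
    have "Cauchy (\<lambda>n. D ^ (2 * n) \<cdot> x)" by (rule LIMSEQ_imp_Cauchy[OF slimD[OF L(2)]])
    then have "Cauchy (\<lambda>n. V n \<cdot> x)" by (simp add: Cauchy_def dist_norm diffV)
    then show "convergent (\<lambda>n. V n \<cdot> x)" by (rule Cauchy_convergent)
  next
    fix n x
    have "norm (V n \<cdot> x) = norm (D ^ (2 * n) \<cdot> x - x)"
      using diffV[of n x 0] by (simp add: V_def G_def)
    also have "\<dots> \<le> norm (D ^ (2 * n) \<cdot> x) + norm x" by (rule norm_triangle_ineq4)
    also have "\<dots> \<le> 2 * norm x" using norm_power_app_le[of D "2 * n" x] B by (simp add: D_def)
    finally show "norm (V n \<cdot> x) \<le> 2 * norm x" .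
  qed
  then obtain W where W: "slim V W" by blast
  have "star W * W = 1 - L"
  proof -
    have "cinner ((star W * W) \<cdot> x) y = cinner ((1 - L) \<cdot> x) y" for x y
    proof -
      have "(\<lambda>n. cinner (V n \<cdot> x) (V n \<cdot> y)) \<longlonglongrightarrow> cinner (W \<cdot> x) (W \<cdot> y)"
        by (intro tendsto_cinner slimD[OF W])
      moreover have "cinner (V n \<cdot> x) (V n \<cdot> y) = cinner ((1 - D ^ (2 * n)) \<cdot> x) ((1 - D ^ (2 * n)) \<cdot> y)" for n
        unfolding V_def BG[symmetric] by (simp add: BU)
      moreover have "(\<lambda>n. cinner ((1 - D ^ (2 * n)) \<cdot> x) ((1 - D ^ (2 * n)) \<cdot> y))
          \<longlonglongrightarrow> cinner ((1 - L) \<cdot> x) ((1 - L) \<cdot> y)"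
        by (intro tendsto_cinner slimD slim_diff slim_const L)
      ultimately have "cinner (W \<cdot> x) (W \<cdot> y) = cinner ((1 - L) \<cdot> x) ((1 - L) \<cdot> y)"
        using LIMSEQ_unique by simp
      then show ?thesis
        by (metis L(1) app_simps(6) pr_compl pr_idem pr_star star_cinner')
    qed
    then have "star (star W * W) = star (1 - L)"
      by (intro star_eqI) (metis star_cinner)
    then show ?thesis by (simp only: star_eq_iff)
  qed
  moreover have "W \<in> M" if "vn M" "T \<in> M" for M
  proof -
    interpret vn M by fact
    have "A \<in> M" using that by (auto simp: A_def intro!: ins)
    then have "B \<in> M" by (rule B(4)[OF that(1)])
    then show ?thesis
      using that by (intro slim_in[OF _ W]) (auto simp: V_def U_def G_def D_def intro!: ins)
  qed
  moreover have "Q * W = W" if "Q * T = T" for Q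
  proof -
    have "Q * V n = V n" for n using that by (simp add: V_def U_def mult.assoc[symmetric])
    then show ?thesis using slim_unique[OF slim_mult_left[OF W, of Q]] W by simp
  qed
  ultimately show ?thesis using \<open>kp T = L\<close> by blast
qed

text \<open>\<open>P\<close> is the kernel projection of \<open>A + B\<close>, with \<open>B\<close>
  the absolute value of \<open>A\<close>. On it \<open>A = - B\<close>; off it \<open>A = B\<close>,
  because \<open>A - B\<close> annihilates the range of \<open>A + B\<close>. The root
  \<open>R\<close> of \<open>B\<close> yields the signs and the strictness.\<close>

lemma spectral_projection_exists:
  fixes A :: "'h::complex_hilbert_space cop"
  assumes sa: "star A = A"
  shows "\<exists>P. pr P \<and> (\<forall>M. vn M \<longrightarrow> A \<in> M \<longrightarrow> P \<in> M) \<and> (\<forall>S. S * A = A * S \<longrightarrow> S * P = P * S) \<and>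
    (\<forall>x. P \<cdot> x = x \<longrightarrow> Re (cinner (A \<cdot> x) x) \<le> 0) \<and>
    (\<forall>x. P \<cdot> x = 0 \<longrightarrow> Re (cinner (A \<cdot> x) x) \<ge> 0 \<and> (Re (cinner (A \<cdot> x) x) = 0 \<longrightarrow> x = 0))"
proof -
  obtain B R where B: "star B = B" "B * B = A * A" "\<And>S. S * (A * A) = A * A * S \<Longrightarrow> S * B = B * S"
    "\<And>M. vn M \<Longrightarrow> A \<in> M \<Longrightarrow> B \<in> M" and R: "star R = R" "R * R = B"
    using abs_exists[of A] unfolding sa by blast
  have Bform: "Re (cinner (B \<cdot> x) x) = (norm (R \<cdot> x))\<^sup>2" for x
    by (simp add: R(1) norm_app_sq flip: R(2))
  define G where "G = A + B"
  have Gs: "star G = G" by (simp add: G_def sa B)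
  have AB: "A * B = B * A" by (rule B(3)) (simp add: mult.assoc)
  have ABG: "(A - B) * G = 0" by (simp add: G_def algebra_simps AB B(2))
  define P where "P = kp G"
  have "pr P" by (simp add: P_def pr_kp)
  moreover have "P \<in> M" if "vn M" "A \<in> M" for M
  proof -
    interpret vn M by fact
    show ?thesis unfolding P_def G_def
      by (rule kp_in_vn[OF that(1)]) (intro ins that B)
  qed
  moreover have "S * P = P * S" if "S * A = A * S" for S
  proof -
    have "S * (A * A) = A * A * S" using that by (metis mult.assoc)
    then have "S * B = B * S" by (rule B(3))
    then have "S * G = G * S" using that by (simp add: G_def algebra_simps)
    then have "S * (star G * G) = star G * G * S" unfolding Gs by (metis mult.assoc)
    then show ?thesis unfolding P_def by (rule kp_commute)
  qed
  moreover have "Re (cinner (A \<cdot> x) x) \<le> 0" if "P \<cdot> x = x" for x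
  proof -
    have "G \<cdot> x = 0" using that by (simp add: P_def kp_iff)
    then have "A \<cdot> x = - (B \<cdot> x)" by (simp add: G_def add_eq_0_iff2)
    then show ?thesis using Bform[of x] by (simp add: cinner_simps)
  qed
  moreover have "Re (cinner (A \<cdot> x) x) \<ge> 0 \<and> (Re (cinner (A \<cdot> x) x) = 0 \<longrightarrow> x = 0)" if "P \<cdot> x = 0" for x
  proof -
    have "(A - B) * rp G = 0" by (rule rp_absorb[OF ABG])
    then have "(A - B) * (1 - P) = 0" by (simp add: rp_def Gs P_def)
    then have "(A - B) \<cdot> (1 - P) \<cdot> x = 0" by (metis app_simps(1,6))
    then have AxBx: "A \<cdot> x = B \<cdot> x" using that by simp
    have "x = 0" if "R \<cdot> x = 0"
    proof -
      have "B \<cdot> x = 0" using that by (simp flip: R(2))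
      then have "P \<cdot> x = x" by (simp add: P_def kp_iff G_def AxBx)
      then show ?thesis using \<open>P \<cdot> x = 0\<close> by simp
    qed
    then show ?thesis using Bform[of x] by (simp add: AxBx)
  qed
  ultimately show ?thesis by blast
qed

section \<open>Monotone limits of projections and Murray-von Neumann subequivalence\<close>

lemma pr_incseq:
  assumes P: "\<And>n. pr (P n)" and inc: "\<And>n. P (Suc n) * P n = P n" and "m \<le> n"
  shows "P n * P m = P m"
  using \<open>m \<le> n\<close>
proof (induction n rule: dec_induct)
  case (step n)
  have "P (Suc n) * P m = P (Suc n) * P n * P m" by (simp add: step mult.assoc)
  then show ?case by (simp add: inc step)
qed (simp add: pr_idem P)

lemma pr_diff_norm:
  assumes P: "pr P" and Q: "pr Q" and PQ: "P * Q = Q"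
  shows "(norm (P \<cdot> x - Q \<cdot> x))\<^sup>2 = (norm (P \<cdot> x))\<^sup>2 - (norm (Q \<cdot> x))\<^sup>2"
  using pr_norm_sq[OF pr_diff[OF P Q PQ], of x]
  by (simp add: pr_norm_sq[OF P] pr_norm_sq[OF Q] cinner_simps)

lemma Cauchy_of_sq_diff:
  fixes X :: "nat \<Rightarrow> 'a::real_normed_vector" and a :: "nat \<Rightarrow> real"
  assumes a: "Cauchy a" and le: "\<And>m n. m \<le> n \<Longrightarrow> (norm (X n - X m))\<^sup>2 \<le> \<bar>a n - a m\<bar>"
  shows "Cauchy X"
proof (rule CauchyI')
  fix e :: real assume "e > 0"
  then obtain N where N: "\<And>m n. m \<ge> N \<Longrightarrow> n \<ge> N \<Longrightarrow> norm (a m - a n) < e\<^sup>2"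
    using CauchyD[OF a, of "e\<^sup>2"] by auto
  have "dist (X m) (X n) < e" if "m \<ge> N" "n > m" for m n
  proof -
    have "(norm (X n - X m))\<^sup>2 \<le> \<bar>a n - a m\<bar>" using that by (intro le) simp
    also have "\<dots> < e\<^sup>2" using N[of n m] that by simp
    finally show ?thesis
      using \<open>e > 0\<close> power2_less_imp_less by (fastforce simp: dist_norm norm_minus_commute)
  qed
  then show "\<exists>M. \<forall>m\<ge>M. \<forall>n>m. dist (X m) (X n) < e" by blast
qed

lemma pr_incseq_Cauchy:
  assumes P: "\<And>n. pr (P n)" and inc: "\<And>n. P (Suc n) * P n = P n"
  shows "Cauchy (\<lambda>n. (norm (P n \<cdot> x))\<^sup>2)"
proof -
  have "incseq (\<lambda>n. (norm (P n \<cdot> x))\<^sup>2)"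
    using pr_diff_norm[OF P P inc, of _ x] by (intro incseq_SucI) (metis diff_ge_0_iff_ge zero_le_power2)
  then obtain l where "(\<lambda>n. (norm (P n \<cdot> x))\<^sup>2) \<longlonglongrightarrow> l"
    using incseq_convergent[of _ "(norm x)\<^sup>2"] power_mono[OF pr_norm_le[OF P] norm_ge_zero] by metis
  then show ?thesis by (rule LIMSEQ_imp_Cauchy)
qed

lemma pr_incseq_slim:
  assumes P: "\<And>n. pr (P n)" and inc: "\<And>n. P (Suc n) * P n = P n"
  shows "\<exists>L. slim P L \<and> pr L \<and> (\<forall>n. L * P n = P n)"
proof -
  have "\<exists>L. slim P L"
  proof (rule slim_exists[where b = 1])
    show "convergent (\<lambda>n. P n \<cdot> x)" for x
      by (rule Cauchy_convergent, rule Cauchy_of_sq_diff[OF pr_incseq_Cauchy[of P, OF P inc, of x]])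
        (simp add: pr_diff_norm[OF P P pr_incseq[of P, OF P inc]])
  qed (simp add: pr_norm_le[OF P])
  then obtain L where L: "slim P L" by blast
  have "L * P n = P n" for n
  proof -
    have "slim (\<lambda>k. P (k + n) * P n) (L * P n)"
      using slim_mult_right[OF slim_subseq[OF L, of "\<lambda>k. k + n"], of "P n"]
      by (simp add: strict_mono_def)
    then have "slim (\<lambda>k. P n) (L * P n)" by (simp add: pr_incseq[of P, OF P inc])
    then show ?thesis using slim_unique[OF slim_const] by metis
  qed
  then show ?thesis using L pr_slim[OF L P] by blast
qed

lemma pr_decseq_slim:
  assumes P: "\<And>n. pr (P n)" and dec: "\<And>n. P n * P (Suc n) = P (Suc n)"
  shows "\<exists>L. slim P L \<and> pr L \<and> (\<forall>n. P n * L = L)"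
proof -
  have s: "P (Suc n) * P n = P (Suc n)" for n
    using dec pr_le_sym[OF P P] by metis
  have "(1 - P (Suc n)) * (1 - P n) = 1 - P n" for n by (simp add: algebra_simps s)
  from pr_incseq_slim[of "\<lambda>n. 1 - P n", OF pr_compl[OF P] this] obtain L where
    L: "slim (\<lambda>n. 1 - P n) L" "pr L" "\<And>n. L * (1 - P n) = 1 - P n" by blast
  have "P n * (1 - L) = 1 - L" for n
  proof -
    have "(1 - P n) * L = 1 - P n" using L(3)[of n] pr_le_sym[OF L(2) pr_compl[OF P]] by metis
    then show ?thesis by (simp add: algebra_simps)
  qed
  moreover have "slim P (1 - L)" using slim_diff[OF slim_const[of 1] L(1)] by simp
  ultimately show ?thesis using L(2) pr_compl by blast
qed

lemma pr_vec_zero: "pr P \<Longrightarrow> star V * V = P \<Longrightarrow> P \<cdot> x = 0 \<Longrightarrow> V \<cdot> x = 0"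
  using norm_app_sq[of V x] by (simp flip: app_simps(6))

lemma isometry_right:
  assumes P: "pr P" and V: "star V * V = P"
  shows "V * P = V"
proof -
  have "V \<cdot> (x - P \<cdot> x) = 0" for x
    by (rule pr_vec_zero[OF P V]) (simp add: app_diff pr_app_idem[OF P])
  then show ?thesis by (intro cop_eqI) (simp add: app_diff)
qed

lemma isometry_range:
  assumes P: "pr P" and V: "star V * V = P"
  shows "pr (V * star V)"
proof -
  have "V * star V * (V * star V) = V * (star V * V) * star V" by (simp add: mult.assoc)
  then show ?thesis by (simp add: pr_def V isometry_right[OF P V])
qed

text \<open>\<open>Q * V = V\<close> says that the final projection \<open>V * star V\<close> lies
  below \<open>Q\<close>.\<close>

definition ple :: "'h::complex_hilbert_space cop set \<Rightarrow> 'h cop \<Rightarrow> 'h cop \<Rightarrow> bool" where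
  "ple M P Q \<longleftrightarrow> (\<exists>V\<in>M. star V * V = P \<and> Q * V = V)"

section \<open>Calculus of subequivalence inside one algebra\<close>

context vn
begin

lemma kp_in: "T \<in> M \<Longrightarrow> kp T \<in> M"
  by (rule kp_in_vn) unfold_locales

lemma rp_in: "T \<in> M \<Longrightarrow> rp T \<in> M"
  unfolding rp_def by (intro ins kp_in)

lemma ple_le: "P \<in> M \<Longrightarrow> pr P \<Longrightarrow> Q * P = P \<Longrightarrow> ple M P Q"
  unfolding ple_def by (rule bexI[of _ P]) (simp_all add: pr_star pr_idem)

lemma ple_mono: "ple M P Q \<Longrightarrow> R * Q = Q \<Longrightarrow> ple M P R"
  unfolding ple_def by (metis mult.assoc)

lemma ple_trans: assumes "ple M P Q" "ple M Q R" shows "ple M P R"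
proof -
  obtain V W where V: "V \<in> M" "star V * V = P" "Q * V = V" and W: "W \<in> M" "star W * W = Q" "R * W = W"
    using assms by (auto simp: ple_def)
  have "star (W * V) * (W * V) = star V * (star W * W) * V" by (simp add: mult.assoc)
  then have "star (W * V) * (W * V) = P" by (simp add: W V mult.assoc)
  moreover have "R * (W * V) = W * V" by (simp add: W mult.assoc[symmetric])
  ultimately show ?thesis using V W mult_in unfolding ple_def by blast
qed

lemma ple_add:
  assumes "ple M P1 Q1" "ple M P2 Q2" and Q: "pr Q1" "pr Q2" "Q1 * Q2 = 0"
  shows "ple M (P1 + P2) (Q1 + Q2)"
proof -
  obtain V W where V: "V \<in> M" "star V * V = P1" "Q1 * V = V" and W: "W \<in> M" "star W * W = P2" "Q2 * W = W"
    using assms by (auto simp: ple_def)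
  have Q21: "Q2 * Q1 = 0" using Q pr_orth_sym by blast
  have "star V * W = star (Q1 * V) * (Q2 * W)" by (simp add: V W)
  also have "\<dots> = star V * (Q1 * Q2) * W" using Q(1) by (simp add: pr_star mult.assoc)
  finally have VW: "star V * W = 0" by (simp add: Q)
  then have WV: "star W * V = 0" by (metis star_simps(1,6) star_star)
  have "Q1 * W = Q1 * Q2 * W" "Q2 * V = Q2 * Q1 * V" by (simp_all add: V W mult.assoc)
  then have "(Q1 + Q2) * (V + W) = V + W" by (simp add: algebra_simps V W Q Q21)
  moreover have "star (V + W) * (V + W) = P1 + P2" by (simp add: algebra_simps V W VW WV)
  ultimately show ?thesis using V W add_in unfolding ple_def by blast
qed

text \<open>\<open>W * P\<close> has kernel projection \<open>1 - P\<close>, so its polar part is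
  isometric exactly on the range of \<open>P\<close> and inherits the range bound
  \<open>Q\<close>.\<close>

lemma ple_injI:
  assumes W: "W \<in> M" and P: "P \<in> M" "pr P" and Q: "Q * W = W"
    and inj: "\<And>x. P \<cdot> x = x \<Longrightarrow> W \<cdot> x = 0 \<Longrightarrow> x = 0"
  shows "ple M P Q"
proof -
  have k: "kp (W * P) = 1 - P"
  proof (rule kp_eqI[OF pr_compl[OF P(2)]])
    fix x
    show "(1 - P) \<cdot> x = x \<longleftrightarrow> (W * P) \<cdot> x = 0"
      using inj[of "P \<cdot> x"] by (auto simp: pr_app_idem[OF P(2)])
  qed
  obtain V where V: "star V * V = 1 - kp (W * P)" "\<And>M. vn M \<Longrightarrow> W * P \<in> M \<Longrightarrow> V \<in> M"
    "\<And>Q. Q * (W * P) = W * P \<Longrightarrow> Q * V = V"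
    using polar_exists[of "W * P"] by blast
  have "V \<in> M" by (rule V(2)) (use W P in \<open>auto intro: ins vn_axioms\<close>)
  moreover have "Q * V = V" by (rule V(3)) (simp add: Q mult.assoc[symmetric])
  ultimately show ?thesis using V(1) unfolding ple_def k by (intro bexI[of _ V]) auto
qed

text \<open>The increment \<open>V n - V m\<close> has the same norm on each vector as
  \<open>P n - P m\<close>, so strong convergence of the partial isometries follows from that of
  their initial projections.\<close>

lemma isometry_chain_limit:
  assumes P: "\<And>n. pr (P n)" and inc: "\<And>n. P (Suc n) * P n = P n" and PL: "slim P L"
    and V: "\<And>n. V n \<in> M" "\<And>n. star (V n) * V n = P n" "\<And>n. V (Suc n) * P n = V n"
  shows "\<exists>W\<in>M. slim V W \<and> star W * W = L \<and> (\<forall>n. W * P n = V n)"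
proof -
  have ext: "V n * P m = V m" if "m \<le> n" for m n
    using that
  proof (induction n rule: dec_induct)
    case base then show ?case by (rule isometry_right[OF P V(2)])
  next
    case (step n)
    have "V (Suc n) * P m = V (Suc n) * (P n * P m)"
      using pr_incseq[of P, OF P inc step(1)] by simp
    also have "\<dots> = V n * P m" by (simp add: mult.assoc[symmetric] V(3))
    finally show ?case using step by simp
  qed
  have Vnorm: "norm (V n \<cdot> x) = norm (P n \<cdot> x)" for n x
  proof -
    have "(norm (V n \<cdot> x))\<^sup>2 = (norm (P n \<cdot> x))\<^sup>2"
      using norm_app_sq[of "V n" x] pr_norm_sq[OF P, of n x] by (simp flip: V(2))
    then show ?thesis by simp
  qed
  have "\<exists>W. slim V W"
  proof (rule slim_exists[where b = 1])
    fix x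
    have "(norm (V n \<cdot> x - V m \<cdot> x))\<^sup>2 \<le> \<bar>(norm (P n \<cdot> x))\<^sup>2 - (norm (P m \<cdot> x))\<^sup>2\<bar>" if "m \<le> n" for m n
    proof -
      have Pmn: "P n * P m = P m" by (rule pr_incseq[of P, OF P inc that])
      have "V m \<cdot> x = V n \<cdot> P m \<cdot> x" by (simp flip: ext[OF that])
      then have "V n \<cdot> x - V m \<cdot> x = V n \<cdot> (x - P m \<cdot> x)" by (simp add: app_diff)
      then have "norm (V n \<cdot> x - V m \<cdot> x) = norm (P n \<cdot> (x - P m \<cdot> x))" by (simp add: Vnorm)
      also have "P n \<cdot> (x - P m \<cdot> x) = P n \<cdot> x - (P n * P m) \<cdot> x" by (simp add: app_diff)
      finally show ?thesis by (simp add: Pmn pr_diff_norm[OF P P Pmn])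
    qed
    then show "convergent (\<lambda>n. V n \<cdot> x)"
      by (intro Cauchy_convergent Cauchy_of_sq_diff[OF pr_incseq_Cauchy[of P, OF P inc, of x]])
  qed (simp add: Vnorm pr_norm_le[OF P])
  then obtain W where W: "slim V W" by blast
  have "star (star W * W) = star L"
  proof (rule star_eqI)
    fix x y
    have "(\<lambda>n. cinner (V n \<cdot> x) (V n \<cdot> y)) \<longlonglongrightarrow> cinner (W \<cdot> x) (W \<cdot> y)"
      by (intro tendsto_cinner slimD[OF W])
    moreover have "cinner (V n \<cdot> x) (V n \<cdot> y) = cinner (P n \<cdot> x) y" for n
      by (simp add: star_cinner' flip: V(2))
    moreover have "(\<lambda>n. cinner (P n \<cdot> x) y) \<longlonglongrightarrow> cinner (L \<cdot> x) y"
      by (intro tendsto_cinner slimD[OF PL] tendsto_const)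
    ultimately have "cinner (W \<cdot> x) (W \<cdot> y) = cinner (L \<cdot> x) y"
      by (simp add: LIMSEQ_unique)
    then show "cinner ((star W * W) \<cdot> x) y = cinner x (star L \<cdot> y)"
      by (simp add: star_cinner')
  qed
  then have "star W * W = L" by (simp only: star_eq_iff)
  moreover have "W * P n = V n" for n
  proof -
    have "slim (\<lambda>k. V (k + n) * P n) (W * P n)"
      using slim_mult_right[OF slim_subseq[OF W, of "\<lambda>k. k + n"], of "P n"]
      by (simp add: strict_mono_def)
    then have "slim (\<lambda>k. V n) (W * P n)" by (simp add: ext)
    then show ?thesis using slim_unique[OF slim_const] by metis
  qed
  ultimately show ?thesis using W slim_in[OF V(1) W] by blast
qed

text \<open>The Schroeder-Bernstein argument: \<open>W\<close> compresses \<open>E\<close> into itself, and the copies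
  \<open>W\<^sup>n (E - F) W\<^sup>*\<^sup>n\<close> are pairwise orthogonal, so the shift along them carries \<open>E\<close> onto \<open>F\<close>.\<close>

lemma schroeder_bernstein:
  assumes E: "E \<in> M" "pr E" and F: "F \<in> M" "pr F" and FE: "E * F = F"
    and W: "W \<in> M" "star W * W = E" "F * W = W"
  shows "\<exists>V\<in>M. star V * V = E \<and> V * star V = F"
proof -
  have WE: "W * E = W" by (rule isometry_right[OF E(2) W(2)])
  have EW: "E * W = W" by (metis FE W(3) mult.assoc)
  have sWE: "star W * E = star W" using EW E by (metis pr_star star_simps(6))
  have sWF: "star W * F = star W" using W(3) F by (metis pr_star star_simps(6))
  have FE': "F * E = F" using FE E F pr_le_sym by blast
  define r where "r n = W ^ n * (E - F) * star W ^ n" for n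
  have r0: "r 0 = E - F" and rS: "r (Suc n) = W * r n * star W" for n
    by (simp_all add: r_def mult.assoc power_commutes)
  have Er: "E * r n = r n" for n
    by (cases n) (simp_all add: r0 rS algebra_simps FE pr_idem E EW flip: mult.assoc)
  have Fr: "F * r (Suc n) = r (Suc n)" for n by (simp add: rS W(3) flip: mult.assoc)
  have prr: "pr (r n)" for n
  proof (induction n)
    case 0 show ?case by (simp add: r0 pr_diff E F FE)
  next
    case (Suc n)
    have "r (Suc n) * r (Suc n) = W * r n * (star W * W) * r n * star W" by (simp add: rS mult.assoc)
    also have "\<dots> = W * r n * (E * r n) * star W" by (simp add: W mult.assoc)
    also have "\<dots> = W * (r n * r n) * star W" by (simp add: Er mult.assoc)
    also have "\<dots> = r (Suc n)" using Suc by (simp add: rS pr_idem)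
    finally show ?case using Suc by (simp add: pr_def rS mult.assoc)
  qed
  define R where "R n = (\<Sum>k<n. r k)" for n
  have RS: "R (Suc n) = R n + r n" for n by (simp add: R_def)
  have RW: "W * R n * star W = R (Suc n) - r 0" for n
    by (induction n) (simp_all add: R_def rS algebra_simps)
  have ER: "E * R n = R n" for n by (simp add: R_def mult_sum_right Er)
  have prR: "pr (R n) \<and> R n * r n = 0" for n
  proof (induction n)
    case (Suc n)
    then have "pr (R (Suc n))" using prr[of n] pr_add[of "R n" "r n"] by (simp add: RS)
    moreover have "R (Suc n) * r (Suc n) = 0"
    proof -
      have "r 0 * F = 0" by (simp add: r0 algebra_simps FE pr_idem F)
      then have 1: "r 0 * r (Suc n) = 0" by (metis Fr mult.assoc mult_zero_left)
      have "W * R n * star W * r (Suc n) = W * R n * (star W * W) * r n * star W"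
        by (simp add: rS mult.assoc)
      also have "\<dots> = W * (R n * (E * r n)) * star W" by (simp add: W mult.assoc)
      also have "\<dots> = 0" using Suc by (simp add: Er)
      finally have 2: "W * R n * star W * r (Suc n) = 0" .
      have "R (Suc n) = r 0 + W * R n * star W" by (simp add: RW)
      then have "R (Suc n) * r (Suc n) = r 0 * r (Suc n) + W * R n * star W * r (Suc n)"
        by (simp only: distrib_right)
      then show ?thesis by (simp only: 1 2 add_0)
    qed
    ultimately show ?case by simp
  qed (simp_all add: R_def)
  have "R (Suc n) * R n = R n" for n
    using prR[of n] prr[of n] pr_orth_sym[of "R n" "r n"] by (simp add: RS algebra_simps pr_idem)
  then obtain Q where Q: "slim R Q" "pr Q"
    using pr_incseq_slim[of R] prR by blast
  have EQ: "E * Q = Q" using slim_unique[OF slim_mult_left[OF Q(1), of E]] Q(1) by (simp add: ER)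
  have QE: "Q * E = Q" using EQ E Q pr_le_sym by blast
  \<comment> \<open>Conjugation by \<open>W\<close> shifts the sum of the copies by one place, so
    exactly the first copy \<open>E - F\<close> is lost.\<close>
  have WQ: "W * Q * star W = Q - (E - F)"
  proof -
    have "slim (\<lambda>n. W * R n * star W) (W * Q * star W)"
      by (intro slim_mult_left slim_mult_right Q)
    moreover have "slim (\<lambda>n. W * R n * star W) (Q - (E - F))"
      unfolding RW r0 using slim_subseq[OF Q(1), of Suc]
      by (intro slim_diff slim_const) (simp add: strict_mono_def)
    ultimately show ?thesis by (rule slim_unique)
  qed
  have QM: "Q \<in> M"
    by (rule slim_in[OF _ Q(1)]) (auto simp: R_def r_def intro!: ins E F W)
  \<comment> \<open>The shift acts on the copies collected in \<open>Q\<close>, and the identity on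
    the rest of \<open>E\<close>.\<close>
  define V where "V = W * Q + (E - Q)"
  have "V * star V = W * (Q * Q) * star W + W * Q * (E - Q) + (E - Q) * Q * star W + (E - Q) * (E - Q)"
    by (simp add: V_def algebra_simps pr_star E Q mult.assoc)
  also have "\<dots> = F"
    using WQ by (simp add: algebra_simps EQ QE pr_idem pr_idem' E Q mult.assoc)
  finally have 1: "V * star V = F" .
  have "(E - Q) * (W * Q) = 0"
  proof -
    have "(E - Q) * (W * Q * star W) = 0"
    proof -
      have "Q * (E - F) = E - F"
      proof -
        have "slim (\<lambda>n. R (Suc n) * r 0) (Q * r 0)"
          using slim_mult_right[OF slim_subseq[OF Q(1), of Suc]] by (simp add: strict_mono_def)
        moreover have "R (Suc n) * r 0 = r 0" for n
        proof -
          have "W * R n * star W * r 0 = W * R n * (star W * F * (E - F))"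
            by (simp add: r0 sWF mult.assoc)
          also have "\<dots> = 0" by (simp add: algebra_simps FE' pr_idem F mult.assoc)
          finally have 3: "W * R n * star W * r 0 = 0" .
          have "R (Suc n) = r 0 + W * R n * star W" by (simp add: RW)
          then have "R (Suc n) * r 0 = r 0 * r 0 + W * R n * star W * r 0"
            by (simp only: distrib_right)
          then show ?thesis by (simp add: 3 pr_idem prr del: mult.assoc)
        qed
        ultimately show ?thesis using slim_unique[OF slim_const] by (metis (no_types, lifting) ext r0)
      qed
      moreover have "E * (Q * F) = Q * F" by (simp add: EQ flip: mult.assoc)
      ultimately show ?thesis unfolding WQ
        by (simp add: algebra_simps EQ QE pr_idem pr_idem' E Q FE)
    qed
    then have "(E - Q) * (W * Q * star W) * W = 0" by simp
    then have "(E - Q) * (W * (Q * (star W * W))) = 0" by (simp add: mult.assoc)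
    then show ?thesis by (simp add: W QE)
  qed
  then have c: "(E - Q) * W * Q = 0" by (simp add: mult.assoc)
  then have "star ((E - Q) * W * Q) = 0" by simp
  then have c': "Q * star W * (E - Q) = 0" by (simp add: pr_star E Q mult.assoc)
  have "star V * V = Q * (star W * W) * Q + Q * star W * (E - Q) + (E - Q) * W * Q + (E - Q) * (E - Q)"
    by (simp add: V_def algebra_simps pr_star E Q mult.assoc)
  also have "\<dots> = E"
    unfolding c c' W(2) by (simp add: algebra_simps EQ QE pr_idem E Q mult.assoc)
  finally have 2: "star V * V = E" .
  have "V \<in> M" unfolding V_def by (intro ins W QM E)
  then show ?thesis using 1 2 by blast
qed

end

section \<open>Separable factors\<close>

text \<open>
  \<open>\<Phi>\<close> evaluates a countable norm-dense family of normal functionals, and \<open>\<xi>\<close> is a countable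
  family of vectors separating \<open>M\<close>: this is all that is used of the separable predual.
\<close>

locale sepfac = vn M for M :: "'h::complex_hilbert_space cop set" +
  fixes \<Phi> :: "'h cop \<Rightarrow> nat \<Rightarrow> complex" and \<xi> :: "nat \<Rightarrow> 'h"
  assumes center: "T \<in> M \<Longrightarrow> (\<And>S. S \<in> M \<Longrightarrow> S * T = T * S) \<Longrightarrow> \<exists>c. T = csc c"
    and approx: "e > 0 \<Longrightarrow> \<exists>n. \<forall>T\<in>M. norm T \<le> 1 \<longrightarrow> cmod (cinner (T \<cdot> x) y - \<Phi> T n) \<le> e"
    and separating: "T \<in> M \<Longrightarrow> (\<And>n. T \<cdot> \<xi> n = 0) \<Longrightarrow> T = 0"
begin

text \<open>\<open>\<Phi>\<close> maps into the second countable space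
  \<open>nat \<Rightarrow> complex\<close>, and \<open>C\<close> picks one element of
  \<open>S\<close> for each basic open set that is hit. Two coefficients are approximated at once so
  that they can be compared with each other.\<close>

lemma countable_weakly_dense:
  assumes S: "S \<subseteq> M" "\<And>T. T \<in> S \<Longrightarrow> norm T \<le> 1"
  shows "\<exists>C. C \<subseteq> S \<and> countable C \<and> (\<forall>T x y x' y' e. T \<in> S \<longrightarrow> e > 0 \<longrightarrow> (\<exists>B\<in>C.
    cmod (cinner (T \<cdot> x) y - cinner (B \<cdot> x) y) < e \<and>
    cmod (cinner (T \<cdot> x') y' - cinner (B \<cdot> x') y') < e))"
proof -
  obtain \<B> :: "(nat \<Rightarrow> complex) set set" where \<B>: "countable \<B>" "topological_basis \<B>"
    using ex_countable_basis by blast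
  define pick where "pick b = (SOME T. T \<in> S \<and> \<Phi> T \<in> b)" for b
  define C where "C = pick ` {b\<in>\<B>. \<exists>T\<in>S. \<Phi> T \<in> b}"
  have pick: "pick b \<in> S \<and> \<Phi> (pick b) \<in> b" if "\<exists>T\<in>S. \<Phi> T \<in> b" for b
    unfolding pick_def by (rule someI_ex) (use that in blast)
  have "C \<subseteq> S" using pick by (auto simp: C_def)
  moreover have "countable C" using \<B> by (auto simp: C_def)
  moreover have "\<exists>B\<in>C. cmod (cinner (T \<cdot> x) y - cinner (B \<cdot> x) y) < e \<and>
      cmod (cinner (T \<cdot> x') y' - cinner (B \<cdot> x') y') < e"
    if T: "T \<in> S" and "e > 0" for T x y x' y' e
  proof -
    have e: "e / 4 > 0" using \<open>e > 0\<close> by simp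
    obtain n where n: "\<And>T. T \<in> M \<Longrightarrow> norm T \<le> 1 \<Longrightarrow> cmod (cinner (T \<cdot> x) y - \<Phi> T n) \<le> e / 4"
      using approx[OF e] by blast
    obtain m where m: "\<And>T. T \<in> M \<Longrightarrow> norm T \<le> 1 \<Longrightarrow> cmod (cinner (T \<cdot> x') y' - \<Phi> T m) \<le> e / 4"
      using approx[OF e] by blast
    define U where "U = {g :: nat \<Rightarrow> complex. cmod (\<Phi> T n - g n) < e / 4} \<inter> {g. cmod (\<Phi> T m - g m) < e / 4}"
    have "open U" unfolding U_def
      by (intro open_Int open_Collect_less continuous_intros continuous_on_product_coordinates)
    moreover have "\<Phi> T \<in> U" using e by (simp add: U_def)
    ultimately obtain b where b: "b \<in> \<B>" "\<Phi> T \<in> b" "b \<subseteq> U"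
      using topological_basisE[OF \<B>(2)] by metis
    define B where "B = pick b"
    have B: "B \<in> S" "\<Phi> B \<in> U" "B \<in> C" using pick[of b] b T by (auto simp: B_def C_def)
    have key: "cmod (u - v) < e" if "cmod (u - p) \<le> e / 4" "cmod (v - q) \<le> e / 4" "cmod (p - q) < e / 4" for u v p q
    proof -
      have "cmod (u - v) \<le> cmod (u - p) + cmod (p - q) + cmod (q - v)"
        by (smt (verit) norm_triangle_ineq4 norm_triangle_ineq diff_add_cancel add_diff_eq norm_minus_commute norm_diff_triangle_le)
      then show ?thesis using that norm_minus_commute[of q v] e by linarith
    qed
    have "T \<in> M" "norm T \<le> 1" "B \<in> M" "norm B \<le> 1" using S T B by auto
    then show ?thesis
      using B n m by (intro bexI[of _ B] conjI key[of _ "\<Phi> T n" _ "\<Phi> B n"] key[of _ "\<Phi> T m" _ "\<Phi> B m"])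
        (auto simp: U_def)
  qed
  ultimately show ?thesis by (intro exI[of _ C] conjI allI impI)
qed

text \<open>Commutation and annihilation are both equalities between two coefficients of the same
  operator; this form lets them be checked on a sequence.\<close>

lemma dense_sequence:
  assumes S: "S \<subseteq> M" "\<And>T. T \<in> S \<Longrightarrow> norm T \<le> 1" "S \<noteq> {}"
  shows "\<exists>B :: nat \<Rightarrow> 'h cop. (\<forall>n. B n \<in> S) \<and> (\<forall>T x y x' y'. T \<in> S \<longrightarrow>
    (\<forall>n. cinner (B n \<cdot> x) y = cinner (B n \<cdot> x') y') \<longrightarrow> cinner (T \<cdot> x) y = cinner (T \<cdot> x') y')"
proof -
  have "\<exists>C. C \<subseteq> S \<and> countable C \<and> (\<forall>T x y x' y' e. T \<in> S \<longrightarrow> e > 0 \<longrightarrow> (\<exists>B\<in>C.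
    cmod (cinner (T \<cdot> x) y - cinner (B \<cdot> x) y) < e \<and>
    cmod (cinner (T \<cdot> x') y' - cinner (B \<cdot> x') y') < e))"
    by (rule countable_weakly_dense[OF S(1)]) (rule S(2))
  then obtain C where C: "C \<subseteq> S" "countable C" "\<forall>T x y x' y' e. T \<in> S \<longrightarrow> e > 0 \<longrightarrow> (\<exists>B\<in>C.
    cmod (cinner (T \<cdot> x) y - cinner (B \<cdot> x) y) < e \<and>
    cmod (cinner (T \<cdot> x') y' - cinner (B \<cdot> x') y') < e)"
    by (elim exE conjE) (rule that)
  note C3 = C(3)[rule_format]
  have "C \<noteq> {}"
  proof -
    obtain T where "T \<in> S" using S(3) by blast
    then show ?thesis using C3[of T 1 0 0 0 0] by auto
  qed
  have range: "range (from_nat_into C) = C" using C(2) \<open>C \<noteq> {}\<close> by simp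
  show ?thesis
  proof (intro exI[of _ "from_nat_into C"] conjI allI impI)
    show "from_nat_into C n \<in> S" for n using from_nat_into[OF \<open>C \<noteq> {}\<close>] C(1) by blast
    fix T x y x' y' assume T: "T \<in> S"
      and eq: "\<forall>n. cinner (from_nat_into C n \<cdot> x) y = cinner (from_nat_into C n \<cdot> x') y'"
    have eqC: "cinner (B \<cdot> x) y = cinner (B \<cdot> x') y'" if "B \<in> C" for B
      using that eq range by (metis imageE)
    have "cmod (cinner (T \<cdot> x) y - cinner (T \<cdot> x') y') \<le> 0 + e" if e: "e > 0" for e
    proof -
      obtain B where B: "B \<in> C" "cmod (cinner (T \<cdot> x) y - cinner (B \<cdot> x) y) < e / 2"
        "cmod (cinner (T \<cdot> x') y' - cinner (B \<cdot> x') y') < e / 2"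
        using C3[OF T half_gt_zero[OF e], of x y x' y'] by blast
      then show ?thesis
        using norm_triangle_ineq4[of "cinner (T \<cdot> x) y - cinner (B \<cdot> x) y" "cinner (T \<cdot> x') y' - cinner (B \<cdot> x') y'"]
        by (simp add: eqC)
    qed
    then have "cmod (cinner (T \<cdot> x) y - cinner (T \<cdot> x') y') \<le> 0" by (rule field_le_epsilon)
    then show "cinner (T \<cdot> x) y = cinner (T \<cdot> x') y'" by simp
  qed
qed

text \<open>The form of \<open>P + R\<close> is the sum of two squares, so its kernel is the
  intersection of the kernels, and its range projection is the join.\<close>

lemma join_le:
  assumes P: "P \<in> M" "pr P" and R: "R \<in> M" "pr R"
  shows "\<exists>J\<in>M. pr J \<and> J * P = P \<and> J * R = R \<and> (\<forall>S. S * P = 0 \<longrightarrow> S * R = 0 \<longrightarrow> S * J = 0)"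
proof (intro bexI conjI allI impI)
  let ?J = "rp (P + R)"
  show "?J \<in> M" by (intro rp_in ins P R)
  show "pr ?J" by (rule pr_rp)
  have ann: "P \<cdot> x = 0 \<and> R \<cdot> x = 0" if "(P + R) \<cdot> x = 0" for x
  proof -
    have "Re (cinner ((P + R) \<cdot> x) x) = (norm (P \<cdot> x))\<^sup>2 + (norm (R \<cdot> x))\<^sup>2"
      by (simp add: cinner_simps pr_norm_sq P R)
    then show ?thesis using that by (simp add: sum_power2_eq_zero_iff)
  qed
  have sPR: "star (P + R) = P + R" by (simp add: pr_star P R)
  have "P * kp (P + R) = 0" "R * kp (P + R) = 0"
    using ann kp_right[of "P + R"] by (intro cop_eqI; metis app_simps(1,6))+
  then have "star (P * kp (P + R)) = 0" "star (R * kp (P + R)) = 0" by simp_all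
  then show "?J * P = P" "?J * R = R"
    by (simp_all add: rp_def sPR pr_star P R pr_kp algebra_simps del: star_simps(3))
  fix S assume "S * P = 0" "S * R = 0"
  then show "S * ?J = 0" by (intro rp_absorb) (simp add: algebra_simps)
qed

lemma scalar_projection:
  fixes P :: "'h cop"
  assumes "pr P" "P = csc c" shows "P = 0 \<or> P = 1"
proof -
  have "csc (c * c - c) = (0 :: 'h cop)"
    using pr_idem[OF assms(1)] unfolding assms(2) csc_mult csc_diff[symmetric] by simp
  then have "(c * c - c) *\<^sub>C x = (0::'h)" for x by (metis csc_app app_simps(1))
  then have "c * c - c = 0 \<or> (\<forall>x::'h. x = 0)"
    by (metis norm_scaleC norm_eq_zero mult_eq_0_iff norm_zero)
  moreover have "c * c - c = 0 \<longleftrightarrow> c = 0 \<or> c = 1" by (simp add: right_diff_distrib[symmetric] flip: mult_1_right)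
  ultimately show ?thesis using assms(2) by (auto intro: cop_eqI)
qed

lemma central_projection:
  assumes "P \<in> M" "pr P" "\<And>S. S \<in> M \<Longrightarrow> S * P = P * S"
  shows "P = 0 \<or> P = 1"
  using center[OF assms(1,3)] scalar_projection[OF assms(2)] by blast

text \<open>\<open>S * T * R = 0\<close> says that the coefficients of \<open>T\<close> between
  \<open>R \<cdot> x\<close> and \<open>star S \<cdot> y\<close> equal the trivial coefficient at
  the zero vectors; scaling reduces \<open>M\<close> to its unit ball.\<close>

lemma unit_ball_sequence:
  "\<exists>B :: nat \<Rightarrow> 'h cop. (\<forall>n. B n \<in> M \<and> norm (B n) \<le> 1) \<and>
    (\<forall>S R. (\<forall>n. S * B n * R = 0) \<longrightarrow> (\<forall>T\<in>M. S * T * R = 0))"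
proof -
  have "{T\<in>M. norm T \<le> 1} \<noteq> {}" using zero_in by force
  then have "\<exists>B :: nat \<Rightarrow> 'h cop. (\<forall>n. B n \<in> {T\<in>M. norm T \<le> 1}) \<and> (\<forall>T x y x' y'. T \<in> {T\<in>M. norm T \<le> 1} \<longrightarrow>
    (\<forall>n. cinner (B n \<cdot> x) y = cinner (B n \<cdot> x') y') \<longrightarrow> cinner (T \<cdot> x) y = cinner (T \<cdot> x') y')"
    by (intro dense_sequence) auto
  then obtain B :: "nat \<Rightarrow> 'h cop" where B: "\<forall>n. B n \<in> {T\<in>M. norm T \<le> 1}"
    and dens: "\<forall>T x y x' y'. T \<in> {T\<in>M. norm T \<le> 1} \<longrightarrow>
      (\<forall>n. cinner (B n \<cdot> x) y = cinner (B n \<cdot> x') y') \<longrightarrow> cinner (T \<cdot> x) y = cinner (T \<cdot> x') y'"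
    by (elim exE conjE) (rule that)
  have ball: "S * T * R = 0" if ann: "\<forall>n. S * B n * R = 0" and T: "T \<in> M" "norm T \<le> 1" for S R T
  proof -
    have "cinner (T \<cdot> R \<cdot> x) (star S \<cdot> y) = cinner (T \<cdot> 0) 0" for x y
    proof (rule dens[rule_format])
      fix n
      have "S \<cdot> B n \<cdot> R \<cdot> x = 0" using ann by (metis app_simps(1,6))
      then show "cinner (B n \<cdot> R \<cdot> x) (star S \<cdot> y) = cinner (B n \<cdot> 0) 0"
        by (simp only: star_cinner' star_star cinner_zero_left cinner_zero_right)
    qed (use T in simp)
    then have "cinner (S \<cdot> T \<cdot> R \<cdot> x) y = 0" for x y
      by (simp only: star_cinner[of S] cinner_zero_right)
    then have "S \<cdot> T \<cdot> R \<cdot> x = 0" for x by (metis cinner_self norm_eq_zero of_real_eq_0_iff power_eq_0_iff)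
    then show ?thesis by (intro cop_eqI) simp
  qed
  have all: "S * T * R = 0" if ann: "\<forall>n. S * B n * R = 0" and T: "T \<in> M" for S R T
  proof -
    define s where "s = 1 / (1 + norm T)"
    have "1 + norm T > 0" by (simp add: add_pos_nonneg)
    then have s: "s > 0" "norm (s *\<^sub>R T) \<le> 1" by (simp_all add: s_def)
    have "S * (s *\<^sub>R T) * R = 0" by (rule ball[OF ann]) (use s T in \<open>auto intro: ins\<close>)
    then show ?thesis using s by simp
  qed
  show ?thesis using B all by (intro exI[of _ B]) simp
qed

text \<open>\<open>Z\<close> is the central support of \<open>P\<close>, the join of the ranges of
  all \<open>T * P\<close>. It is invariant under \<open>M\<close>, hence central and 0 or 1; it
  dominates \<open>P\<close>, while \<open>Q\<close> annihilates it.\<close>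

lemma factor_prime:
  assumes P: "P \<in> M" "pr P" and Q: "Q \<in> M" "pr Q" and ann: "\<And>T. T \<in> M \<Longrightarrow> Q * T * P = 0"
  shows "P = 0 \<or> Q = 0"
proof -
  obtain B :: "nat \<Rightarrow> 'h cop" where B: "\<forall>n. B n \<in> M \<and> norm (B n) \<le> 1"
    and dens: "\<forall>S R. (\<forall>n. S * B n * R = 0) \<longrightarrow> (\<forall>T\<in>M. S * T * R = 0)"
    using unit_ball_sequence by (elim exE conjE) (rule that)
  have BM: "B n \<in> M" for n using B by simp
  \<comment> \<open>Being killed by every left annihilator of \<open>M P\<close> survives joins and
    strong limits, and so reaches \<open>Z\<close>.\<close>
  define good where "good J \<longleftrightarrow> J \<in> M \<and> pr J \<and> (\<forall>S. (\<forall>T\<in>M. S * T * P = 0) \<longrightarrow> S * J = 0)" for J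
  have good0: "good 0" by (simp add: good_def zero_in)
  have step: "\<exists>J'. good J' \<and> J' * J = J \<and> J' * (T * P) = T * P" if J: "good J" and T: "T \<in> M" for J T
  proof -
    have R: "rp (T * P) \<in> M" "pr (rp (T * P))" using T P by (auto intro!: rp_in ins pr_rp)
    have J1: "J \<in> M" "pr J" using J by (simp_all add: good_def)
    obtain J' where "J' \<in> M" and *: "pr J' \<and> J' * J = J \<and> J' * rp (T * P) = rp (T * P) \<and>
      (\<forall>S. S * J = 0 \<longrightarrow> S * rp (T * P) = 0 \<longrightarrow> S * J' = 0)"
      by (rule bexE[OF join_le[OF J1 R]])
    then have J': "J' \<in> M" "pr J'" "J' * J = J" "J' * rp (T * P) = rp (T * P)"
      "\<And>S. S * J = 0 \<Longrightarrow> S * rp (T * P) = 0 \<Longrightarrow> S * J' = 0" by simp_all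
    have "good J'" unfolding good_def
    proof (intro conjI allI impI J')
      fix S assume S: "\<forall>T\<in>M. S * T * P = 0"
      show "S * J = 0" using J S by (simp add: good_def)
      show "S * rp (T * P) = 0" using S T by (intro rp_absorb) (simp add: mult.assoc)
    qed
    moreover have "J' * (T * P) = T * P" by (metis J'(4) mult.assoc rp_left)
    ultimately show ?thesis using J' by blast
  qed
  have "\<exists>J. \<forall>n. good (J n) \<and> J (Suc n) * J n = J n \<and> J (Suc n) * (B n * P) = B n * P"
    by (rule dependent_nat_choice) (use good0 step[OF _ BM] in blast)+
  then obtain J where J: "\<And>n. good (J n)" "\<And>n. J (Suc n) * J n = J n \<and> J (Suc n) * (B n * P) = B n * P"
    by blast
  have prJ: "pr (J n)" and JM: "J n \<in> M" for n using J(1) by (auto simp: good_def)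
  obtain Z where Z: "slim J Z" "pr Z" "\<And>n. Z * J n = J n"
    using pr_incseq_slim[of J, OF prJ] J(2) by blast
  have ZM: "Z \<in> M" by (rule slim_in[OF JM Z(1)])
  have Zann: "S * Z = 0" if "\<And>T. T \<in> M \<Longrightarrow> S * T * P = 0" for S
  proof -
    have "S * J n = 0" for n using J(1) that by (simp add: good_def)
    then have "slim (\<lambda>n. 0) (S * Z)" using slim_mult_left[OF Z(1), of S] by simp
    then show ?thesis using slim_unique[OF slim_const] by metis
  qed
  have ZB: "Z * (B n * P) = B n * P" for n
  proof -
    have "Z * (B n * P) = Z * J (Suc n) * (B n * P)" using J(2)[of n] by (simp add: mult.assoc)
    then show ?thesis using J(2)[of n] by (simp add: Z(3))
  qed
  have "(1 - Z) * B n * P = 0" for n using ZB[of n] by (simp add: algebra_simps)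
  then have Z2: "(1 - Z) * T * P = 0" if "T \<in> M" for T using that dens by simp
  have "(1 - Z) * T * Z = 0" if T: "T \<in> M" for T
  proof (rule Zann)
    fix T' assume "T' \<in> M"
    then show "(1 - Z) * T * T' * P = 0" using Z2[of "T * T'"] T mult_in by (simp add: mult.assoc)
  qed
  then have ZT: "Z * T * Z = T * Z" if "T \<in> M" for T using that by (simp add: algebra_simps)
  have "S * Z = Z * S" if "S \<in> M" for S
  proof -
    have "star (Z * star S * Z) = star (star S * Z)" using ZT[OF star_in[OF that]] by simp
    then have "Z * S * Z = Z * S" by (simp add: pr_star Z mult.assoc)
    then show ?thesis using ZT[OF that] by simp
  qed
  then consider "Z = 0" | "Z = 1" using central_projection[OF ZM Z(2)] by blast
  then show ?thesis
  proof cases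
    case 1 then show ?thesis using Z2[OF one_in] by simp
  next
    case 2 then show ?thesis using Zann[of Q] ann by simp
  qed
qed

section \<open>Comparison of projections\<close>

text \<open>A sum of vector functionals at the separating vectors, with weights that force
  convergence. On a projection each summand is a squared norm, so a zero value means that all
  separating vectors are killed.\<close>

lemma weight_exists:
  "\<exists>\<phi> :: 'h cop \<Rightarrow> real. (\<forall>S T. \<phi> (S + T) = \<phi> S + \<phi> T) \<and> (\<forall>P. pr P \<longrightarrow> 0 \<le> \<phi> P) \<and>
     (\<forall>P\<in>M. pr P \<longrightarrow> \<phi> P = 0 \<longrightarrow> P = 0) \<and> (\<forall>P. pr P \<longrightarrow> \<phi> P \<le> \<phi> 1)"
proof -
  define w where "w n = (1 / 2) ^ n / (1 + (norm (\<xi> n))\<^sup>2)" for n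
  have pos: "1 + (norm (\<xi> n))\<^sup>2 > 0" for n by (simp add: add_pos_nonneg)
  have w: "w n > 0" for n using pos[of n] by (simp add: w_def)
  have wb: "w n * (norm (\<xi> n))\<^sup>2 \<le> (1 / 2) ^ n" for n
    using pos[of n] by (simp add: w_def divide_simps)
  define f where "f T n = w n * Re (cinner (T \<cdot> \<xi> n) (\<xi> n))" for T n
  have fle: "\<bar>f T n\<bar> \<le> norm T * (1 / 2) ^ n" for T n
  proof -
    have "\<bar>Re (cinner (T \<cdot> \<xi> n) (\<xi> n))\<bar> \<le> norm (T \<cdot> \<xi> n) * norm (\<xi> n)"
      using abs_Re_le_cmod cmod_cinner_le order_trans by blast
    also have "\<dots> \<le> norm T * norm (\<xi> n) * norm (\<xi> n)" by (intro mult_right_mono norm_app) simp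
    finally have "\<bar>f T n\<bar> \<le> w n * (norm T * (norm (\<xi> n))\<^sup>2)"
      using w[of n] by (simp add: f_def abs_mult power2_eq_square mult.assoc)
    also have "\<dots> = norm T * (w n * (norm (\<xi> n))\<^sup>2)" by simp
    also have "\<dots> \<le> norm T * (1 / 2) ^ n" by (intro mult_left_mono wb) simp
    finally show ?thesis .
  qed
  have summ: "summable (f T)" for T
    by (rule summable_comparison_test'[where g = "\<lambda>n. norm T * (1 / 2) ^ n" and N = 0])
      (use fle in \<open>auto intro!: summable_mult summable_geometric\<close>)
  have fpr: "f P n = w n * (norm (P \<cdot> \<xi> n))\<^sup>2" if "pr P" for P n
    by (simp add: f_def pr_norm_sq[OF that])
  show ?thesis
  proof (intro exI[of _ "\<lambda>T. suminf (f T)"] conjI allI impI ballI)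
    show "suminf (f (S + T)) = suminf (f S) + suminf (f T)" for S T
    proof -
      have "f (S + T) = (\<lambda>n. f S n + f T n)" by (simp add: f_def cinner_simps algebra_simps fun_eq_iff)
      then show ?thesis using suminf_add[OF summ summ, of S T] by simp
    qed
    show "0 \<le> suminf (f P)" if "pr P" for P
      using w by (intro suminf_nonneg summ) (simp add: fpr[OF that] less_imp_le)
    show "suminf (f P) \<le> suminf (f 1)" if "pr P" for P
      using w pr_norm_le[OF that] by (intro suminf_le summ) (simp add: fpr that less_imp_le power_mono)
    show "P = 0" if P: "P \<in> M" "pr P" "suminf (f P) = 0" for P
    proof (rule separating[OF P(1)])
      fix n
      have "f P n = 0"
        using suminf_eq_zero_iff[OF summ, of P] w P by (auto simp: fpr[OF P(2)] less_imp_le)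
      then show "P \<cdot> \<xi> n = 0" using w[of n] by (simp add: fpr[OF P(2)])
    qed
  qed
qed

text \<open>Primeness supplies a nonzero \<open>Q * T * P\<close>; its polar part is the partial
  isometry.\<close>

lemma partial_isometry_between:
  assumes P: "P \<in> M" "pr P" "P \<noteq> 0" and Q: "Q \<in> M" "pr Q" "Q \<noteq> 0"
  shows "\<exists>V\<in>M. pr (star V * V) \<and> star V * V \<noteq> 0 \<and> V * P = V \<and> Q * V = V"
proof -
  obtain T where T: "T \<in> M" "Q * T * P \<noteq> 0" using factor_prime[of P Q] P Q by blast
  define W where "W = Q * T * P"
  have WM: "W \<in> M" unfolding W_def by (intro ins P Q T)
  obtain V where V: "star V * V = 1 - kp W" "\<And>M. vn M \<Longrightarrow> W \<in> M \<Longrightarrow> V \<in> M"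
    "\<And>Q. Q * W = W \<Longrightarrow> Q * V = V"
    using polar_exists[of W] by blast
  have "V \<in> M" by (rule V(2)[OF vn_axioms WM])
  moreover have "Q * V = V" by (rule V(3)) (simp add: W_def mult.assoc[symmetric] pr_idem Q)
  moreover have "pr (star V * V)" by (simp add: V(1) pr_compl pr_kp)
  moreover have "star V * V \<noteq> 0"
  proof
    assume "star V * V = 0"
    then have "kp W = 1" by (simp add: V(1))
    then show False using kp_right[of W] T by (simp add: W_def)
  qed
  moreover have "V * P = V"
  proof -
    have "W * (1 - P) = 0" by (simp add: W_def algebra_simps mult.assoc pr_idem P)
    then have "kp W * (1 - P) = 1 - P" by (rule kp_absorb)
    then have "star V * V * (1 - P) = 0" by (simp add: V(1) algebra_simps)
    then have "star (V * (1 - P)) * (V * (1 - P)) = 0" by (simp add: mult.assoc)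
    then have "V * (1 - P) = 0" by (simp only: cop_eq_0_iff_star_mult)
    then show ?thesis by (simp add: algebra_simps)
  qed
  ultimately show ?thesis by blast
qed

text \<open>
  A maximal partial isometry from \<open>P\<close> to \<open>Q\<close> is found by exhaustion with respect to a faithful
  weight, which replaces Zorn's lemma and keeps all limits sequential.
\<close>

lemma comparison:
  assumes P: "P \<in> M" "pr P" and Q: "Q \<in> M" "pr Q"
  shows "ple M P Q \<or> ple M Q P"
proof -
  obtain \<phi> :: "'h cop \<Rightarrow> real" where
    \<phi>_add: "\<And>S T. \<phi> (S + T) = \<phi> S + \<phi> T" and \<phi>_nn: "\<And>P. pr P \<Longrightarrow> 0 \<le> \<phi> P" and
    \<phi>_0: "\<And>P. P \<in> M \<Longrightarrow> pr P \<Longrightarrow> \<phi> P = 0 \<Longrightarrow> P = 0" and \<phi>_le: "\<And>P. pr P \<Longrightarrow> \<phi> P \<le> \<phi> 1"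
    using weight_exists by blast
  define PI where "PI = {V\<in>M. pr (star V * V) \<and> V * P = V \<and> Q * V = V}"
  define ext where "ext V W \<longleftrightarrow> W * (star V * V) = V \<and> (star W * W) * (star V * V) = star V * V" for V W :: "'h cop"
  define w where "w V = \<phi> (star V * V)" for V
  have ext_w: "w W = w V + \<phi> (star W * W - star V * V)" "0 \<le> \<phi> (star W * W - star V * V)"
    if "V \<in> PI" "W \<in> PI" "ext V W" for V W
  proof -
    have "pr (star W * W - star V * V)" using that by (intro pr_diff) (auto simp: PI_def ext_def)
    then show "0 \<le> \<phi> (star W * W - star V * V)" by (rule \<phi>_nn)
    show "w W = w V + \<phi> (star W * W - star V * V)" using \<phi>_add[of "star V * V" "star W * W - star V * V"]
      by (simp add: w_def)
  qed
  have ext_refl: "ext V V" if "V \<in> PI" for V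
    using that isometry_right[of "star V * V" V] by (auto simp: PI_def ext_def pr_idem)
  have ext_trans: "ext U W" if "ext U V" "ext V W" for U V W
    using that unfolding ext_def by (metis mult.assoc)
  have bd: "bdd_above (w ` {W\<in>PI. ext V W})" for V
    by (rule bdd_aboveI2[where M = "\<phi> 1"]) (auto simp: w_def PI_def intro: \<phi>_le)
  \<comment> \<open>The largest weight within reach of an extension of \<open>V\<close>; the
    recursive choice comes within \<open>1 / Suc n\<close> of it.\<close>
  define s where "s V = Sup (w ` {W\<in>PI. ext V W})" for V
  have step: "\<exists>W. W \<in> PI \<and> ext V W \<and> s V - 1 / real (Suc n) < w W" if "V \<in> PI" for V n
  proof -
    have "s V - 1 / real (Suc n) < s V" by simp
    moreover have "w ` {W\<in>PI. ext V W} \<noteq> {}" using that ext_refl by blast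
    ultimately have "\<exists>y\<in>w ` {W\<in>PI. ext V W}. s V - 1 / real (Suc n) < y"
      unfolding s_def using less_cSup_iff[OF _ bd[of V]] by blast
    then show ?thesis by blast
  qed
  have "0 \<in> PI" by (simp add: PI_def zero_in)
  then have "\<exists>V. \<forall>n. V n \<in> PI \<and> ext (V n) (V (Suc n)) \<and> s (V n) - 1 / real (Suc n) < w (V (Suc n))"
    by (intro dependent_nat_choice) (use step in blast)+
  then obtain V where V: "\<And>n. V n \<in> PI" "\<And>n. ext (V n) (V (Suc n)) \<and> s (V n) - 1 / real (Suc n) < w (V (Suc n))"
    by blast
  define p where "p n = star (V n) * V n" for n
  have prp: "pr (p n)" and VM: "V n \<in> M" for n using V(1) by (auto simp: p_def PI_def)
  have inc: "p (Suc n) * p n = p n" for n using V(2)[of n] by (simp add: p_def ext_def)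
  obtain L where L: "slim p L" "pr L" "\<And>n. L * p n = p n" using pr_incseq_slim[of p, OF prp inc] by blast
  obtain W where W: "W \<in> M" "slim V W" "star W * W = L" "\<And>n. W * p n = V n"
    using isometry_chain_limit[of p, OF prp inc L(1), of V] VM V(2) by (auto simp: p_def ext_def)
  have "W * P = W"
    using slim_unique[OF slim_mult_right[OF W(2), of P]] W(2) V(1) by (simp add: PI_def)
  moreover have "Q * W = W"
    using slim_unique[OF slim_mult_left[OF W(2), of Q]] W(2) V(1) by (simp add: PI_def)
  ultimately have WPI: "W \<in> PI" using W L by (simp add: PI_def)
  have extW: "ext (V n) W" for n using W L(3) by (simp add: ext_def p_def)
  \<comment> \<open>An extension of \<open>W\<close> extends every \<open>V n\<close>, so its gain
    in weight is below every \<open>1 / Suc n\<close>; faithfulness turns zero gain into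
    equality.\<close>
  have maximal: "star U * U = star W * W" if U: "U \<in> PI" "ext W U" for U
  proof -
    have "w U \<le> w W"
    proof (rule field_le_epsilon)
      fix e :: real assume "e > 0"
      then obtain n where n: "1 / real (Suc n) < e" using nat_approx_posE by blast
      have "w U \<le> s (V n)" unfolding s_def
        by (rule cSup_upper[OF _ bd]) (use U extW ext_trans in blast)
      also have "\<dots> \<le> w (V (Suc n)) + e" using V(2)[of n] n by simp
      also have "w (V (Suc n)) \<le> w W" using ext_w[OF V(1) WPI extW, of "Suc n"] by simp
      finally show "w U \<le> w W + e" by simp
    qed
    then have "\<phi> (star U * U - star W * W) = 0" using ext_w[OF WPI U] by simp
    moreover have "star U * U - star W * W \<in> M" using U W by (auto simp: PI_def intro!: ins)
    moreover have "pr (star U * U - star W * W)"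
      using U WPI by (intro pr_diff) (auto simp: PI_def ext_def)
    ultimately show ?thesis using \<phi>_0 by force
  qed
  define P0 where "P0 = P - L"
  define K where "K = W * star W"
  define Q0 where "Q0 = Q - K"
  have LP: "L * P = L" by (metis W(3) \<open>W * P = W\<close> mult.assoc)
  have PL: "P * L = L" using LP P L pr_le_sym by blast
  have KM: "K \<in> M" "pr K" using W L isometry_range[of L W] by (auto simp: K_def intro!: ins)
  have QK: "Q * K = K" using \<open>Q * W = W\<close> by (simp add: K_def mult.assoc[symmetric])
  have KW: "K * W = W" by (simp add: K_def mult.assoc W(3) isometry_right[OF L(2) W(3)])
  have LM: "L \<in> M" using W by (auto intro!: ins simp flip: W(3))
  have P0: "P0 \<in> M" "pr P0" using P L LM PL by (auto simp: P0_def intro!: ins pr_diff)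
  have Q0: "Q0 \<in> M" "pr Q0" using Q KM QK by (auto simp: Q0_def intro!: ins pr_diff)
  \<comment> \<open>Otherwise a nonzero partial isometry between the two remainders could be added
    to \<open>W\<close>.\<close>
  have "P0 = 0 \<or> Q0 = 0"
  proof (rule ccontr)
    assume "\<not> (P0 = 0 \<or> Q0 = 0)"
    then obtain U where U: "U \<in> M" "pr (star U * U)" "star U * U \<noteq> 0" "U * P0 = U" "Q0 * U = U"
      using partial_isometry_between[OF P0(1,2) _ Q0(1,2)] by blast
    have UL: "U * L = 0"
    proof -
      have "U * L = U * (P0 * L)" using U(4) by (simp add: mult.assoc[symmetric])
      then show ?thesis by (simp add: P0_def algebra_simps PL pr_idem L)
    qed
    have LU: "L * (star U) = 0" using UL L(2) by (metis pr_star star_simps(1,6))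
    have "star W * U = 0"
    proof -
      have "star W * Q0 = star (Q0 * W)" using Q0 by (simp add: pr_star)
      also have "Q0 * W = 0" using \<open>Q * W = W\<close> by (simp add: Q0_def algebra_simps KW)
      finally show ?thesis using U(5) by (metis mult.assoc mult_zero_left star_simps(1))
    qed
    then have WU: "star W * U = 0" "star U * W = 0" by (simp, metis star_simps(1,6) star_star)
    have uu: "star (W + U) * (W + U) = L + star U * U" by (simp add: algebra_simps WU W)
    have Lu: "L * (star U * U) = 0" by (simp add: mult.assoc[symmetric] LU)
    have "pr (star (W + U) * (W + U))" unfolding uu by (rule pr_add[OF L(2) U(2) Lu])
    moreover have "U * P = U"
    proof -
      have "P0 * P = P0" by (simp add: P0_def algebra_simps LP pr_idem P)
      then show ?thesis using U(4) by (metis mult.assoc)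
    qed
    moreover have "Q * U = U"
    proof -
      have "Q * Q0 = Q0" by (simp add: Q0_def algebra_simps QK pr_idem Q)
      then show ?thesis using U(5) by (metis mult.assoc)
    qed
    ultimately have "W + U \<in> PI"
      using W U \<open>W * P = W\<close> \<open>Q * W = W\<close> by (auto simp: PI_def algebra_simps intro: ins)
    moreover have "ext W (W + U)"
    proof -
      have "star U * U * L = 0" by (simp add: mult.assoc UL)
      then show ?thesis unfolding ext_def uu
        by (simp add: W algebra_simps UL isometry_right[OF L(2) W(3)] pr_idem L)
    qed
    ultimately have "L + star U * U = L" using maximal uu W(3) by metis
    then show False using U by simp
  qed
  then show ?thesis
  proof
    assume "P0 = 0"
    then have "star W * W = P" using W by (simp add: P0_def)
    then show ?thesis using W \<open>Q * W = W\<close> by (auto simp: ple_def)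
  next
    assume "Q0 = 0"
    then have "W * star W = Q" by (simp add: Q0_def K_def)
    moreover have "P * star W = star W" using \<open>W * P = W\<close> P by (metis pr_star star_simps(6))
    ultimately show ?thesis using W unfolding ple_def by (intro disjI2 bexI[of _ "star W"]) (auto intro: ins)
  qed
qed

lemma ple_limit:
  assumes P: "\<And>n. P n \<in> M" "\<And>n. pr (P n)" "P 0 = 0" and inc: "\<And>n. P (Suc n) * P n = P n"
    and L: "slim P L" and A: "A \<in> M" "pr A"
  shows "(\<exists>n. ple M A (P n)) \<or> ple M L A"
proof (rule ccontr)
  assume neg: "\<not> ?thesis"
  define good where "good n V \<longleftrightarrow> V \<in> M \<and> star V * V = P n \<and> A * V = V" for n V
  have step: "\<exists>W. good (Suc n) W \<and> W * P n = V" if V: "good n V" for n V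
  proof -
    have V': "V \<in> M" "star V * V = P n" "A * V = V" using V by (auto simp: good_def)
    define K where "K = V * star V"
    have K: "K \<in> M" "pr K" "A * K = K"
      using V' isometry_range[OF P(2) V'(2)] by (auto simp: K_def mult.assoc[symmetric] intro!: ins)
    have VP: "V * P n = V" by (rule isometry_right[OF P(2) V'(2)])
    have KV: "K * V = V" by (simp add: K_def mult.assoc V'(2) VP)
    have AK: "A - K \<in> M" "pr (A - K)" using A K by (auto intro!: ins pr_diff)
    have D: "P (Suc n) - P n \<in> M" "pr (P (Suc n) - P n)" using P inc by (auto intro!: ins pr_diff)
    have "ple M (P (Suc n) - P n) (A - K)"
    proof (rule ccontr)
      assume "\<not> ?thesis"
      then have "ple M (A - K) (P (Suc n) - P n)" using comparison[OF AK D] by blast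
      moreover have "ple M K (P n)"
        unfolding ple_def
      proof (rule bexI[of _ "star V"], intro conjI)
        show "P n * star V = star V" using VP P(2)[of n] by (metis pr_star star_simps(6))
      qed (use V' in \<open>auto simp: K_def intro: ins\<close>)
      moreover have "(P (Suc n) - P n) * P n = 0" using inc P(2)[of n] by (simp add: algebra_simps pr_idem)
      ultimately have "ple M (A - K + K) (P (Suc n) - P n + P n)"
        using D P(2) by (intro ple_add)
      then show False using neg by auto
    qed
    then obtain U where U: "U \<in> M" "star U * U = P (Suc n) - P n" "(A - K) * U = U"
      by (auto simp: ple_def)
    have UP: "U * P n = 0"
    proof -
      have "star (U * P n) * (U * P n) = P n * (star U * U) * P n"
        using P(2)[of n] by (simp add: pr_star mult.assoc)
      also have "\<dots> = 0" using inc P(2)[of n] by (simp add: U(2) algebra_simps pr_idem mult.assoc)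
      finally show ?thesis by (simp only: cop_eq_0_iff_star_mult)
    qed
    have "K * U = K * (A - K) * U" using U(3) by (simp add: mult.assoc)
    moreover have "K * A = K" using K A pr_le_sym by blast
    ultimately have "K * U = 0" by (simp add: algebra_simps pr_idem K)
    then have AU: "A * U = U" using U(3) by (simp add: algebra_simps)
    have "star V * U = star (K * V) * U" by (simp add: KV)
    also have "\<dots> = star V * (K * U)" using K by (simp add: pr_star mult.assoc)
    finally have VU: "star V * U = 0" by (simp add: \<open>K * U = 0\<close>)
    then have UV: "star U * V = 0" by (metis star_simps(1,6) star_star)
    have "good (Suc n) (V + U)" unfolding good_def
      using V' U by (auto simp: algebra_simps VU UV AU intro: ins)
    moreover have "(V + U) * P n = V" by (simp add: algebra_simps VP UP)
    ultimately show ?thesis by blast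
  qed
  have "good 0 0" by (simp add: good_def P zero_in)
  then have "\<exists>V. \<forall>n. good n (V n) \<and> V (Suc n) * P n = V n"
    by (intro dependent_nat_choice) (use step in blast)+
  then obtain V where V: "\<And>n. good n (V n)" "\<And>n. V (Suc n) * P n = V n" by blast
  have Vn: "V n \<in> M" "star (V n) * V n = P n" "A * V n = V n" for n using V(1) by (auto simp: good_def)
  obtain W where W: "W \<in> M" "slim V W" "star W * W = L"
    using isometry_chain_limit[of P, OF P(2) inc L, of V] Vn V(2) by blast
  have "A * W = W" using slim_unique[OF slim_mult_left[OF W(2), of A]] W(2) by (simp add: Vn)
  then have "ple M L A" using W by (auto simp: ple_def)
  then show False using neg by blast
qed

end

section \<open>Maximal commuting families of projections\<close>

lemma cop_cinner_eqI:
  assumes "\<And>x y. cinner (S \<cdot> x) y = cinner (T \<cdot> x) y" shows "S = T"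
proof -
  have "star S = star T" by (rule star_eqI) (unfold assms, rule star_cinner)
  then show ?thesis by (simp only: star_eq_iff)
qed

text \<open>The corner \<open>t = (1 - p) * q * p\<close> satisfies
  \<open>t = s * t - t * s\<close>; its norm is then at most 2/3 of itself.\<close>

lemma commute_dominant_projection:
  fixes p s q :: "'h::complex_hilbert_space cop"
  assumes p: "pr p" and q: "pr q" and ps: "p * s = s * p" and n: "norm s \<le> 1 / 3"
    and comm: "q * (p + s) = (p + s) * q"
  shows "q * p = p * q"
proof -
  define t where "t = (1 - p) * q * p"
  have "(1 - p) * (q * (p + s)) * p = t + t * s"
    using ps by (simp add: t_def algebra_simps pr_idem pr_idem' p)
  moreover have "(1 - p) * ((p + s) * q) * p = s * t"
  proof -
    have "(1 - p) * p = 0" by (simp add: algebra_simps pr_idem p)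
    moreover have "(1 - p) * s = s * (1 - p)" using ps by (simp add: algebra_simps)
    ultimately have "(1 - p) * (p + s) = s * (1 - p)" by (simp add: distrib_left)
    then show ?thesis by (simp add: t_def flip: mult.assoc)
  qed
  ultimately have t: "t = s * t - t * s" using comm by simp
  have "norm t \<le> norm (s * t) + norm (t * s)" by (subst t) (rule norm_triangle_ineq4)
  also have "\<dots> \<le> norm s * norm t + norm t * norm s" by (intro add_mono norm_mult_ineq)
  also have "\<dots> = 2 * norm s * norm t" by simp
  also have "\<dots> \<le> 2 / 3 * norm t" using n by (intro mult_right_mono) simp_all
  finally have "t = 0" by simp
  then have qp: "q * p = p * q * p" by (simp add: t_def algebra_simps)
  then have "star (q * p) = star (p * q * p)" by simp
  then have "p * q = p * q * p" by (simp add: pr_star pr_idem p q mult.assoc)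
  then show ?thesis using qp by simp
qed

text \<open>The operator in question is \<open>(1 + g)\<^sup>2 - 1\<close>, and near 1 squaring is
  injective. Concretely, the commutator \<open>t\<close> of \<open>q\<close> and \<open>g\<close>
  satisfies \<open>2 t = - (t g + g t)\<close>.\<close>

lemma commute_square_perturbation:
  fixes g q :: "'h::complex_hilbert_space cop"
  assumes n: "norm g \<le> 1 / 3"
    and comm: "q * (2 *\<^sub>R g + g * g) = (2 *\<^sub>R g + g * g) * q"
  shows "q * g = g * q"
proof -
  define t where "t = q * g - g * q"
  have "2 *\<^sub>R t = - (t * g + g * t)" using comm by (simp add: t_def algebra_simps)
  then have "2 * norm t = norm (t * g + g * t)" by (metis norm_minus_cancel norm_scaleR abs_numeral)
  also have "\<dots> \<le> norm t * norm g + norm g * norm t"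
    by (meson add_mono norm_mult_ineq norm_triangle_ineq order_trans)
  also have "\<dots> = 2 * norm g * norm t" by simp
  also have "\<dots> \<le> 2 / 3 * norm t" using n by (intro mult_right_mono) simp_all
  finally show ?thesis by (simp add: t_def)
qed

lemma perturbation_cancel:
  fixes g u :: "'h::complex_hilbert_space cop"
  assumes n: "norm g \<le> 1 / 3" and "u + u * g = 0" shows "u = 0"
proof -
  have "u = - (u * g)" using assms(2) by (simp add: add_eq_0_iff2)
  then have "norm u \<le> norm u * norm g" by (metis norm_minus_cancel norm_mult_ineq)
  also have "\<dots> \<le> norm u * (1 / 3)" using n by (intro mult_left_mono) simp_all
  finally show ?thesis by simp
qed

lemma geometric_third: "(\<lambda>k. (1 / 4 :: real) ^ Suc k) sums (1 / 3)"
  using sums_mult[OF geometric_sums[of "1 / 4 :: real"], of "1 / 4"] by simp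

text \<open>An expansion in base 4 with the projections as digits:
  \<open>4 G n = p n + G (n + 1)\<close>. The tail has norm at most 1/3, small enough for
  \<open>commute_dominant_projection\<close>, so the digits are recovered one after the
  other.\<close>

lemma encode_projections:
  fixes p :: "nat \<Rightarrow> 'h::complex_hilbert_space cop"
  assumes p: "\<And>n. pr (p n)" and comm: "\<And>m n. p m * p n = p n * p m"
  defines "G \<equiv> \<lambda>n. \<Sum>k. (1 / 4) ^ Suc k *\<^sub>R p (n + k)"
  shows "star (G 0) = G 0" and "norm (G 0) \<le> 1 / 3"
    and "\<And>E. (\<And>n. E * p n = p n) \<Longrightarrow> E * G 0 = G 0"
    and "\<And>M. vn M \<Longrightarrow> (\<And>n. p n \<in> M) \<Longrightarrow> G 0 \<in> M"
    and "\<And>q. pr q \<Longrightarrow> q * G 0 = G 0 * q \<Longrightarrow> q * p n = p n * q"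
proof -
  have nf: "norm ((1 / 4) ^ Suc k *\<^sub>R p (n + k)) \<le> (1 / 4) ^ Suc k" for n k
    using pr_norm[OF p[of "n + k"]] by (simp add: mult_left_le)
  have summ: "summable (\<lambda>k. (1 / 4) ^ Suc k *\<^sub>R p (n + k))" for n
    by (rule summable_comparison_test'[OF sums_summable[OF geometric_third], of 0]) (rule nf)
  have nG: "norm (G n) \<le> 1 / 3" for n
  proof -
    have "norm (G n) \<le> (\<Sum>k. (1 / 4) ^ Suc k)"
      unfolding G_def by (rule norm_suminf_le[OF nf sums_summable[OF geometric_third]])
    then show ?thesis by (simp only: sums_unique[OF geometric_third, symmetric])
  qed
  then show "norm (G 0) \<le> 1 / 3" .
  show "star (G 0) = G 0"
    unfolding G_def bounded_linear.suminf[OF bounded_linear_star summ] by (simp add: pr_star p)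
  show "E * G 0 = G 0" if "\<And>n. E * p n = p n" for E
    unfolding G_def suminf_mult[OF summ, symmetric] by (simp add: that)
  show "G 0 \<in> M" if "vn M" "\<And>n. p n \<in> M" for M
  proof -
    interpret vn M by fact
    show ?thesis unfolding G_def by (rule suminf_in[OF _ summ]) (intro ins that)
  qed
  have split: "4 *\<^sub>R G n = p n + G (Suc n)" for n
  proof -
    have "(\<Sum>k. (1 / 4) ^ Suc (Suc k) *\<^sub>R p (n + Suc k)) = G n - (1 / 4) *\<^sub>R p n"
      using suminf_split_head[OF summ[of n]] by (simp add: G_def)
    moreover have "(\<Sum>k. (1 / 4) ^ Suc (Suc k) *\<^sub>R p (n + Suc k)) = (1 / 4) *\<^sub>R G (Suc n)"
      using suminf_scaleR_right[OF summ[of "Suc n"], of "1 / 4"] by (simp add: G_def)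
    ultimately have "4 *\<^sub>R (G n - (1 / 4) *\<^sub>R p n) = 4 *\<^sub>R ((1 / 4) *\<^sub>R G (Suc n))" by simp
    then show ?thesis by (simp add: scaleR_diff_right diff_eq_eq add.commute)
  qed
  have pG: "p m * G n = G n * p m" for m n
    unfolding G_def suminf_mult[OF summ, symmetric] suminf_mult2[OF summ] by (simp add: comm)
  show "q * p n = p n * q" if q: "pr q" and qG: "q * G 0 = G 0 * q" for q
  proof -
    have step: "q * p n = p n * q" if "q * G n = G n * q" for n
    proof (rule commute_dominant_projection[OF p q pG nG])
      have "q * (4 *\<^sub>R G n) = (4 *\<^sub>R G n) * q" using that by simp
      then show "q * (p n + G (Suc n)) = (p n + G (Suc n)) * q" by (simp only: split)
    qed
    have "q * G n = G n * q" for n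
    proof (induction n)
      case (Suc n)
      have "q * (4 *\<^sub>R G n) = (4 *\<^sub>R G n) * q" using Suc by simp
      then have "q * (p n + G (Suc n)) = (p n + G (Suc n)) * q" by (simp only: split)
      then show ?case using step[OF Suc] by (simp add: algebra_simps)
    qed (rule qG)
    then show ?thesis by (rule step)
  qed
qed

context sepfac
begin

text \<open>Zorn's lemma gives the family. A weakly dense sequence in it is encoded in one operator
  \<open>g\<close>, so that a projection commuting with \<open>g\<close> commutes with the entire
  family.\<close>

lemma maximal_commuting_family:
  assumes E: "E \<in> M" "pr E" and f: "f \<in> M" "pr f" "E * f = f"
  obtains PP g where "f \<in> PP" and "\<And>p. p \<in> PP \<Longrightarrow> p \<in> M \<and> pr p \<and> E * p = p"
    and "\<And>p q. p \<in> PP \<Longrightarrow> q \<in> PP \<Longrightarrow> p * q = q * p"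
    and "\<And>q. q \<in> M \<Longrightarrow> pr q \<Longrightarrow> E * q = q \<Longrightarrow> \<forall>p\<in>PP. q * p = p * q \<Longrightarrow> q \<in> PP"
    and "g \<in> M" "star g = g" "norm g \<le> 1 / 3" "E * g = g"
    and "\<And>q p. pr q \<Longrightarrow> q * g = g * q \<Longrightarrow> p \<in> PP \<Longrightarrow> q * p = p * q"
proof -
  define \<A> where "\<A> = {S. f \<in> S \<and> S \<subseteq> {p\<in>M. pr p \<and> E * p = p} \<and> (\<forall>p\<in>S. \<forall>q\<in>S. p * q = q * p)}"
  have "{f} \<in> \<A>" using f by (simp add: \<A>_def)
  then have "\<exists>PP\<in>\<A>. \<forall>X\<in>\<A>. PP \<subseteq> X \<longrightarrow> X = PP"
  proof (intro subset_Zorn_nonempty)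
    fix \<C> assume C: "\<C> \<noteq> {}" "subset.chain \<A> \<C>"
    have CA: "\<C> \<subseteq> \<A>" and chain: "\<And>X Y. X \<in> \<C> \<Longrightarrow> Y \<in> \<C> \<Longrightarrow> X \<subseteq> Y \<or> Y \<subseteq> X"
      using C(2) by (auto simp: subset_chain_def)
    have "p * q = q * p" if pq: "p \<in> \<Union>\<C>" "q \<in> \<Union>\<C>" for p q
    proof -
      obtain X Y where XY: "X \<in> \<C>" "Y \<in> \<C>" "p \<in> X" "q \<in> Y" using pq by blast
      then obtain W where "W \<in> \<C>" "p \<in> W" "q \<in> W" using chain[of X Y] by blast
      then show ?thesis using CA by (auto simp: \<A>_def)
    qed
    then show "\<Union>\<C> \<in> \<A>" using C(1) CA by (auto simp: \<A>_def)
  qed auto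
  then obtain PP where PP: "PP \<in> \<A>" and maxi: "\<And>X. X \<in> \<A> \<Longrightarrow> PP \<subseteq> X \<Longrightarrow> X = PP" by blast
  have PPp: "p \<in> M \<and> pr p \<and> E * p = p" if "p \<in> PP" for p using PP that by (auto simp: \<A>_def)
  have PPc: "p * q = q * p" if "p \<in> PP" "q \<in> PP" for p q using PP that by (auto simp: \<A>_def)
  have fPP: "f \<in> PP" using PP by (simp add: \<A>_def)
  have maxq: "q \<in> PP" if q: "q \<in> M" "pr q" "E * q = q" and c: "\<forall>p\<in>PP. q * p = p * q" for q
  proof -
    have "insert q PP \<in> \<A>" using PP q c by (auto simp: \<A>_def)
    then show ?thesis using maxi[of "insert q PP"] by blast
  qed
  have "\<exists>B :: nat \<Rightarrow> 'h cop. (\<forall>n. B n \<in> PP) \<and> (\<forall>T x y x' y'. T \<in> PP \<longrightarrow>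
    (\<forall>n. cinner (B n \<cdot> x) y = cinner (B n \<cdot> x') y') \<longrightarrow> cinner (T \<cdot> x) y = cinner (T \<cdot> x') y')"
    by (rule dense_sequence) (use PPp fPP pr_norm in auto)
  then obtain B :: "nat \<Rightarrow> 'h cop" where B: "\<forall>n. B n \<in> PP" and dens: "\<forall>T x y x' y'. T \<in> PP \<longrightarrow>
    (\<forall>n. cinner (B n \<cdot> x) y = cinner (B n \<cdot> x') y') \<longrightarrow> cinner (T \<cdot> x) y = cinner (T \<cdot> x') y'"
    by (elim exE conjE) (rule that)
  have prB: "pr (B n)" and cB: "B m * B n = B n * B m" and EB: "E * B n = B n" and BM: "B n \<in> M" for m n
    using B PPp PPc by blast+
  define g where "g = (\<Sum>k. (1 / 4) ^ Suc k *\<^sub>R B (0 + k))"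
  note enc = encode_projections[of B, OF prB cB, folded g_def]
  have comm: "q * p = p * q" if q: "pr q" "q * g = g * q" and p: "p \<in> PP" for p q
  proof -
    have qB: "q * B n = B n * q" for n by (rule enc(5)[OF q])
    have "cinner (p \<cdot> x) (q \<cdot> y) = cinner (p \<cdot> q \<cdot> x) y" for x y
    proof (rule dens[rule_format, OF p])
      fix n
      have "cinner (B n \<cdot> x) (q \<cdot> y) = cinner (q \<cdot> B n \<cdot> x) y" by (simp add: star_cinner' pr_star q)
      also have "q \<cdot> B n \<cdot> x = B n \<cdot> q \<cdot> x" using qB[of n] by (metis app_simps(6))
      finally show "cinner (B n \<cdot> x) (q \<cdot> y) = cinner (B n \<cdot> q \<cdot> x) y" .
    qed
    then show ?thesis by (intro cop_cinner_eqI) (simp add: star_cinner' pr_star q)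
  qed
  show thesis
    by (rule that[OF fPP PPp PPc maxq enc(4)[OF vn_axioms BM] enc(1,2) enc(3)[OF EB] comm])
qed

end

section \<open>An operator that no commuting family disconnects\<close>

text \<open>A point with a neighbourhood hit only finitely often lies in a basic set hit only
  finitely often, and there are countably many such sets.\<close>

lemma uncountable_accumulation:
  fixes \<Psi> :: "'a \<Rightarrow> 'b::second_countable_topology"
  assumes "uncountable Z"
  shows "\<exists>z0\<in>Z. \<forall>U. open U \<longrightarrow> \<Psi> z0 \<in> U \<longrightarrow> infinite {z\<in>Z. \<Psi> z \<in> U}"
proof (rule ccontr)
  assume neg: "\<not> ?thesis"
  obtain \<B> :: "'b set set" where \<B>: "countable \<B>" "topological_basis \<B>"
    using ex_countable_basis by blast
  have "Z \<subseteq> (\<Union>b\<in>{b\<in>\<B>. finite {z\<in>Z. \<Psi> z \<in> b}}. {z\<in>Z. \<Psi> z \<in> b})"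
  proof
    fix z assume z: "z \<in> Z"
    then obtain U where U: "open U" "\<Psi> z \<in> U" "finite {z\<in>Z. \<Psi> z \<in> U}" using neg by blast
    then obtain b where b: "b \<in> \<B>" "\<Psi> z \<in> b" "b \<subseteq> U" using topological_basisE[OF \<B>(2)] by metis
    then have "finite {z\<in>Z. \<Psi> z \<in> b}" by (intro finite_subset[OF _ U(3)]) auto
    then show "z \<in> (\<Union>b\<in>{b\<in>\<B>. finite {z\<in>Z. \<Psi> z \<in> b}}. {z\<in>Z. \<Psi> z \<in> b})" using b z by blast
  qed
  moreover have "countable (\<Union>b\<in>{b\<in>\<B>. finite {z\<in>Z. \<Psi> z \<in> b}}. {z\<in>Z. \<Psi> z \<in> b})"
    by (rule countable_UN[OF countable_Collect[OF \<B>(1)]]) (auto intro: countable_finite)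
  ultimately show False using assms countable_subset by blast
qed

lemma infinite_sets_injective_choice:
  assumes "\<And>n::nat. infinite (S n)"
  shows "\<exists>z. inj z \<and> (\<forall>n. z n \<in> S n)"
proof -
  have pick: "\<exists>z. z \<in> S n \<and> z \<notin> F" if "finite F" for n F
    using assms[of n] that by (metis finite_subset subsetI)
  \<comment> \<open>The state pairs the finite set of points used so far with the point chosen
    last.\<close>
  have "\<exists>f. \<forall>n. (finite (fst (f n)) \<and> snd (f n) \<in> S n \<and> snd (f n) \<in> fst (f n)) \<and>
      (fst (f n) \<subseteq> fst (f (Suc n)) \<and> snd (f (Suc n)) \<notin> fst (f n))"
  proof (rule dependent_nat_choice)
    obtain z where "z \<in> S 0" using pick[of "{}" 0] by blast
    then show "\<exists>x. finite (fst x) \<and> snd x \<in> S 0 \<and> snd x \<in> fst x"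
      by (intro exI[of _ "({z}, z)"]) simp
  next
    fix x :: "'a set \<times> 'a" and n
    assume x: "finite (fst x) \<and> snd x \<in> S n \<and> snd x \<in> fst x"
    then obtain z where "z \<in> S (Suc n)" "z \<notin> fst x" using pick by blast
    then show "\<exists>y. (finite (fst y) \<and> snd y \<in> S (Suc n) \<and> snd y \<in> fst y) \<and> fst x \<subseteq> fst y \<and> snd y \<notin> fst x"
      using x by (intro exI[of _ "(insert z (fst x), z)"]) auto
  qed
  then obtain f where *: "\<forall>n. (finite (fst (f n)) \<and> snd (f n) \<in> S n \<and> snd (f n) \<in> fst (f n)) \<and>
      (fst (f n) \<subseteq> fst (f (Suc n)) \<and> snd (f (Suc n)) \<notin> fst (f n))" by (rule exE)
  have f: "snd (f n) \<in> S n" "snd (f n) \<in> fst (f n)"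
    "fst (f n) \<subseteq> fst (f (Suc n))" "snd (f (Suc n)) \<notin> fst (f n)" for n using *[rule_format, of n] by simp_all
  have mono: "fst (f m) \<subseteq> fst (f n)" if "m \<le> n" for m n
    using lift_Suc_mono_le[of "\<lambda>n. fst (f n)", OF f(3) that] .
  have ne: "snd (f m) \<noteq> snd (f n)" if mn: "m < n" for m n
  proof -
    obtain k where k: "n = Suc k" "m \<le> k" using mn by (cases n) auto
    then show ?thesis using mono[of m k] f(2)[of m] f(4)[of k] by auto
  qed
  have "inj (\<lambda>n. snd (f n))" by (rule injI) (metis ne nat_neq_iff)
  then show ?thesis using f(1) by blast
qed

text \<open>The partial products decrease to the infimum. On \<open>v\<close> the errors add up to
  at most half of \<open>norm v\<close>, so the infimum does not kill \<open>v\<close>.\<close>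

lemma commuting_projections_inf:
  fixes r :: "nat \<Rightarrow> 'h::complex_hilbert_space cop"
  assumes r: "\<And>n. pr (r n)" and comm: "\<And>m n. r m * r n = r n * r m"
    and v: "\<And>n. norm (r n \<cdot> v - v) \<le> norm v * (1 / 2) ^ Suc (Suc n)" and "v \<noteq> 0"
  shows "\<exists>R. pr R \<and> R \<noteq> 0 \<and> (\<forall>n. R * r n = R) \<and> (\<forall>M. vn M \<longrightarrow> (\<forall>n. r n \<in> M) \<longrightarrow> R \<in> M)"
proof -
  define P where "P n = prod_list (map r [0..<n])" for n
  have P0: "P 0 = 1" and PS: "P (Suc n) = P n * r n" for n by (simp_all add: P_def)
  have rP: "r m * P n = P n * r m" for m n
  proof (induction n)
    case (Suc n)
    have "r m * P (Suc n) = r m * P n * r n" by (simp add: PS mult.assoc)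
    also have "\<dots> = P n * (r m * r n)" by (simp add: Suc mult.assoc)
    finally show ?case by (simp add: comm[of m n] PS mult.assoc)
  qed (simp add: P0)
  have prP: "pr (P n)" for n
    by (induction n) (simp_all add: P0 PS pr_mult r rP)
  have "P n * P (Suc n) = P (Suc n)" for n by (simp add: PS pr_idem' prP)
  then obtain L where L: "slim P L" "pr L" "\<And>n. P n * L = L"
    using pr_decseq_slim[of P, OF prP] by blast
  have est: "norm (P n \<cdot> v - v) \<le> norm v * (1 / 2 - (1 / 2) ^ Suc n)" for n
  proof (induction n)
    case (Suc n)
    have "P (Suc n) \<cdot> v - v = P n \<cdot> (r n \<cdot> v - v) + (P n \<cdot> v - v)" by (simp add: PS app_diff)
    then have "norm (P (Suc n) \<cdot> v - v) \<le> norm (P n \<cdot> (r n \<cdot> v - v)) + norm (P n \<cdot> v - v)"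
      by (metis norm_triangle_ineq)
    also have "\<dots> \<le> norm v * (1 / 2) ^ Suc (Suc n) + norm v * (1 / 2 - (1 / 2) ^ Suc n)"
      using pr_norm_le[OF prP, of n "r n \<cdot> v - v"] v[of n] Suc by linarith
    also have "\<dots> = norm v * (1 / 2 - (1 / 2) ^ Suc (Suc n))" by (simp add: algebra_simps)
    finally show ?case .
  qed (simp add: P0)
  have "norm (L \<cdot> v - v) \<le> norm v * (1 / 2)"
  proof (rule Lim_bounded[of "\<lambda>n. norm (P n \<cdot> v - v)"])
    show "(\<lambda>n. norm (P n \<cdot> v - v)) \<longlonglongrightarrow> norm (L \<cdot> v - v)" by (intro tendsto_intros slimD L)
    show "\<forall>n\<ge>0. norm (P n \<cdot> v - v) \<le> norm v * (1 / 2)"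
    proof (intro allI impI)
      fix n
      have "norm v * (1 / 2 - (1 / 2) ^ Suc n) \<le> norm v * (1 / 2)" by (intro mult_left_mono) simp_all
      then show "norm (P n \<cdot> v - v) \<le> norm v * (1 / 2)" using est[of n] by linarith
    qed
  qed
  then have "L \<noteq> 0" using \<open>v \<noteq> 0\<close> by auto
  moreover have "L * r n = L" for n
  proof -
    have "r n * L = r n * (P (Suc n) * L)" by (simp add: L)
    also have "\<dots> = r n * P n * r n * L" by (simp add: PS mult.assoc)
    also have "\<dots> = P n * (r n * r n) * L" by (simp add: rP mult.assoc)
    also have "\<dots> = L" using L(3)[of "Suc n"] by (simp add: pr_idem r PS)
    finally show ?thesis using pr_le_sym L r by blast
  qed
  moreover have "L \<in> M" if "vn M" "\<forall>n. r n \<in> M" for M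
  proof -
    interpret vn M by fact
    have "P n \<in> M" for n using that by (induction n) (auto simp: P0 PS intro: ins)
    then show ?thesis by (rule slim_in[OF _ L(1)])
  qed
  ultimately show ?thesis using L(2) by blast
qed

text \<open>For projections weak closeness is strong closeness: the squared norm expands into
  coefficients against \<open>x\<close> and \<open>q \<cdot> x\<close>. One error enters once and
  the other twice, whence the 3.\<close>

lemma pr_close:
  assumes p: "pr p" and q: "pr q"
    and "cmod (cinner (p \<cdot> x) x - cinner (q \<cdot> x) x) < d" "cmod (cinner (p \<cdot> x) (q \<cdot> x) - cinner (q \<cdot> x) (q \<cdot> x)) < d"
  shows "(norm (p \<cdot> x - q \<cdot> x))\<^sup>2 < 3 * d"
proof -
  have qq: "cinner (q \<cdot> x) (q \<cdot> x) = cinner (q \<cdot> x) x" by (simp add: star_cinner' pr_star pr_app_idem q)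
  have pp: "cinner (p \<cdot> x) (p \<cdot> x) = cinner (p \<cdot> x) x" by (simp add: star_cinner' pr_star pr_app_idem p)
  have c: "Re (cinner (q \<cdot> x) (p \<cdot> x)) = Re (cinner (p \<cdot> x) (q \<cdot> x))"
    by (subst cinner_commute) simp
  have "(norm (p \<cdot> x - q \<cdot> x))\<^sup>2 = Re (cinner (p \<cdot> x) x) + Re (cinner (q \<cdot> x) x) - 2 * Re (cinner (p \<cdot> x) (q \<cdot> x))"
    unfolding power2_norm_eq_inner inner_eq_Re_cinner by (simp add: cinner_simps pp qq c)
  moreover have "\<bar>Re (cinner (p \<cdot> x) x) - Re (cinner (q \<cdot> x) x)\<bar> < d"
    using abs_Re_le_cmod[of "cinner (p \<cdot> x) x - cinner (q \<cdot> x) x"] assms(3) by simp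
  moreover have "\<bar>Re (cinner (p \<cdot> x) (q \<cdot> x)) - Re (cinner (q \<cdot> x) x)\<bar> < d"
    using abs_Re_le_cmod[of "cinner (p \<cdot> x) (q \<cdot> x) - cinner (q \<cdot> x) (q \<cdot> x)"] assms(4) by (simp add: qq)
  ultimately show ?thesis by (simp add: abs_less_iff)
qed

text \<open>Bounded \<open>c\<close> and the factor 1/2 give a series converging for
  \<open>cmod w < 2\<close>. The zeros in \<open>{0..1}\<close> accumulate inside this disc, so the
  identity theorem applies.\<close>

lemma power_series_vanishes:
  fixes c :: "nat \<Rightarrow> complex"
  assumes bd: "\<And>n. cmod (c n) \<le> K" and Z: "infinite Z" "Z \<subseteq> {0..1::real}"
    and zero: "\<And>z. z \<in> Z \<Longrightarrow> (\<lambda>n. c n * (of_real z / 2) ^ n) sums 0"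
  shows "c n = 0"
proof -
  define a where "a n = c n * (1 / 2) ^ n" for n
  define f where "f w = (\<Sum>n. a n * w ^ n)" for w
  have sm: "(\<lambda>n. a n * w ^ n) sums f w" if "cmod w < 2" for w
  proof -
    have le: "norm (a n * w ^ n) \<le> K * (cmod w / 2) ^ n" for n
      using bd[of n] by (simp add: a_def norm_mult norm_power norm_divide power_divide mult_right_mono divide_right_mono)
    have "summable (\<lambda>n. (cmod w / 2) ^ n)" using that by (intro summable_geometric) simp
    then have "summable (\<lambda>n. K * (cmod w / 2) ^ n)" by (rule summable_mult)
    from summable_comparison_test'[OF this, of 0 "\<lambda>n. a n * w ^ n"] le
    have "summable (\<lambda>n. a n * w ^ n)" by simp
    then show ?thesis by (simp add: f_def summable_sums)
  qed
  have hol: "f holomorphic_on ball 0 2"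
    by (rule power_series_holomorphic[where a = a]) (use sm in \<open>simp add: dist_norm\<close>)
  have fz: "f (of_real z) = 0" if "z \<in> Z" for z
  proof -
    have "cmod (of_real z) < 2" using Z(2) that by auto
    moreover have "a n * of_real z ^ n = c n * (of_real z / 2) ^ n" for n by (simp add: a_def power_divide)
    ultimately show ?thesis using sm[of "of_real z"] zero[OF that] sums_unique2 by (metis (no_types, lifting) ext)
  qed
  obtain x where x: "x \<in> {0..1}" "x islimpt Z"
    using Z compact_eq_Bolzano_Weierstrass[of "{0..1::real}"] by auto
  have lp: "complex_of_real x islimpt of_real ` Z"
    unfolding islimpt_approachable
  proof (intro allI impI)
    fix e :: real assume "e > 0"
    then obtain z where "z \<in> Z" "z \<noteq> x" "dist z x < e" using x(2) by (auto simp: islimpt_approachable)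
    then show "\<exists>w\<in>complex_of_real ` Z. w \<noteq> of_real x \<and> dist w (of_real x) < e"
      by (intro bexI[of _ "of_real z"]) (auto simp: dist_norm simp flip: of_real_diff)
  qed
  have f0: "f w = 0" if "w \<in> ball 0 2" for w
  proof (rule analytic_continuation[OF hol _ _ _ _ lp _ that])
    show "of_real ` Z \<subseteq> ball (0::complex) 2" using Z(2) by fastforce
    show "complex_of_real x \<in> ball 0 2" using x(1) by simp
  qed (use fz in auto)
  have "a n = 0"
  proof (cases "n = 0")
    case True
    have "(\<lambda>n. a n * 0 ^ n) sums a 0" by (rule powser_sums_zero)
    moreover have "f 0 = 0" by (rule f0) simp
    ultimately show ?thesis using sm[of 0] sums_unique2 True by fastforce
  next
    \<comment> \<open>A nonzero coefficient of positive order would make the zero at the origin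
      isolated.\<close>
    case False
    show ?thesis
    proof (rule ccontr)
      assume "a n \<noteq> 0"
      then obtain s where s: "0 < s" "\<And>z. z \<in> cball 0 s - {0} \<Longrightarrow> f z \<noteq> 0"
        using powser_0_nonzero[of 2 0 a f n] sm f0[of 0] False by auto
      have "of_real (min s 1) \<in> cball 0 s - {0 :: complex}" using s(1) by auto
      then have "f (of_real (min s 1)) \<noteq> 0" by (rule s(2))
      moreover have "f (of_real (min s 1)) = 0" using s(1) by (intro f0) (auto simp: min_def)
      ultimately show False by simp
    qed
  qed
  then show ?thesis by (simp add: a_def)
qed

context sepfac
begin

text \<open>Among uncountably many pairs, one is a condensation point for the values of
  \<open>\<Phi>\<close>; \<open>pr_close\<close> upgrades this to norm closeness at the vectors
  \<open>x\<close> and \<open>y\<close>.\<close>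

lemma projections_accumulate:
  fixes p q :: "real \<Rightarrow> 'h cop"
  assumes Z: "uncountable Z" and p: "\<And>z. z \<in> Z \<Longrightarrow> p z \<in> M \<and> pr (p z)" and q: "\<And>z. z \<in> Z \<Longrightarrow> q z \<in> M \<and> pr (q z)"
  shows "\<exists>z0\<in>Z. \<forall>e>0. infinite {z\<in>Z. norm (p z \<cdot> x - p z0 \<cdot> x) < e \<and> norm (q z \<cdot> y - q z0 \<cdot> y) < e}"
proof -
  obtain z0 where z0: "z0 \<in> Z"
    and acc: "\<And>U. open U \<Longrightarrow> (\<Phi> (p z0), \<Phi> (q z0)) \<in> U \<Longrightarrow> infinite {z\<in>Z. (\<Phi> (p z), \<Phi> (q z)) \<in> U}"
    using uncountable_accumulation[OF Z, of "\<lambda>z. (\<Phi> (p z), \<Phi> (q z))"] by (elim bexE) (rule that, auto)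
  have "infinite {z\<in>Z. norm (p z \<cdot> x - p z0 \<cdot> x) < e \<and> norm (q z \<cdot> y - q z0 \<cdot> y) < e}" if "e > 0" for e
  proof -
    define d where "d = e\<^sup>2 / 3"
    have d: "d > 0" "d / 4 > 0" using that by (simp_all add: d_def)
    obtain n1 where n1: "\<forall>T\<in>M. norm T \<le> 1 \<longrightarrow> cmod (cinner (T \<cdot> x) x - \<Phi> T n1) \<le> d / 4"
      using approx[OF d(2), of x x] by blast
    obtain n2 where n2: "\<forall>T\<in>M. norm T \<le> 1 \<longrightarrow> cmod (cinner (T \<cdot> x) (p z0 \<cdot> x) - \<Phi> T n2) \<le> d / 4"
      using approx[OF d(2), of x "p z0 \<cdot> x"] by blast
    obtain m1 where m1: "\<forall>T\<in>M. norm T \<le> 1 \<longrightarrow> cmod (cinner (T \<cdot> y) y - \<Phi> T m1) \<le> d / 4"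
      using approx[OF d(2), of y y] by blast
    obtain m2 where m2: "\<forall>T\<in>M. norm T \<le> 1 \<longrightarrow> cmod (cinner (T \<cdot> y) (q z0 \<cdot> y) - \<Phi> T m2) \<le> d / 4"
      using approx[OF d(2), of y "q z0 \<cdot> y"] by blast
    define U :: "((nat \<Rightarrow> complex) \<times> (nat \<Rightarrow> complex)) set" where "U = {w.
      cmod (fst w n1 - \<Phi> (p z0) n1) < d / 4 \<and> cmod (fst w n2 - \<Phi> (p z0) n2) < d / 4 \<and>
      cmod (snd w m1 - \<Phi> (q z0) m1) < d / 4 \<and> cmod (snd w m2 - \<Phi> (q z0) m2) < d / 4}"
    have c1: "continuous_on UNIV (\<lambda>w::(nat \<Rightarrow> complex) \<times> (nat \<Rightarrow> complex). fst w n)" for n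
      by (rule continuous_on_product_then_coordinatewise) (intro continuous_intros)
    have c2: "continuous_on UNIV (\<lambda>w::(nat \<Rightarrow> complex) \<times> (nat \<Rightarrow> complex). snd w n)" for n
      by (rule continuous_on_product_then_coordinatewise) (intro continuous_intros)
    have "open U" unfolding U_def
      by (intro open_Collect_conj open_Collect_less continuous_intros c1 c2)
    moreover have "(\<Phi> (p z0), \<Phi> (q z0)) \<in> U" using d by (simp add: U_def)
    ultimately have inf: "infinite {z\<in>Z. (\<Phi> (p z), \<Phi> (q z)) \<in> U}" by (rule acc)
    have key: "cmod (u - v) < d" if "cmod (u - s) \<le> d / 4" "cmod (v - t) \<le> d / 4" "cmod (s - t) < d / 4" for u v s t
    proof -
      have "u - v = (u - s) + ((s - t) - (v - t))" by simp
      then have "cmod (u - v) \<le> cmod (u - s) + (cmod (s - t) + cmod (v - t))"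
        using norm_triangle_ineq[of "u - s" "(s - t) - (v - t)"] norm_triangle_ineq4[of "s - t" "v - t"] by simp
      then show ?thesis using that d by linarith
    qed
    have close: "norm (r \<cdot> x - r' \<cdot> x) < e"
      if r: "r \<in> M" "pr r" and r': "r' \<in> M" "pr r'"
        and n1: "\<forall>T\<in>M. norm T \<le> 1 \<longrightarrow> cmod (cinner (T \<cdot> x) x - \<Phi> T n1) \<le> d / 4"
        and n2: "\<forall>T\<in>M. norm T \<le> 1 \<longrightarrow> cmod (cinner (T \<cdot> x) (r' \<cdot> x) - \<Phi> T n2) \<le> d / 4"
        and U: "cmod (\<Phi> r n1 - \<Phi> r' n1) < d / 4" "cmod (\<Phi> r n2 - \<Phi> r' n2) < d / 4"
      for r r' x n1 n2
    proof -
      have nr: "norm r \<le> 1" "norm r' \<le> 1" using r r' pr_norm by auto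
      have "cmod (cinner (r \<cdot> x) x - cinner (r' \<cdot> x) x) < d"
        by (rule key[OF n1[rule_format, OF r(1) nr(1)] n1[rule_format, OF r'(1) nr(2)] U(1)])
      moreover have "cmod (cinner (r \<cdot> x) (r' \<cdot> x) - cinner (r' \<cdot> x) (r' \<cdot> x)) < d"
        by (rule key[OF n2[rule_format, OF r(1) nr(1)] n2[rule_format, OF r'(1) nr(2)] U(2)])
      ultimately have "(norm (r \<cdot> x - r' \<cdot> x))\<^sup>2 < 3 * d" by (rule pr_close[OF r(2) r'(2)])
      then have "(norm (r \<cdot> x - r' \<cdot> x))\<^sup>2 < e\<^sup>2" by (simp add: d_def)
      from power2_less_imp_less[OF this less_imp_le[OF \<open>e > 0\<close>]] show ?thesis .
    qed
    have "{z\<in>Z. (\<Phi> (p z), \<Phi> (q z)) \<in> U} \<subseteq> {z\<in>Z. norm (p z \<cdot> x - p z0 \<cdot> x) < e \<and> norm (q z \<cdot> y - q z0 \<cdot> y) < e}"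
    proof
      fix z assume "z \<in> {z\<in>Z. (\<Phi> (p z), \<Phi> (q z)) \<in> U}"
      then have z: "z \<in> Z"
        and U1: "cmod (\<Phi> (p z) n1 - \<Phi> (p z0) n1) < d / 4" "cmod (\<Phi> (p z) n2 - \<Phi> (p z0) n2) < d / 4"
        and U2: "cmod (\<Phi> (q z) m1 - \<Phi> (q z0) m1) < d / 4" "cmod (\<Phi> (q z) m2 - \<Phi> (q z0) m2) < d / 4"
        by (simp_all add: U_def)
      have pz: "p z \<in> M" "pr (p z)" "p z0 \<in> M" "pr (p z0)" using p[OF z] p[OF z0] by simp_all
      have qz: "q z \<in> M" "pr (q z)" "q z0 \<in> M" "pr (q z0)" using q[OF z] q[OF z0] by simp_all
      show "z \<in> {z\<in>Z. norm (p z \<cdot> x - p z0 \<cdot> x) < e \<and> norm (q z \<cdot> y - q z0 \<cdot> y) < e}"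
        using z close[OF pz n1 n2 U1] close[OF qz m1 m2 U2] by simp
    qed
    from infinite_super[OF this inf] show ?thesis .
  qed
  then show ?thesis using z0 by blast
qed

text \<open>
  A generic member \<open>\<Sum>n. (z/2)\<^sup>n B\<^sub>n\<close> of a one-parameter analytic family will do: if for uncountably
  many \<open>z\<close> a pair of nonzero projections were disconnected, then infinitely many of these pairs
  would have nonzero infima, and by analyticity these would be disconnected by all of \<open>M\<close>.
\<close>

lemma generic_connecting_operator:
  assumes PP: "\<And>p. p \<in> PP \<Longrightarrow> p \<in> M \<and> pr p" and comm: "\<And>p q. p \<in> PP \<Longrightarrow> q \<in> PP \<Longrightarrow> p * q = q * p"
  shows "\<exists>b\<in>M. \<forall>p\<in>PP. \<forall>q\<in>PP. p * b * q = 0 \<longrightarrow> p = 0 \<or> q = 0"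
proof (rule ccontr)
  assume neg: "\<not> ?thesis"
  obtain B :: "nat \<Rightarrow> 'h cop" where B: "\<forall>n. B n \<in> M \<and> norm (B n) \<le> 1"
    and dens: "\<forall>S R. (\<forall>n. S * B n * R = 0) \<longrightarrow> (\<forall>T\<in>M. S * T * R = 0)"
    using unit_ball_sequence by (elim exE conjE) (rule that)
  have BM: "B n \<in> M" and Bn: "norm (B n) \<le> 1" for n using B by simp_all
  define b where "b z = (\<Sum>n. (z / 2) ^ n *\<^sub>R B n)" for z :: real
  have summ: "summable (\<lambda>n. (z / 2) ^ n *\<^sub>R B n)" if "z \<in> {0..1}" for z
  proof (rule summable_comparison_test'[where N = 0])
    show "summable (\<lambda>n. (1 / 2 :: real) ^ n)" by (rule summable_geometric) simp
    show "norm ((z / 2) ^ n *\<^sub>R B n) \<le> (1 / 2) ^ n" for n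
    proof -
      have "\<bar>z / 2\<bar> ^ n * norm (B n) \<le> (1 / 2) ^ n * 1"
        using that Bn[of n] by (intro mult_mono power_mono) auto
      then show ?thesis by (simp add: power_abs)
    qed
  qed
  have bM: "b z \<in> M" if "z \<in> {0..1}" for z
    unfolding b_def by (rule suminf_in[OF _ summ[OF that]]) (intro ins BM)
  have "\<forall>z\<in>{0..1}. \<exists>p q. p \<in> PP \<and> q \<in> PP \<and> p * b z * q = 0 \<and> p \<noteq> 0 \<and> q \<noteq> 0"
    using neg bM by blast
  then obtain p q where pq: "\<And>z. z \<in> {0..1} \<Longrightarrow> p z \<in> PP \<and> q z \<in> PP \<and> p z * b z * q z = 0 \<and> p z \<noteq> 0 \<and> q z \<noteq> 0"
    by metis
  \<comment> \<open>A nonzero projection in \<open>M\<close> moves some \<open>\<xi> k\<close>.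
    Sorting the parameters by these indices leaves one uncountable class with fixed test
    vectors.\<close>
  define Zkl where "Zkl k l = {z\<in>{0..1::real}. p z \<cdot> \<xi> k \<noteq> 0 \<and> q z \<cdot> \<xi> l \<noteq> 0}" for k l
  have "{0..1} \<subseteq> (\<Union>k l. Zkl k l)"
  proof
    fix z :: real assume z: "z \<in> {0..1}"
    then obtain k l where "p z \<cdot> \<xi> k \<noteq> 0" "q z \<cdot> \<xi> l \<noteq> 0"
      using pq[OF z] PP separating by metis
    then show "z \<in> (\<Union>k l. Zkl k l)" using z by (auto simp: Zkl_def)
  qed
  moreover have "uncountable {0..1::real}" by (simp add: uncountable_closed_interval)
  ultimately obtain k l where kl: "uncountable (Zkl k l)"
    by (metis countable_UN countable_subset countableI_type)
  define Z where "Z = Zkl k l"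
  have Z01: "Z \<subseteq> {0..1}" by (auto simp: Z_def Zkl_def)
  have pM: "p z \<in> M \<and> pr (p z)" and qM: "q z \<in> M \<and> pr (q z)" if "z \<in> Z" for z
    using pq PP Z01 that by blast+
  have "\<exists>z0\<in>Z. \<forall>e>0. infinite {z\<in>Z. norm (p z \<cdot> \<xi> k - p z0 \<cdot> \<xi> k) < e \<and> norm (q z \<cdot> \<xi> l - q z0 \<cdot> \<xi> l) < e}"
    by (rule projections_accumulate[OF kl[folded Z_def]]) (use pM qM in auto)
  then obtain z0 where z0: "z0 \<in> Z"
    and acc: "\<And>e. e > 0 \<Longrightarrow> infinite {z\<in>Z. norm (p z \<cdot> \<xi> k - p z0 \<cdot> \<xi> k) < e \<and> norm (q z \<cdot> \<xi> l - q z0 \<cdot> \<xi> l) < e}"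
    by (elim bexE) (rule that, auto)
  define v w where "v = p z0 \<cdot> \<xi> k" and "w = q z0 \<cdot> \<xi> l"
  have vw: "v \<noteq> 0" "w \<noteq> 0" using z0 by (simp_all add: v_def w_def Z_def Zkl_def)
  \<comment> \<open>With errors \<open>\<delta> * (1 / 2) ^ (n + 2)\<close> both infima, of the
    \<open>p (\<zeta> n)\<close> and of the \<open>q (\<zeta> n)\<close>, stay nonzero by
    \<open>commuting_projections_inf\<close>.\<close>
  define \<delta> where "\<delta> = min (norm v) (norm w)"
  have \<delta>: "\<delta> > 0" "\<delta> \<le> norm v" "\<delta> \<le> norm w" using vw by (auto simp: \<delta>_def)
  have "infinite {z\<in>Z. norm (p z \<cdot> \<xi> k - p z0 \<cdot> \<xi> k) < \<delta> * (1 / 2) ^ Suc (Suc n) \<and>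
      norm (q z \<cdot> \<xi> l - q z0 \<cdot> \<xi> l) < \<delta> * (1 / 2) ^ Suc (Suc n)}" for n
    by (rule acc) (use \<delta> in simp)
  from infinite_sets_injective_choice[of "\<lambda>n. {z\<in>Z. norm (p z \<cdot> \<xi> k - p z0 \<cdot> \<xi> k) < \<delta> * (1 / 2) ^ Suc (Suc n) \<and>
      norm (q z \<cdot> \<xi> l - q z0 \<cdot> \<xi> l) < \<delta> * (1 / 2) ^ Suc (Suc n)}", OF this]
  obtain \<zeta> where inj: "inj \<zeta>" and \<zeta>: "\<And>n. \<zeta> n \<in> Z"
    "\<And>n. norm (p (\<zeta> n) \<cdot> \<xi> k - p z0 \<cdot> \<xi> k) < \<delta> * (1 / 2) ^ Suc (Suc n)"
    "\<And>n. norm (q (\<zeta> n) \<cdot> \<xi> l - q z0 \<cdot> \<xi> l) < \<delta> * (1 / 2) ^ Suc (Suc n)"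
    by auto
  have proj: "norm (r \<cdot> (r0 \<cdot> x) - r0 \<cdot> x) \<le> \<eta> * (1 / 2) ^ Suc (Suc n)"
    if "pr r0" "r * r0 = r0 * r" "norm (r \<cdot> x - r0 \<cdot> x) < \<delta> * (1 / 2) ^ Suc (Suc n)" "\<delta> \<le> \<eta>"
    for r r0 :: "'h cop" and x n \<eta>
  proof -
    have "r \<cdot> r0 \<cdot> x = r0 \<cdot> r \<cdot> x" using that(2) by (metis app_simps(6))
    then have "r \<cdot> r0 \<cdot> x - r0 \<cdot> x = r0 \<cdot> (r \<cdot> x - r0 \<cdot> x)"
      by (simp add: app_diff pr_app_idem that(1))
    then have "norm (r \<cdot> r0 \<cdot> x - r0 \<cdot> x) \<le> norm (r \<cdot> x - r0 \<cdot> x)" by (simp add: pr_norm_le[OF that(1)])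
    also have "\<dots> \<le> \<delta> * (1 / 2) ^ Suc (Suc n)" by (rule less_imp_le[OF that(3)])
    also have "\<dots> \<le> \<eta> * (1 / 2) ^ Suc (Suc n)" by (rule mult_right_mono[OF that(4)]) simp
    finally show ?thesis .
  qed
  have inZ: "z \<in> {0..1}" if "z \<in> Z" for z using that Z01 by blast
  have cp: "p z * p z' = p z' * p z" and cq: "q z * q z' = q z' * q z" if "z \<in> Z" "z' \<in> Z" for z z'
    using comm pq inZ that by blast+
  have "\<exists>R. pr R \<and> R \<noteq> 0 \<and> (\<forall>n. R * p (\<zeta> n) = R) \<and> (\<forall>M. vn M \<longrightarrow> (\<forall>n. p (\<zeta> n) \<in> M) \<longrightarrow> R \<in> M)"
  proof (rule commuting_projections_inf[OF _ _ _ vw(1)])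
    show "norm (p (\<zeta> n) \<cdot> v - v) \<le> norm v * (1 / 2) ^ Suc (Suc n)" for n
      unfolding v_def by (rule proj) (use pM z0 \<zeta> cp \<delta> in \<open>auto simp: v_def\<close>)
  qed (use pM \<zeta> cp in auto)
  then obtain P where P: "pr P" "P \<noteq> 0" "\<And>n. P * p (\<zeta> n) = P" "P \<in> M"
    using pM \<zeta>(1) vn_axioms by metis
  have "\<exists>R. pr R \<and> R \<noteq> 0 \<and> (\<forall>n. R * q (\<zeta> n) = R) \<and> (\<forall>M. vn M \<longrightarrow> (\<forall>n. q (\<zeta> n) \<in> M) \<longrightarrow> R \<in> M)"
  proof (rule commuting_projections_inf[OF _ _ _ vw(2)])
    show "norm (q (\<zeta> n) \<cdot> w - w) \<le> norm w * (1 / 2) ^ Suc (Suc n)" for n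
      unfolding w_def by (rule proj) (use qM z0 \<zeta> cq \<delta> in \<open>auto simp: w_def\<close>)
  qed (use qM \<zeta> cq in auto)
  then obtain Q where Q: "pr Q" "Q \<noteq> 0" "\<And>n. Q * q (\<zeta> n) = Q" "Q \<in> M"
    using qM \<zeta>(1) vn_axioms by metis
  have PbQ: "P * b (\<zeta> n) * Q = 0" for n
  proof -
    have "q (\<zeta> n) * Q = Q" using Q qM \<zeta>(1) pr_le_sym by blast
    then have "P * b (\<zeta> n) * Q = P * (p (\<zeta> n) * b (\<zeta> n) * q (\<zeta> n)) * Q"
      using P(3)[of n] by (metis mult.assoc)
    then show ?thesis using pq[OF inZ[OF \<zeta>(1)], of n] by simp
  qed
  \<comment> \<open>Every coefficient of \<open>P * b z * Q\<close> is a power series in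
    \<open>z\<close> with zeros at the infinitely many \<open>\<zeta> n\<close>, so it vanishes term
    by term.\<close>
  have "P * B n * Q = 0" for n
  proof (rule cop_eqI)
    fix x
    define c where "c y n = cinner (P \<cdot> B n \<cdot> Q \<cdot> x) y" for y n
    have "c y n = 0" for y
    proof (rule power_series_vanishes[where Z = "range \<zeta>" and c = "c y" and K = "norm x * norm y"])
      show "infinite (range \<zeta>)" using inj by (simp add: finite_image_iff)
      show "range \<zeta> \<subseteq> {0..1}" using \<zeta>(1) Z01 by blast
      show "cmod (c y n) \<le> norm x * norm y" for n
      proof -
        have "norm (B n \<cdot> Q \<cdot> x) \<le> norm (B n) * norm (Q \<cdot> x)" by (rule norm_app)
        also have "\<dots> \<le> 1 * norm x" by (intro mult_mono Bn pr_norm_le Q) auto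
        finally have "norm (P \<cdot> B n \<cdot> Q \<cdot> x) \<le> norm x" using pr_norm_le[OF P(1)] order_trans by fastforce
        then have "norm (P \<cdot> B n \<cdot> Q \<cdot> x) * norm y \<le> norm x * norm y" by (intro mult_right_mono) auto
        then show ?thesis unfolding c_def using cmod_cinner_le order_trans by blast
      qed
      fix z assume "z \<in> range \<zeta>"
      then obtain j where j: "z = \<zeta> j" by blast
      have "(\<lambda>n. (z / 2) ^ n *\<^sub>R B n) sums b z"
        unfolding b_def by (rule summable_sums[OF summ]) (use inZ \<zeta>(1) j in blast)
      then have "(\<lambda>n. P * ((z / 2) ^ n *\<^sub>R B n) * Q) sums (P * b z * Q)"
        by (intro sums_mult sums_mult2)
      then have "(\<lambda>n. (P * ((z / 2) ^ n *\<^sub>R B n) * Q) \<cdot> x) sums 0"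
        using bounded_linear.sums[OF bounded_bilinear.bounded_linear_left[OF bounded_bilinear_app, of x]] PbQ[of j]
        unfolding j by fastforce
      then have "(\<lambda>n. cinner ((P * ((z / 2) ^ n *\<^sub>R B n) * Q) \<cdot> x) y) sums 0"
        using bounded_linear.sums[OF bounded_bilinear.bounded_linear_left[OF bounded_bilinear_cinner, of y]] by fastforce
      moreover have "cinner ((P * ((z / 2) ^ n *\<^sub>R B n) * Q) \<cdot> x) y = c y n * (of_real z / 2) ^ n" for n
        by (simp add: c_def app_scaleR scaleR_eq_scaleC cinner_scaleC_left mult.commute)
      ultimately show "(\<lambda>n. c y n * (of_real z / 2) ^ n) sums 0" by simp
    qed
    then have "cinner (P \<cdot> B n \<cdot> Q \<cdot> x) (P \<cdot> B n \<cdot> Q \<cdot> x) = 0" by (simp add: c_def)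
    then show "(P * B n * Q) \<cdot> x = 0 \<cdot> x" by (simp add: cinner_self)
  qed
  then have "P * T * Q = 0" if "T \<in> M" for T using dens that by blast
  then show False using factor_prime[OF Q(4,1) P(4,1)] P(2) Q(2) by blast
qed

end

section \<open>An irreducible off-diagonal operator\<close>

lemma mult_ctx: "(a::'h::complex_hilbert_space cop) * b = c \<Longrightarrow> a * (b * x) = c * x"
  by (simp add: mult.assoc[symmetric])

lemma zero_left_of_range:
  "(E::'h::complex_hilbert_space cop) * F = 0 \<Longrightarrow> F * x = x \<Longrightarrow> E * x = 0"
  by (metis mult.assoc mult_zero_left)

lemma zero_right_of_range:
  "(F::'h::complex_hilbert_space cop) * E = 0 \<Longrightarrow> x * F = x \<Longrightarrow> x * E = 0"
  by (metis mult.assoc mult_zero_right)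

context sepfac
begin

text \<open>Place \<open>E2\<close> inside \<open>E1\<close>. If the rest of \<open>E1\<close> fits
  into \<open>E3\<close>, done. Otherwise \<open>E3\<close> fits into that rest, so
  \<open>E2 + E3\<close> is subequivalent to \<open>E1\<close>, hence equivalent to it by
  Schroeder-Bernstein, and the equivalence is cut along \<open>E2\<close> and
  \<open>E3\<close>.\<close>

lemma fit_largest_block:
  assumes E: "E1 \<in> M" "pr E1" "E2 \<in> M" "pr E2" "E3 \<in> M" "pr E3"
    and orth: "E2 * E3 = 0"
    and le: "ple M E2 E1" "ple M E1 (E2 + E3)"
  shows "\<exists>v\<in>M. \<exists>y\<in>M. star v * v = E2 \<and> E1 * v = v \<and> star y * y = E1 - v * star v \<and> E3 * y = y"
proof -
  have orth': "E3 * E2 = 0" using orth E pr_orth_sym by blast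
  obtain v where v: "v \<in> M" "star v * v = E2" "E1 * v = v" using le(1) by (auto simp: ple_def)
  define F2 where "F2 = v * star v"
  have F2: "F2 \<in> M" "pr F2" "E1 * F2 = F2"
    using v isometry_range[OF E(4) v(2)] by (auto simp: F2_def mult.assoc[symmetric] intro!: ins)
  have F3: "E1 - F2 \<in> M" "pr (E1 - F2)" using E F2 by (auto intro!: ins pr_diff)
  consider "ple M (E1 - F2) E3" | "ple M E3 (E1 - F2)" using comparison[OF F3 E(5,6)] by blast
  then show ?thesis
  proof cases
    case 1
    then show ?thesis using v by (auto simp: ple_def F2_def)
  next
    case 2
    have "ple M E2 F2" unfolding ple_def
      by (rule bexI[of _ v]) (use v isometry_right[OF E(4) v(2)] in \<open>simp_all add: F2_def mult.assoc\<close>)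
    moreover have "F2 * (E1 - F2) = 0"
      using F2 E pr_le_sym[of E1 F2] by (simp add: algebra_simps pr_idem)
    ultimately have "ple M (E2 + E3) (F2 + (E1 - F2))" by (intro ple_add 2 F2 F3)
    then have "ple M (E2 + E3) E1" by simp
    then obtain t where t: "t \<in> M" "star t * t = E2 + E3" "E1 * t = t" by (auto simp: ple_def)
    obtain u where u: "u \<in> M" "star u * u = E1" "(E2 + E3) * u = u" using le(2) by (auto simp: ple_def)
    have E23: "pr (E2 + E3)" by (rule pr_add[OF E(4,6) orth])
    define F where "F = t * star t"
    have tE: "t * (E2 + E3) = t" by (rule isometry_right[OF E23 t(2)])
    have F: "F \<in> M" "pr F" "E1 * F = F"
      using t isometry_range[OF E23 t(2)] by (auto simp: F_def mult.assoc[symmetric] intro!: ins)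
    have 1: "star (t * u) * (t * u) = E1"
    proof -
      have "star (t * u) * (t * u) = star u * ((star t * t) * u)" by (simp add: mult.assoc)
      then show ?thesis by (simp only: t(2) u(2,3))
    qed
    have 2: "F * (t * u) = t * u"
    proof -
      have "F * (t * u) = t * (star t * t) * u" by (simp add: F_def mult.assoc)
      then show ?thesis by (simp only: t(2) tE)
    qed
    obtain V where V: "V \<in> M" "star V * V = E1" "V * star V = F"
      using schroeder_bernstein[OF E(1,2) F mult_in[OF t(1) u(1)] 1 2] by blast
    \<comment> \<open>\<open>s\<close> carries \<open>E1\<close> onto \<open>E2 + E3\<close>; its
      two rows provide the isometries \<open>v'\<close> and \<open>y\<close>.\<close>
    define s where "s = star t * V"
    have FV: "F * V = V" using isometry_right[OF E(2) V(2)] by (simp add: V(2) flip: V(3) mult.assoc) (simp add: mult.assoc V(2))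
    have ss: "star s * s = E1"
    proof -
      have "star s * s = star V * (F * V)" by (simp add: s_def F_def mult.assoc)
      then show ?thesis by (simp only: FV V(2))
    qed
    have ss': "s * star s = E2 + E3"
    proof -
      have "s * star s = star t * F * t" by (simp add: s_def mult.assoc flip: V(3))
      also have "\<dots> = (star t * t) * (star t * t)" by (simp add: F_def mult.assoc)
      finally show ?thesis using pr_idem[OF E23] by (simp only: t(2))
    qed
    have sM: "s \<in> M" unfolding s_def by (intro ins t V)
    have sE1: "s * E1 = s" by (rule isometry_right[OF E(2) ss])
    have E1s: "E1 * star s = star s" using sE1 E by (metis pr_star star_simps(6))
    define v' where "v' = star s * E2"
    define y where "y = E3 * s"
    have vv: "star v' * v' = E2"
    proof -
      have "star v' * v' = E2 * (s * star s) * E2" by (simp add: v'_def pr_star E mult.assoc)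
      then show ?thesis unfolding ss' by (simp add: algebra_simps pr_idem E orth orth')
    qed
    have "star y * y = star s * E3 * s" by (simp add: y_def pr_star E pr_idem' mult.assoc)
    also have "\<dots> = star s * (s * star s) * s - star s * E2 * s"
      unfolding ss' by (simp add: algebra_simps)
    also have "\<dots> = (star s * s) * (star s * s) - v' * star v'"
      by (simp add: v'_def pr_star E pr_idem' mult.assoc)
    finally have yy: "star y * y = E1 - v' * star v'" by (simp only: ss pr_idem[OF E(2)])
    have "E1 * v' = v'" by (simp add: v'_def E1s mult.assoc[symmetric])
    moreover have "E3 * y = y" by (simp add: y_def pr_idem' E)
    moreover have "v' \<in> M" "y \<in> M" unfolding v'_def y_def by (intro ins sM E)+
    ultimately show ?thesis using vv yy by blast
  qed
qed

text \<open>
  In block form the entries are \<open>E1 K E2 = v (E2 + g)\<close>, \<open>E2 K E3 = w\<close> and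
  \<open>E1 K E3 = y\<^sup>* + v b w\<close>: the partial isometries tie the three diagonal entries of a commuting
  projection together, \<open>g\<close> forces the second one into a maximal commuting family, and \<open>b\<close> leaves
  only the trivial members of this family.
\<close>

lemma irreducible_offdiagonal_sorted:
  assumes E: "E1 \<in> M" "pr E1" "E2 \<in> M" "pr E2" "E3 \<in> M" "pr E3"
    and orth: "E1 * E2 = 0" "E1 * E3 = 0" "E2 * E3 = 0" and sum: "E1 + E2 + E3 = 1" and "E3 \<noteq> 0"
    and le: "ple M E2 E1" "ple M E3 E2" "ple M E1 (E2 + E3)"
  shows "\<exists>K\<in>M. star K = K \<and> E1 * K * E1 = 0 \<and> E2 * K * E2 = 0 \<and> E3 * K * E3 = 0 \<and>
    (\<forall>q\<in>M. pr q \<longrightarrow> q * E1 = E1 * q \<longrightarrow> q * E2 = E2 * q \<longrightarrow> q * E3 = E3 * q \<longrightarrow> q * K = K * q \<longrightarrow>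
      q = 0 \<or> q = 1)"
proof -
  obtain v y where v: "v \<in> M" "star v * v = E2" "E1 * v = v"
    and y: "y \<in> M" "star y * y = E1 - v * star v" "E3 * y = y"
    using fit_largest_block[OF E orth(3) le(1,3)] by blast
  obtain w where w: "w \<in> M" "star w * w = E3" "E2 * w = w" using le(2) by (auto simp: ple_def)
  define f where "f = w * star w"
  have f: "f \<in> M" "pr f" "E2 * f = f"
    using w isometry_range[OF E(6) w(2)] by (auto simp: f_def mult.assoc[symmetric] intro!: ins)
  have orth': "E2 * E1 = 0" "E3 * E1 = 0" "E3 * E2 = 0" using orth E pr_orth_sym by blast+
  have vE: "v * E2 = v" by (rule isometry_right[OF E(4) v(2)])
  have wE: "w * E3 = w" by (rule isometry_right[OF E(6) w(2)])
  have "f \<noteq> 0"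
  proof
    assume "f = 0"
    then have "star w * f * w = 0" by simp
    then have "E3 * E3 = 0" by (simp add: f_def mult.assoc flip: w(2))
    then show False using \<open>E3 \<noteq> 0\<close> E by (simp add: pr_idem)
  qed
  define F2 where "F2 = v * star v"
  have F2: "pr F2" "E1 * F2 = F2"
    using v isometry_range[OF E(4) v(2)] by (auto simp: F2_def mult.assoc[symmetric])
  have F3: "pr (E1 - F2)" using E F2 by (intro pr_diff)
  have yF: "y * (E1 - F2) = y" by (rule isometry_right[OF F3]) (simp add: y F2_def)
  have F2E: "F2 * E1 = F2" using F2 E pr_le_sym by blast
  have F32: "(E1 - F2) * F2 = 0" "(E1 - F2) * E1 = E1 - F2"
    using F2 by (simp_all add: algebra_simps pr_idem F2E E)
  have yF2: "y * F2 = 0" and yE1: "y * E1 = y" using yF F32 by (metis mult.assoc mult_zero_right, metis mult.assoc)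
  \<comment> \<open>\<open>v\<close> ends in \<open>F2\<close>, whereas \<open>y\<close> starts on
    \<open>E1 - F2\<close>. This later lets \<open>star v\<close> remove the term
    \<open>star y\<close> from the third entry.\<close>
  have yv: "y * v = 0"
  proof -
    have "y * v = y * (v * E2)" by (simp add: vE)
    also have "\<dots> = y * F2 * v" by (simp add: F2_def mult.assoc flip: v(2))
    finally show ?thesis by (simp add: yF2)
  qed
  obtain PP g where fPP: "f \<in> PP" and PP: "\<And>p. p \<in> PP \<Longrightarrow> p \<in> M \<and> pr p \<and> E2 * p = p"
    and PPc: "\<And>p q. p \<in> PP \<Longrightarrow> q \<in> PP \<Longrightarrow> p * q = q * p"
    and PPmax: "\<And>q. q \<in> M \<Longrightarrow> pr q \<Longrightarrow> E2 * q = q \<Longrightarrow> \<forall>p\<in>PP. q * p = p * q \<Longrightarrow> q \<in> PP"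
    and g: "g \<in> M" "star g = g" "norm g \<le> 1 / 3" "E2 * g = g"
    and gPP: "\<And>q p. pr q \<Longrightarrow> q * g = g * q \<Longrightarrow> p \<in> PP \<Longrightarrow> q * p = p * q"
    by (rule maximal_commuting_family[OF E(3,4) f]) (rule that)
  have "\<exists>b\<in>M. \<forall>p\<in>PP. \<forall>q\<in>PP. p * b * q = 0 \<longrightarrow> p = 0 \<or> q = 0"
    by (rule generic_connecting_operator[of PP]) (use PP PPc in blast)+
  then obtain b where b: "b \<in> M" and bgen: "\<And>p q. p \<in> PP \<Longrightarrow> q \<in> PP \<Longrightarrow> p * b * q = 0 \<Longrightarrow> p = 0 \<or> q = 0"
    by blast
  have gE: "g * E2 = g" using g E by (metis pr_star star_simps(6))
  define K0 where "K0 = v * (E2 + g) + w + star y + v * b * w"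
  define K where "K = K0 + star K0"
  have sv: "star v * E1 = star v" "E2 * star v = star v" using v(3) vE E by (metis pr_star star_simps(6))+
  have sw: "star w * E2 = star w" "E3 * star w = star w" using w(3) wE E by (metis pr_star star_simps(6))+
  have sy: "star y * E3 = star y" "E1 * star y = star y" using y(3) yE1 E by (metis pr_star star_simps(6))+
  \<comment> \<open>The multiplication table of the blocks: products with matching projections are
    absorbed, those with mismatched ones vanish.\<close>
  note base = v(3) vE w(3) wE y(3) yE1 g(4) gE sv sw sy orth orth' pr_idem[OF E(2)] pr_idem[OF E(4)] pr_idem[OF E(6)]
    orth'(1)[THEN zero_left_of_range, OF v(3)] orth'(2)[THEN zero_left_of_range, OF v(3)]
    orth(1)[THEN zero_left_of_range, OF w(3)] orth'(3)[THEN zero_left_of_range, OF w(3)]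
    orth(2)[THEN zero_left_of_range, OF y(3)] orth(3)[THEN zero_left_of_range, OF y(3)]
    orth(1)[THEN zero_left_of_range, OF g(4)] orth'(3)[THEN zero_left_of_range, OF g(4)]
    orth(1)[THEN zero_left_of_range, OF sv(2)] orth'(3)[THEN zero_left_of_range, OF sv(2)]
    orth(2)[THEN zero_left_of_range, OF sw(2)] orth(3)[THEN zero_left_of_range, OF sw(2)]
    orth'(1)[THEN zero_left_of_range, OF sy(2)] orth'(2)[THEN zero_left_of_range, OF sy(2)]
    orth'(1)[THEN zero_right_of_range, OF vE] orth(3)[THEN zero_right_of_range, OF vE]
    orth'(2)[THEN zero_right_of_range, OF wE] orth'(3)[THEN zero_right_of_range, OF wE]
    orth(1)[THEN zero_right_of_range, OF yE1] orth(2)[THEN zero_right_of_range, OF yE1]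
    orth'(1)[THEN zero_right_of_range, OF gE] orth(3)[THEN zero_right_of_range, OF gE]
    orth(1)[THEN zero_right_of_range, OF sv(1)] orth(2)[THEN zero_right_of_range, OF sv(1)]
    orth'(1)[THEN zero_right_of_range, OF sw(1)] orth(3)[THEN zero_right_of_range, OF sw(1)]
    orth'(2)[THEN zero_right_of_range, OF sy(1)] orth'(3)[THEN zero_right_of_range, OF sy(1)]
  note rules = base base[THEN mult_ctx]
  have sE: "star E1 = E1" "star E2 = E2" "star E3 = E3" using E by (simp_all add: pr_star)
  have K12: "E1 * K * E2 = v * (E2 + g)" and K23: "E2 * K * E3 = w" and K13: "E1 * K * E3 = star y + v * b * w"
    and K11: "E1 * K * E1 = 0" and K22: "E2 * K * E2 = 0" and K33: "E3 * K * E3 = 0"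
    by (simp_all add: K_def K0_def algebra_simps sE g(2) rules)
  have KM: "K \<in> M" unfolding K_def K0_def by (intro ins v w y g b E)
  have Ks: "star K = K" by (simp add: K_def add.commute)
  have main: "q * E2 = 0 \<or> (1 - q) * E2 = 0" and vanish: "q * E2 = 0 \<Longrightarrow> q = 0"
    if q: "q \<in> M" "pr q" and qE: "q * E1 = E1 * q" "q * E2 = E2 * q" "q * E3 = E3 * q" and qK: "q * K = K * q" for q
  proof -
    have blk: "q * (A * K * B) = A * K * B * q" if "q * A = A * q" "q * B = B * q" for A B
      using that qK by (metis mult.assoc)
    have qvh: "q * (v * (E2 + g)) = v * (E2 + g) * q" using blk[OF qE(1,2)] by (simp only: K12)
    have qw: "q * w = w * q" using blk[OF qE(2,3)] by (simp only: K23)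
    have qc: "q * (star y + v * b * w) = (star y + v * b * w) * q" using blk[OF qE(1,3)] by (simp only: K13)
    have sq: "star q = q" using q by (simp add: pr_star)
    \<comment> \<open>\<open>v\<close> is isometric on \<open>E2\<close>, so the square of the first
      entry is \<open>(E2 + g)\<^sup>2\<close>. Commuting with it means commuting with
      \<open>g\<close>, and then the entry itself yields \<open>v\<close>.\<close>
    have hh: "star (v * (E2 + g)) * (v * (E2 + g)) = E2 + (2 *\<^sub>R g + g * g)"
    proof -
      have "star (v * (E2 + g)) * (v * (E2 + g)) = (E2 + g) * (star v * v) * (E2 + g)"
        by (simp add: sE g(2) mult.assoc)
      then show ?thesis unfolding v(2) by (simp add: algebra_simps rules scaleR_2)
    qed
    have "q * star (v * (E2 + g)) = star (v * (E2 + g) * q)" by (simp add: sq mult.assoc)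
    also have "\<dots> = star (q * (v * (E2 + g)))" by (simp only: qvh)
    also have "\<dots> = star (v * (E2 + g)) * q" by (simp only: star_simps sq)
    finally have "q * (star (v * (E2 + g)) * (v * (E2 + g))) = star (v * (E2 + g)) * (v * (E2 + g)) * q"
      using qvh by (metis mult.assoc)
    then have "q * (2 *\<^sub>R g + g * g) = (2 *\<^sub>R g + g * g) * q"
      unfolding hh using qE(2) by (simp add: algebra_simps)
    then have qg: "q * g = g * q" by (rule commute_square_perturbation[OF g(3)])
    have qv: "q * v = v * q"
    proof -
      define u where "u = q * v - v * q"
      have "u + u * g = q * (v * (E2 + g)) - v * (E2 + g) * q"
        using qE(2) qg by (simp add: u_def algebra_simps rules)
      then have "u + u * g = 0" by (simp only: qvh diff_self)
      then have "u = 0" by (rule perturbation_cancel[OF g(3)])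
      then show ?thesis by (simp add: u_def)
    qed
    have qsv: "q * star v = star v * q" using arg_cong[OF qv, of star] by (simp add: sq)
    have qsw: "q * star w = star w * q" using arg_cong[OF qw, of star] by (simp add: sq)
    \<comment> \<open>Applying \<open>star v\<close> isolates the generic operator \<open>b\<close>
      in the third entry.\<close>
    have svc: "star v * (star y + v * b * w) = E2 * b * w"
    proof -
      have "star v * star y = 0" using arg_cong[OF yv, of star] by simp
      moreover have "star v * (v * b * w) = E2 * b * w" by (simp add: v(2) flip: mult.assoc)
      ultimately show ?thesis by (simp add: distrib_left)
    qed
    have qbw: "q * (E2 * b * w) = E2 * b * w * q"
      unfolding svc[symmetric] using qc qsv by (metis mult.assoc)
    have qbf: "q * (E2 * b * f) = E2 * b * q * f"
    proof -
      have "q * (E2 * b * f) = q * (E2 * b * w) * star w" by (simp add: f_def mult.assoc)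
      also have "\<dots> = E2 * b * w * q * star w" by (simp only: qbw)
      also have "\<dots> = E2 * b * (w * q) * star w" by (simp only: mult.assoc)
      also have "\<dots> = E2 * b * (q * w) * star w" by (simp only: qw)
      finally show ?thesis by (simp add: f_def mult.assoc)
    qed
    define r where "r = E2 * q"
    have r: "r \<in> M" "pr r" "E2 * r = r"
      using q E qE(2) by (auto simp: r_def pr_idem' intro!: ins pr_mult)
    have rg: "r * g = g * r"
    proof -
      have "r * g = E2 * (g * q)" by (simp add: r_def qg mult.assoc)
      then show ?thesis by (simp add: r_def rules)
    qed
    \<comment> \<open>The corner of \<open>q\<close> commutes with \<open>g\<close>, hence with the
      whole family, and belongs to it by maximality.\<close>
    have rPP: "r \<in> PP" by (rule PPmax[OF r]) (use gPP[OF r(2) rg] in blast)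
    have E2PP: "E2 \<in> PP"
    proof (rule PPmax[OF E(3,4) pr_idem[OF E(4)]], rule ballI)
      fix p assume "p \<in> PP"
      then show "E2 * p = p * E2" using PP[of p] pr_le_sym[OF E(4)] by metis
    qed
    have rf: "r * f = f * r" by (rule PPc[OF rPP fPP])
    have rE2: "r * E2 = r" using r E pr_le_sym by blast
    have rbf: "r * b * f = E2 * b * r * f"
    proof -
      have "r * b * f = (E2 * E2) * q * b * f" by (simp add: r_def pr_idem E)
      also have "\<dots> = E2 * (E2 * q) * b * f" by (simp only: mult.assoc)
      also have "\<dots> = E2 * (q * E2) * b * f" by (simp only: qE(2))
      also have "\<dots> = E2 * (q * (E2 * b * f))" by (simp only: mult.assoc)
      also have "\<dots> = E2 * (E2 * b * q * f)" by (simp only: qbf)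
      also have "\<dots> = (E2 * E2) * b * (q * f)" by (simp only: mult.assoc)
      also have "\<dots> = E2 * b * (q * f)" by (simp only: pr_idem[OF E(4)])
      also have "q * f = r * f" using f(3) qE(2) by (metis r_def mult.assoc)
      finally show ?thesis by (simp add: mult.assoc)
    qed
    have rbfr: "r * b * f * r = r * b * f"
    proof -
      have "r * b * f * r = E2 * b * r * f * r" by (simp only: rbf)
      also have "\<dots> = E2 * b * (r * r) * f" by (simp only: rf[symmetric] mult.assoc)
      also have "\<dots> = E2 * b * r * f" by (simp only: pr_idem[OF r(2)])
      finally show ?thesis by (simp only: rbf)
    qed
    \<comment> \<open>\<open>r * b * f = E2 * b * r * f\<close> forces both mixed products to
      vanish. Genericity of \<open>b\<close> then kills one factor in each, and as
      \<open>f \<noteq> 0\<close> only \<open>r = E2\<close> or \<open>r = 0\<close>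
      remains.\<close>
    have c1: "(E2 - r) * b * (r * f) = 0"
    proof -
      have "(E2 - r) * b * (r * f) = E2 * b * r * f - r * b * f * r" by (simp add: algebra_simps rf)
      then show ?thesis by (simp only: rbf[symmetric] rbfr diff_self)
    qed
    have c2: "r * b * (f - r * f) = 0"
    proof -
      have "r * b * (f - r * f) = r * b * f - r * b * f * r" by (simp add: algebra_simps rf)
      then show ?thesis by (simp only: rbfr diff_self)
    qed
    have cr: "p * r = r * p" if "p \<in> PP" for p by (rule PPc[OF that rPP])
    have cf: "p * f = f * p" if "p \<in> PP" for p by (rule PPc[OF that fPP])
    have ce: "p * E2 = E2 * p" if "p \<in> PP" for p by (rule PPc[OF that E2PP])
    have "E2 - r \<in> PP"
    proof (rule PPmax)
      show "pr (E2 - r)" by (rule pr_diff[OF E(4) r(2,3)])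
      show "\<forall>p\<in>PP. (E2 - r) * p = p * (E2 - r)" using cr ce by (simp add: algebra_simps)
    qed (use r E in \<open>auto intro!: ins simp: algebra_simps pr_idem\<close>)
    moreover have rfPP: "r * f \<in> PP"
    proof (rule PPmax)
      show "pr (r * f)" by (rule pr_mult[OF r(2) f(2) rf])
      show "\<forall>p\<in>PP. r * f * p = p * (r * f)"
      proof
        fix p assume "p \<in> PP"
        then show "r * f * p = p * (r * f)" using cr[of p] cf[of p] by (metis mult.assoc)
      qed
    qed (use r f in \<open>auto intro!: ins simp: mult.assoc[symmetric]\<close>)
    ultimately have d1: "E2 - r = 0 \<or> r * f = 0" using bgen c1 by blast
    have "f - r * f \<in> PP"
    proof (rule PPmax)
      show "pr (f - r * f)"
        using f r rf by (intro pr_diff pr_mult) (auto simp: pr_idem' rf)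
      show "\<forall>p\<in>PP. (f - r * f) * p = p * (f - r * f)"
      proof
        fix p assume "p \<in> PP"
        then show "(f - r * f) * p = p * (f - r * f)"
          using PPc[of p "r * f"] rfPP cf[of p] by (simp only: left_diff_distrib right_diff_distrib)
      qed
      show "E2 * (f - r * f) = f - r * f" using r f by (simp add: right_diff_distrib mult.assoc[symmetric])
    qed (use r f in \<open>auto intro!: ins\<close>)
    then have d2: "r = 0 \<or> f - r * f = 0" using bgen[OF rPP _ c2] by blast
    have "r = E2 \<or> r = 0" using d1 d2 \<open>f \<noteq> 0\<close> by auto
    then show "q * E2 = 0 \<or> (1 - q) * E2 = 0" using qE(2) by (auto simp: r_def algebra_simps)
    \<comment> \<open>A zero in the \<open>E2\<close> corner spreads along the entries:
      \<open>w\<close> takes it to \<open>E3\<close>, \<open>v\<close> to \<open>v * star v\<close>,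
      and \<open>y\<close> to what is left of \<open>E1\<close>.\<close>
    show "q = 0" if z: "q * E2 = 0"
    proof -
      have "w * q = 0" using qw z w(3) by (metis mult.assoc mult_zero_left)
      then have q3: "E3 * q = 0" by (metis w(2) mult.assoc mult_zero_right)
      have "v * q = 0" using z vE qE(2) by (metis mult.assoc mult_zero_right)
      then have qv0: "q * v = 0" using qv by simp
      have "(star y + v * b * w) * q = 0" by (simp add: distrib_right mult.assoc \<open>w * q = 0\<close>)
        (metis q3 sy(1) mult.assoc mult_zero_right)
      then have "q * star y + q * (v * b * w) = 0" using qc by (simp add: distrib_left)
      moreover have "q * (v * b * w) = 0" by (simp add: qv0 flip: mult.assoc)
      ultimately have "q * star y = 0" by simp
      then have "q * (E1 - v * star v) = 0" using y(2) by (metis mult.assoc mult_zero_left)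
      moreover have "q * (v * star v) = 0" by (simp add: qv0 flip: mult.assoc)
      ultimately have "q * E1 = 0" by (simp add: algebra_simps)
      then have "q * (E1 + E2 + E3) = 0" using z q3 qE(3) by (simp add: distrib_left)
      then show ?thesis by (simp add: sum)
    qed
  qed
  have "q = 0 \<or> q = 1"
    if q: "q \<in> M" "pr q" and qE: "q * E1 = E1 * q" "q * E2 = E2 * q" "q * E3 = E3 * q" and qK: "q * K = K * q" for q
  proof -
    have q': "1 - q \<in> M" "pr (1 - q)" "(1 - q) * E1 = E1 * (1 - q)" "(1 - q) * E2 = E2 * (1 - q)"
      "(1 - q) * E3 = E3 * (1 - q)" "(1 - q) * K = K * (1 - q)"
      using q qE qK by (auto intro!: ins pr_compl simp: algebra_simps)
    show ?thesis using main[OF q qE qK] vanish[OF q qE qK] vanish[OF q'] by auto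
  qed
  then show ?thesis using KM Ks K11 K22 K33 by (intro bexI[of _ K]) auto
qed

lemma irreducible_offdiagonal:
  assumes E: "E1 \<in> M" "pr E1" "E2 \<in> M" "pr E2" "E3 \<in> M" "pr E3"
    and orth: "E1 * E2 = 0" "E1 * E3 = 0" "E2 * E3 = 0" and sum: "E1 + E2 + E3 = 1"
    and nz: "E1 \<noteq> 0" "E2 \<noteq> 0" "E3 \<noteq> 0"
    and le: "ple M E1 (1 - E1)" "ple M E2 (1 - E2)" "ple M E3 (1 - E3)"
  shows "\<exists>K\<in>M. star K = K \<and> E1 * K * E1 = 0 \<and> E2 * K * E2 = 0 \<and> E3 * K * E3 = 0 \<and>
    (\<forall>q\<in>M. pr q \<longrightarrow> q * E1 = E1 * q \<longrightarrow> q * E2 = E2 * q \<longrightarrow> q * E3 = E3 * q \<longrightarrow> q * K = K * q \<longrightarrow>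
      q = 0 \<or> q = 1)"
proof -
  have orth': "E2 * E1 = 0" "E3 * E1 = 0" "E3 * E2 = 0" using orth E pr_orth_sym by blast+
  have s1: "1 - E1 = E2 + E3" and s2: "1 - E2 = E1 + E3" and s3: "1 - E3 = E1 + E2"
    by (simp_all flip: sum)
  have perm: ?thesis
    if ex: "\<exists>K\<in>M. star K = K \<and> A * K * A = 0 \<and> B * K * B = 0 \<and> C * K * C = 0 \<and>
      (\<forall>q\<in>M. pr q \<longrightarrow> q * A = A * q \<longrightarrow> q * B = B * q \<longrightarrow> q * C = C * q \<longrightarrow> q * K = K * q \<longrightarrow> q = 0 \<or> q = 1)"
      and eq: "{A, B, C} = {E1, E2, E3}" for A B C
  proof -
    obtain K where KM: "K \<in> M" and *: "star K = K \<and> A * K * A = 0 \<and> B * K * B = 0 \<and> C * K * C = 0 \<and>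
      (\<forall>q\<in>M. pr q \<longrightarrow> q * A = A * q \<longrightarrow> q * B = B * q \<longrightarrow> q * C = C * q \<longrightarrow> q * K = K * q \<longrightarrow> q = 0 \<or> q = 1)"
      by (rule bexE[OF ex])
    have K: "K \<in> M" "star K = K" "\<forall>X\<in>{A, B, C}. X * K * X = 0"
      "\<forall>q\<in>M. pr q \<longrightarrow> (\<forall>X\<in>{A, B, C}. q * X = X * q) \<longrightarrow> q * K = K * q \<longrightarrow> q = 0 \<or> q = 1"
      using KM * by simp_all
    then show ?thesis unfolding eq by (intro bexI[of _ K]) simp_all
  qed
  note c12 = comparison[OF E(1,2) E(3,4)] and c13 = comparison[OF E(1,2) E(5,6)] and c23 = comparison[OF E(3,4) E(5,6)]
  \<comment> \<open>Every outcome of the three comparisons, even a cyclic one, contains a descending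
    chain through all three projections, and the conclusion is symmetric in them.\<close>
  consider
    (a) "ple M E2 E1" "ple M E3 E2" | (b) "ple M E3 E1" "ple M E2 E3" | (c) "ple M E1 E2" "ple M E3 E1"
    | (d) "ple M E3 E2" "ple M E1 E3" | (e) "ple M E1 E3" "ple M E2 E1" | (f) "ple M E2 E3" "ple M E1 E2"
    using c12 c13 c23 by blast
  then show ?thesis
  proof cases
    case a
    show ?thesis
      by (rule irreducible_offdiagonal_sorted[OF E orth sum nz(3) a]) (use le in \<open>simp only: s1\<close>)
  next
    case b
    have "E1 + E3 + E2 = 1" "1 - E1 = E3 + E2" using sum by (simp_all add: algebra_simps s1)
    from irreducible_offdiagonal_sorted[OF E(1,2,5,6,3,4) orth(2,1) orth'(3) this(1) nz(2) b le(1)[unfolded this(2)]]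
    show ?thesis by (rule perm) auto
  next
    case c
    have "E2 + E1 + E3 = 1" "1 - E2 = E1 + E3" using sum by (simp_all add: algebra_simps s2)
    from irreducible_offdiagonal_sorted[OF E(3,4,1,2,5,6) orth'(1) orth(3,2) this(1) nz(3) c le(2)[unfolded this(2)]]
    show ?thesis by (rule perm) auto
  next
    case d
    have "E2 + E3 + E1 = 1" "1 - E2 = E3 + E1" using sum by (simp_all add: algebra_simps s2)
    from irreducible_offdiagonal_sorted[OF E(3,4,5,6,1,2) orth(3) orth'(1,2) this(1) nz(1) d le(2)[unfolded this(2)]]
    show ?thesis by (rule perm) auto
  next
    case e
    have "E3 + E1 + E2 = 1" "1 - E3 = E1 + E2" using sum by (simp_all add: algebra_simps s3)
    from irreducible_offdiagonal_sorted[OF E(5,6,1,2,3,4) orth'(2,3) orth(1) this(1) nz(2) e le(3)[unfolded this(2)]]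
    show ?thesis by (rule perm) auto
  next
    case f
    have "E3 + E2 + E1 = 1" "1 - E3 = E2 + E1" using sum by (simp_all add: algebra_simps s3)
    from irreducible_offdiagonal_sorted[OF E(5,6,3,4,1,2) orth'(3,2,1) this(1) nz(1) f le(3)[unfolded this(2)]]
    show ?thesis by (rule perm) auto
  qed
qed

end

section \<open>Three small spectral projections\<close>

lemma pr_orth_sum:
  fixes p :: "nat \<Rightarrow> 'h::complex_hilbert_space cop"
  assumes p: "\<And>n. pr (p n)" and orth: "\<And>i j. i < j \<Longrightarrow> p i * p j = 0"
  shows "pr (\<Sum>k<n. p k)" and "n \<le> m \<Longrightarrow> (\<Sum>k<n. p k) * p m = 0"
    and "(\<Sum>k<Suc n. p k) * (\<Sum>k<n. p k) = (\<Sum>k<n. p k)"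
proof -
  have z: "(\<Sum>k<n. p k) * p m = 0" if "n \<le> m" for n m
    unfolding sum_distrib_right by (rule sum.neutral) (use orth that in auto)
  then show "n \<le> m \<Longrightarrow> (\<Sum>k<n. p k) * p m = 0" .
  have pr: "pr (\<Sum>k<n. p k)" for n
    by (induction n) (simp_all add: pr_add p z)
  then show "pr (\<Sum>k<n. p k)" .
  have "p n * (\<Sum>k<n. p k) = 0" using z[of n n] pr_orth_sym[OF pr p] by simp
  then show "(\<Sum>k<Suc n. p k) * (\<Sum>k<n. p k) = (\<Sum>k<n. p k)"
    by (simp add: distrib_right pr_idem pr)
qed

text \<open>The partial sums of the partial isometries extend one another because both families are
  orthogonal, so \<open>isometry_chain_limit\<close> applies.\<close>

lemma (in vn) ple_sum:
  assumes p: "\<And>n. pr (p n)" "\<And>i j. i < j \<Longrightarrow> p i * p j = 0"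
    and r: "\<And>n. pr (r n)" "\<And>i j. i < j \<Longrightarrow> r i * r j = 0"
    and le: "\<And>n. ple M (p n) (r n)"
    and L: "slim (\<lambda>n. \<Sum>k<n. p k) L" and Q: "\<And>n. Q * r n = r n"
  shows "ple M L Q"
proof -
  obtain V where V: "\<And>n. V n \<in> M" "\<And>n. star (V n) * V n = p n" "\<And>n. r n * V n = V n"
    using le unfolding ple_def by metis
  define U where "U n = (\<Sum>k<n. V k)" for n
  have Vp: "V n * p n = V n" for n by (rule isometry_right[OF p(1) V(2)])
  have Vr: "star (V n) * r n = star (V n)" for n using V(3) r(1) by (metis pr_star star_simps(6))
  have orthV: "star (V i) * V j = 0" if "i \<noteq> j" for i j
  proof -
    have "r i * r j = 0" using r that pr_orth_sym[OF r(1) r(1)] by (metis nat_neq_iff)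
    moreover have "star (V i) * V j = star (V i) * (r i * r j) * V j"
      by (metis V(3) Vr mult.assoc)
    ultimately show ?thesis by simp
  qed
  have UU: "star (U n) * U n = (\<Sum>k<n. p k)" for n
  proof (induction n)
    case (Suc n)
    have "star (U n) = (\<Sum>k<n. star (V k))" for n by (induction n) (simp_all add: U_def)
    then have 1: "star (U n) * V n = 0"
      by (simp add: sum_distrib_right orthV)
    then have 2: "star (V n) * U n = 0" by (metis star_simps(1,6) star_star)
    have "U (Suc n) = U n + V n" by (simp add: U_def)
    then show ?case by (simp add: algebra_simps 1 2 V Suc)
  qed (simp add: U_def)
  have UP: "U (Suc n) * (\<Sum>k<n. p k) = U n" for n
  proof -
    have "U n * (\<Sum>k<n. p k) = U n" by (rule isometry_right[OF pr_orth_sum(1)[of p, OF p] UU])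
    moreover have "V n * (\<Sum>k<n. p k) = 0"
    proof -
      have "p n * (\<Sum>k<n. p k) = 0"
        using pr_orth_sum(2)[of p, OF p order_refl, of n] pr_orth_sym[OF pr_orth_sum(1)[of p, OF p] p(1)] by simp
      then show ?thesis using Vp by (metis mult.assoc mult_zero_right)
    qed
    ultimately show ?thesis by (simp add: U_def distrib_right)
  qed
  have UM: "U n \<in> M" for n unfolding U_def by (intro ins V)
  obtain W where W: "W \<in> M" "slim U W" "star W * W = L"
    using isometry_chain_limit[of "\<lambda>n. \<Sum>k<n. p k", OF pr_orth_sum(1)[of p, OF p] pr_orth_sum(3)[of p, OF p] L UM UU UP]
    by blast
  have "Q * V n = V n" for n using Q V(3) by (metis mult.assoc)
  then have "Q * U n = U n" for n by (simp add: U_def mult_sum_right)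
  then have "Q * W = W" using slim_unique[OF slim_mult_left[OF W(2), of Q]] W(2) by simp
  then show ?thesis using W by (auto simp: ple_def)
qed

text \<open>\<open>BB\<close> stands for the hyperinvariant spectral projections and the
  \<open>P k\<close> for countably many cuts of the spectrum. An element that no \<open>P k\<close>
  splits plays the role of an atom. \<open>atom_small\<close> and \<open>not_two_atoms\<close> are
  the forms taken by the two conditions of the theorem.\<close>

locale bool_alg = sepfac M \<Phi> \<xi> for M :: "'h::complex_hilbert_space cop set" and \<Phi> \<xi> +
  fixes BB :: "'h cop set" and P :: "nat \<Rightarrow> 'h cop"
  assumes BB: "E \<in> BB \<Longrightarrow> E \<in> M" "E \<in> BB \<Longrightarrow> pr E"
    and BB_one: "1 \<in> BB"
    and BB_compl: "E \<in> BB \<Longrightarrow> 1 - E \<in> BB"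
    and BB_mult: "E \<in> BB \<Longrightarrow> F \<in> BB \<Longrightarrow> E * F \<in> BB"
    and BB_comm: "E \<in> BB \<Longrightarrow> F \<in> BB \<Longrightarrow> E * F = F * E"
    and BB_slim: "(\<And>n. X n \<in> BB) \<Longrightarrow> slim X L \<Longrightarrow> L \<in> BB"
    and P_BB: "P k \<in> BB"
    and atom_small: "S \<in> BB \<Longrightarrow> (\<And>k. P k * S = S \<or> P k * S = 0) \<Longrightarrow> ple M S (1 - S)"
    and not_two_atoms: "E \<in> BB \<Longrightarrow> F \<in> BB \<Longrightarrow> E + F = 1 \<Longrightarrow>
      \<exists>k. (P k * E \<noteq> E \<and> P k * E \<noteq> 0) \<or> (P k * F \<noteq> F \<and> P k * F \<noteq> 0)"
    and nontrivial: "(1 :: 'h cop) \<noteq> 0"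
begin

definition small :: "'h cop \<Rightarrow> bool" where
  "small E \<longleftrightarrow> ple M E (1 - E)"

definition triple :: "'h cop \<Rightarrow> 'h cop \<Rightarrow> 'h cop \<Rightarrow> bool" where
  "triple A B C \<longleftrightarrow> A \<in> BB \<and> B \<in> BB \<and> C \<in> BB \<and> A * B = 0 \<and> A * C = 0 \<and> B * C = 0 \<and>
    A + B + C = 1 \<and> small A \<and> small B \<and> small C"

lemma BB_diff: "E \<in> BB \<Longrightarrow> F \<in> BB \<Longrightarrow> E * F = F \<Longrightarrow> E - F \<in> BB"
  using BB_mult[OF _ BB_compl, of E F] by (simp add: algebra_simps)

lemma BB_add: "E \<in> BB \<Longrightarrow> F \<in> BB \<Longrightarrow> E * F = 0 \<Longrightarrow> E + F \<in> BB"
  using BB_compl[OF BB_mult[OF BB_compl BB_compl], of E F] by (simp add: algebra_simps)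

lemma BB_zero: "0 \<in> BB"
  using BB_compl[OF BB_one] by simp

lemma small_sub:
  assumes "small E" "E \<in> BB" "F \<in> BB" "E * F = F" shows "small F"
proof -
  have "F * E = F" using assms BB pr_le_sym by blast
  have "ple M F E" by (rule ple_le) (use assms BB in auto)
  then have "ple M F (1 - E)" using assms(1) ple_trans by (auto simp: small_def)
  moreover have "(1 - F) * (1 - E) = 1 - E" using \<open>F * E = F\<close> by (simp add: algebra_simps)
  ultimately show ?thesis unfolding small_def by (rule ple_mono)
qed

lemma small_compl:
  assumes "E \<in> BB" "\<not> small E" shows "small (1 - E)"
  using comparison[of E "1 - E"] assms BB BB_compl by (auto simp: small_def)

lemma ple_zero:
  assumes "ple M E 0" shows "E = 0"
  using assms by (auto simp: ple_def)

lemma one_not_small: "\<not> small 1"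
  using ple_zero[of 1] nontrivial by (auto simp: small_def)

text \<open>Each slice \<open>D n - D m\<close> fits into a later slice \<open>D m - D l\<close>:
  otherwise \<open>D m\<close> would fit into \<open>D n - D m\<close>, which lies in its
  complement, and would be small. In a chain of consecutive slices the odd and the even ones then
  embed into each other, so both sums are small; the third member is the complement of the non-small
  \<open>D (i 0)\<close>.\<close>

lemma vanishing_tail_triple:
  assumes D: "\<And>n. D n \<in> BB" "\<And>n. D n * D (Suc n) = D (Suc n)" "slim D 0" "\<And>n. \<not> small (D n)"
  shows "\<exists>A B C. triple A B C"
proof -
  have prD: "pr (D n)" and DM: "D n \<in> M" for n using BB D(1) by auto
  have DD: "D m * D n = D n" if "m \<le> n" for m n
    using that
  proof (induction n rule: dec_induct)
    case (step n)
    then show ?case using D(2)[of n] by (metis mult.assoc)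
  qed (simp add: pr_idem prD)
  have DD': "D n * D m = D n" if "m \<le> n" for m n
    using DD[OF that] pr_le_sym[OF prD prD] by blast
  have BBd: "D m - D n \<in> BB" if "m \<le> n" for m n by (rule BB_diff[OF D(1) D(1) DD[OF that]])
  have step: "\<exists>l>m. ple M (D n - D m) (D m - D l)" if "n < m" for n m
  proof -
    define X where "X k = D m - D (m + k)" for k
    have XB: "X k \<in> BB" for k unfolding X_def by (rule BBd) simp
    have X0: "X 0 = 0" by (simp add: X_def)
    have "X (Suc k) * X k = X k" for k
      by (simp add: X_def algebra_simps DD DD' pr_idem prD)
    moreover have "slim X (D m - 0)"
      unfolding X_def by (rule slim_diff[OF slim_const]) (rule slim_subseq[OF D(3)], simp add: strict_mono_def)
    then have "slim X (D m)" by simp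
    ultimately have "(\<exists>k. ple M (D n - D m) (X k)) \<or> ple M (D m) (D n - D m)"
      using XB BB BBd[of n m] that X0 by (intro ple_limit) auto
    then show ?thesis
    proof
      assume "\<exists>k. ple M (D n - D m) (X k)"
      then obtain k where "ple M (D n - D m) (X k)" by blast
      moreover have "X (Suc k) * X k = X k" by fact
      ultimately have "ple M (D n - D m) (X (Suc k))" by (rule ple_mono)
      then show ?thesis by (intro exI[of _ "m + Suc k"]) (simp add: X_def)
    next
      assume *: "ple M (D m) (D n - D m)"
      have "(1 - D m) * (D n - D m) = D n - D m"
        using that by (simp add: algebra_simps DD' pr_idem prD less_imp_le)
      then have "small (D m)" unfolding small_def using * ple_mono by blast
      then show ?thesis using D(4) by blast
    qed
  qed
  \<comment> \<open>The pair holds two consecutive indices, since the next slice depends on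
    both.\<close>
  have "\<exists>h. \<forall>k. fst (h k) < snd (h k) \<and> (fst (h (Suc k)) = snd (h k) \<and>
      ple M (D (fst (h k)) - D (snd (h k))) (D (snd (h k)) - D (snd (h (Suc k)))))"
  proof (rule dependent_nat_choice)
    show "\<exists>x. fst x < snd (x::nat \<times> nat)" by (rule exI[of _ "(0, 1)"]) simp
    fix x :: "nat \<times> nat" and k :: nat
    assume "fst x < snd x"
    then obtain l where "l > snd x" "ple M (D (fst x) - D (snd x)) (D (snd x) - D l)" using step by blast
    then show "\<exists>y. fst y < snd y \<and> (fst y = snd x \<and> ple M (D (fst x) - D (snd x)) (D (snd x) - D (snd y)))"
      by (intro exI[of _ "(snd x, l)"]) simp
  qed
  then obtain h where h: "\<forall>k. fst (h k) < snd (h k) \<and> (fst (h (Suc k)) = snd (h k) \<and>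
      ple M (D (fst (h k)) - D (snd (h k))) (D (snd (h k)) - D (snd (h (Suc k)))))" by (rule exE)
  define i where "i k = fst (h k)" for k
  define a where "a k = D (i k) - D (i (Suc k))" for k
  have i: "i k < i (Suc k)" for k using h by (simp add: i_def)
  have ale: "ple M (a k) (a (Suc k))" for k
    using h[rule_format, of k] h[rule_format, of "Suc k"] by (simp add: a_def i_def)
  have smi: "strict_mono i" using i by (simp add: strict_mono_Suc_iff)
  have aB: "a k \<in> BB" for k unfolding a_def by (rule BBd) (use i[of k] in simp)
  have pra: "pr (a k)" for k using BB aB by auto
  have orth: "a j * a k = 0" if "j < k" for j k
  proof -
    have "i (Suc j) \<le> i k" using smi that by (simp add: strict_mono_less_eq Suc_le_eq)
    moreover have "i j < i (Suc j)" "i k < i (Suc k)" using i by auto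
    ultimately show ?thesis by (simp add: a_def algebra_simps DD)
  qed
  define Ev where "Ev n = (\<Sum>k<n. a (2 * k))" for n
  define Od where "Od n = (\<Sum>k<n. a (2 * k + 1))" for n
  have orthE: "a (2 * j) * a (2 * k) = 0" "a (2 * j + 1) * a (2 * k + 1) = 0"
    "a (2 * Suc j) * a (2 * Suc k) = 0" if "j < k" for j k
    using that by (intro orth; simp)+
  have aa: "a j * a k = 0" if "j \<noteq> k" for j k
    using orth that pr_orth_sym[OF pra pra] by (metis nat_neq_iff)
  note sE = pr_orth_sum[of "\<lambda>k. a (2 * k)", OF pra orthE(1), folded Ev_def]
  note sO = pr_orth_sum[of "\<lambda>k. a (2 * k + 1)", OF pra orthE(2), folded Od_def]
  obtain EE where EE: "slim Ev EE" "pr EE" "\<And>n. EE * Ev n = Ev n"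
    using pr_incseq_slim[of Ev, OF sE(1,3)] by blast
  obtain Om where Om: "slim Od Om" "pr Om" "\<And>n. Om * Od n = Od n"
    using pr_incseq_slim[of Od, OF sO(1,3)] by blast
  have "Ev n \<in> BB" for n
    by (induction n) (use sE(2) in \<open>auto simp: Ev_def BB_zero intro!: BB_add aB\<close>)
  then have EEB: "EE \<in> BB" by (rule BB_slim[OF _ EE(1)])
  have "Od n \<in> BB" for n
    by (induction n) (use sO(2) in \<open>auto simp: Od_def BB_zero intro!: BB_add aB\<close>)
  then have OmB: "Om \<in> BB" by (rule BB_slim[OF _ Om(1)])
  have EEa: "EE * a (2 * n) = a (2 * n)" for n
  proof -
    have "a (2 * n) = Ev (Suc n) - Ev n" by (simp add: Ev_def)
    then show ?thesis by (simp only: right_diff_distrib EE(3))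
  qed
  have Oma: "Om * a (2 * n + 1) = a (2 * n + 1)" for n
  proof -
    have "a (2 * n + 1) = Od (Suc n) - Od n" by (simp add: Od_def)
    then show ?thesis by (simp only: right_diff_distrib Om(3))
  qed
  have "Ev n * Od m = 0" for n m
    unfolding Ev_def Od_def sum_product by (intro sum.neutral ballI aa) presburger
  then have "slim (\<lambda>n. 0) (EE * Od m)" for m using slim_mult_right[OF EE(1), of "Od m"] by simp
  then have "EE * Od m = 0" for m using slim_unique[OF slim_const] by metis
  then have "slim (\<lambda>n. 0) (EE * Om)" using slim_mult_left[OF Om(1), of EE] by simp
  then have EO: "EE * Om = 0" using slim_unique[OF slim_const] by metis
  have OE: "Om * EE = 0" using EO EE Om pr_orth_sym by blast
  have "Ev n + Od n = D (i 0) - D (i (2 * n))" for n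
  proof (induction n)
    case (Suc n)
    have "Ev (Suc n) + Od (Suc n) = (Ev n + Od n) + (a (2 * n) + a (2 * n + 1))"
      by (simp add: Ev_def Od_def)
    then show ?case unfolding Suc by (simp add: a_def)
  qed (simp add: Ev_def Od_def)
  moreover have "slim (\<lambda>n. Ev n + Od n) (EE + Om)" by (intro slim_add EE Om)
  moreover have "slim (\<lambda>n. D (i 0) - D (i (2 * n))) (D (i 0) - 0)"
  proof (rule slim_diff[OF slim_const])
    have "strict_mono (\<lambda>n. i (2 * n))" using smi by (simp add: strict_mono_def)
    then show "slim (\<lambda>n. D (i (2 * n))) 0" by (rule slim_subseq[OF D(3)])
  qed
  ultimately have sumEO: "EE + Om = D (i 0)" using slim_unique by fastforce
  have 1: "ple M EE Om"
  proof (rule ple_sum[where p = "\<lambda>k. a (2 * k)" and r = "\<lambda>k. a (2 * k + 1)"])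
    show "ple M (a (2 * n)) (a (2 * n + 1))" for n using ale[of "2 * n"] by simp
    show "slim (\<lambda>n. \<Sum>k<n. a (2 * k)) EE" using EE(1) unfolding Ev_def .
  qed (use pra orthE Oma in auto)
  \<comment> \<open>Each odd slice goes to the even one after it. The index shift leaves
    \<open>a 0\<close> uncovered, which is harmless for subequivalence.\<close>
  have 2: "ple M Om EE"
  proof (rule ple_sum[where p = "\<lambda>k. a (2 * k + 1)" and r = "\<lambda>k. a (2 * Suc k)"])
    show "ple M (a (2 * n + 1)) (a (2 * Suc n))" for n using ale[of "2 * n + 1"] by simp
    show "slim (\<lambda>n. \<Sum>k<n. a (2 * k + 1)) Om" using Om(1) unfolding Od_def .
    show "EE * a (2 * Suc n) = a (2 * Suc n)" for n by (rule EEa)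
    show "a (2 * Suc j) * a (2 * Suc k) = 0" if "j < k" for j k by (rule orthE(3)[OF that])
  qed (use pra orthE in auto)
  have "(1 - EE) * Om = Om" "(1 - Om) * EE = EE" by (simp_all add: algebra_simps EO OE)
  then have "small EE" "small Om" unfolding small_def using 1 2 ple_mono by blast+
  moreover have "small (1 - D (i 0))" by (rule small_compl[OF D(1,4)])
  moreover have "EE * (1 - D (i 0)) = 0" "Om * (1 - D (i 0)) = 0"
    unfolding sumEO[symmetric] by (simp_all add: algebra_simps EO OE pr_idem EE Om)
  ultimately have "triple EE Om (1 - D (i 0))"
    unfolding triple_def using EEB OmB EO BB_compl[OF D(1)] sumEO by simp
  then show ?thesis by blast
qed

text \<open>
  Bisection along the \<open>P k\<close>: as long as no triple appears, one half of the current projection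
  fails to be small. The limit is an atom, hence small by hypothesis, and what remains shrinks to 0.
\<close>

lemma triple_exists: "\<exists>A B C. triple A B C"
proof (rule ccontr)
  assume no: "\<not> ?thesis"
  have step: "\<exists>S'. (S' \<in> BB \<and> \<not> small S') \<and> (S' = S * P k \<or> S' = S * (1 - P k))"
    if S: "S \<in> BB \<and> \<not> small S" for S k
  proof (rule ccontr)
    assume *: "\<not> ?thesis"
    have SB: "S \<in> BB" and PB: "P k \<in> BB" using S P_BB by auto
    have m: "S * P k \<in> BB" "S * (1 - P k) \<in> BB" "1 - S \<in> BB"
      using SB PB by (auto intro!: BB_mult BB_compl)
    have c: "P k * S = S * P k" by (rule BB_comm[OF PB SB])
    have i: "S * S = S" "P k * P k = P k" using BB(2)[OF SB] BB(2)[OF PB] by (auto simp: pr_idem)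
    have c2: "P k * (S * x) = S * (P k * x)" for x using c by (metis mult.assoc)
    have s3: "small (S * P k)" "small (S * (1 - P k))" "small (1 - S)"
      using * m small_compl[OF SB] S by auto
    have "triple (S * P k) (S * (1 - P k)) (1 - S)"
      unfolding triple_def using m s3
      by (simp add: algebra_simps c c2 i mult_ctx[OF i(1)])
    then show False using no by blast
  qed
  have "\<exists>S. \<forall>n. (S n \<in> BB \<and> \<not> small (S n)) \<and> (S (Suc n) = S n * P n \<or> S (Suc n) = S n * (1 - P n))"
    by (rule dependent_nat_choice) (use BB_one one_not_small step in blast)+
  then obtain S where S: "\<And>n. S n \<in> BB" "\<And>n. \<not> small (S n)"
    "\<And>n. S (Suc n) = S n * P n \<or> S (Suc n) = S n * (1 - P n)" by blast
  have prS: "pr (S n)" for n using BB(2) S(1) by blast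
  have dec: "S n * S (Suc n) = S (Suc n)" for n
    using S(3)[of n] by (auto simp: pr_idem' prS)
  obtain L where L: "slim S L" "pr L" "\<And>n. S n * L = L" using pr_decseq_slim[of S, OF prS dec] by blast
  have LB: "L \<in> BB" by (rule BB_slim[OF S(1) L(1)])
  have sL: "small L"
    unfolding small_def
  proof (rule atom_small[OF LB])
    fix k
    have PS: "P k * S k = S k * P k" by (rule BB_comm[OF P_BB S(1)])
    have iP: "P k * P k = P k" using BB(2)[OF P_BB] by (simp add: pr_idem)
    from S(3)[of k] show "P k * L = L \<or> P k * L = 0"
    proof
      assume "S (Suc k) = S k * P k"
      then have "P k * S (Suc k) = S (Suc k)" by (metis PS iP mult.assoc)
      then show ?thesis using L(3)[of "Suc k"] by (metis mult.assoc)
    next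
      assume "S (Suc k) = S k * (1 - P k)"
      then have "P k * S (Suc k) = P k * S k - P k * (S k * P k)"
        by (simp only: right_diff_distrib mult_1_right)
      also have "P k * (S k * P k) = P k * S k" by (metis PS iP mult.assoc)
      finally have "P k * S (Suc k) = 0" by simp
      then show ?thesis using L(3)[of "Suc k"] by (metis mult.assoc mult_zero_left)
    qed
  qed
  define D where "D n = S n - L" for n
  have DB: "D n \<in> BB" for n unfolding D_def by (rule BB_diff[OF S(1) LB L(3)])
  have LS: "L * S n = L" for n using L(2,3) prS pr_le_sym by blast
  \<comment> \<open>If \<open>D n\<close> were small, then \<open>D n\<close>, \<open>L\<close> and
    \<open>1 - S n\<close> would form a triple.\<close>
  have Dns: "\<not> small (D n)" for n
  proof
    assume "small (D n)"
    moreover have "D n * L = 0" "D n * (1 - S n) = 0" "L * (1 - S n) = 0"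
      by (simp_all add: D_def algebra_simps L LS pr_idem prS)
    ultimately have "triple (D n) L (1 - S n)"
      unfolding triple_def using DB LB sL BB_compl[OF S(1)] small_compl[OF S(1,2)] by (simp add: D_def)
    then show False using no by blast
  qed
  have "slim D (L - L)" unfolding D_def by (intro slim_diff slim_const L)
  then have "slim D 0" by simp
  moreover have "D n * D (Suc n) = D (Suc n)" for n
    by (simp add: D_def algebra_simps dec L LS pr_idem)
  ultimately show False using vanishing_tail_triple[of D] DB Dns no by blast
qed

text \<open>A cut that properly splits one piece supplies the third member. The other piece is
  nonzero, for otherwise the split one would be 1, which is not small.\<close>

lemma split_two:
  assumes A: "A \<in> BB" and B: "B \<in> BB" and AB: "A * B = 0" "A + B = 1" and s: "small A" "small B"
  shows "\<exists>A B C. triple A B C \<and> A \<noteq> 0 \<and> B \<noteq> 0 \<and> C \<noteq> 0"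
proof -
  have half: ?thesis if E: "E \<in> BB" and F: "F \<in> BB" and EF: "E * F = 0" "E + F = 1" and s: "small E" "small F"
    and k: "P k * E \<noteq> E" "P k * E \<noteq> 0" for E F k
  proof -
    have m: "E * P k \<in> BB" "E * (1 - P k) \<in> BB" using E P_BB by (auto intro!: BB_mult BB_compl)
    have c: "P k * E = E * P k" by (rule BB_comm[OF P_BB E])
    have i: "E * E = E" "P k * P k = P k" using BB(2)[OF E] BB(2)[OF P_BB] by (auto simp: pr_idem)
    have c2: "P k * (E * x) = E * (P k * x)" for x using c by (metis mult.assoc)
    have FE: "F * E = 0" using EF E F BB pr_orth_sym by blast
    have PF: "P k * F = F * P k" by (rule BB_comm[OF P_BB F])
    have EPF: "E * (P k * F) = 0" by (simp add: PF mult_ctx[OF EF(1)])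
    have ss: "small (E * P k)" "small (E * (1 - P k))"
      by (rule small_sub[OF s(1) E]; use m in \<open>simp add: mult.assoc[symmetric] i\<close>)+
    have "triple (E * P k) (E * (1 - P k)) F"
      unfolding triple_def using m F ss s(2) EF
      by (simp add: algebra_simps c c2 i mult_ctx[OF i(1)] EPF)
    moreover have "F \<noteq> 0" using EF s(1) one_not_small by auto
    moreover have "E * P k \<noteq> 0" "E * (1 - P k) \<noteq> 0" using k by (auto simp: c algebra_simps)
    ultimately show ?thesis by blast
  qed
  obtain k where "(P k * A \<noteq> A \<and> P k * A \<noteq> 0) \<or> (P k * B \<noteq> B \<and> P k * B \<noteq> 0)"
    using not_two_atoms[OF A B AB(2)] by blast
  then show ?thesis
  proof
    assume "P k * A \<noteq> A \<and> P k * A \<noteq> 0"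
    then show ?thesis using half[OF A B AB s] by blast
  next
    assume k: "P k * B \<noteq> B \<and> P k * B \<noteq> 0"
    have "B * A = 0" "B + A = 1" using AB A B BB pr_orth_sym by (blast, simp add: add.commute)
    then show ?thesis using half[OF B A _ _ s(2,1)] k by blast
  qed
qed

lemma nonzero_triple_exists: "\<exists>A B C. triple A B C \<and> A \<noteq> 0 \<and> B \<noteq> 0 \<and> C \<noteq> 0"
proof -
  obtain A B C where t: "triple A B C" using triple_exists by blast
  then have t': "A \<in> BB" "B \<in> BB" "C \<in> BB" "A * B = 0" "A * C = 0" "B * C = 0" "A + B + C = 1"
    "small A" "small B" "small C" by (auto simp: triple_def)
  consider "A = 0" | "B = 0" | "C = 0" | "A \<noteq> 0 \<and> B \<noteq> 0 \<and> C \<noteq> 0" by blast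
  then show ?thesis
  proof cases
    case 1 then show ?thesis using split_two[OF t'(2,3,6) _ t'(9,10)] t'(7) by simp
  next
    case 2 then show ?thesis using split_two[OF t'(1,3,5) _ t'(8,10)] t'(7) by simp
  next
    case 3 then show ?thesis using split_two[OF t'(1,2,4) _ t'(8,9)] t'(7) by simp
  next
    case 4 then show ?thesis using t by blast
  qed
qed

end

section \<open>Hyperinvariant spectral projections of normal operators\<close>

text \<open>Polarisation with \<open>x + y\<close> and \<open>x + \<i> *\<^sub>C y\<close>.\<close>

lemma quadratic_form_zero:
  fixes T :: "'h::complex_hilbert_space cop"
  assumes "\<And>x. cinner (T \<cdot> x) x = 0" shows "T = 0"
proof (rule cop_cinner_eqI)
  fix x y
  have 1: "cinner (T \<cdot> x) y + cinner (T \<cdot> y) x = 0" for y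
    using assms[of "x + y"] assms[of x] assms[of y] by (simp add: app_add cinner_simps add.commute)
  have "- \<i> * cinner (T \<cdot> x) y + \<i> * cinner (T \<cdot> y) x = 0"
    using 1[of "\<i> *\<^sub>C y"] by (simp add: app_scaleC cinner_simps)
  then have "\<i> * (cinner (T \<cdot> y) x - cinner (T \<cdot> x) y) = 0" by (simp add: algebra_simps)
  then have "cinner (T \<cdot> x) y = 0" using 1[of y] by simp
  then show "cinner (T \<cdot> x) y = cinner (0 \<cdot> x) y" by simp
qed

text \<open>Evaluating the nonnegative form at \<open>x - (1 / R) *\<^sub>R (D \<cdot> x)\<close>
  bounds the squared norm of \<open>D \<cdot> x\<close> by \<open>R\<close> times the form at
  \<open>x\<close>.\<close>

lemma positive_form_bound:
  fixes D :: "'h::complex_hilbert_space cop"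
  assumes sa: "star D = D" and R: "R > 0"
    and form: "\<And>x. 0 \<le> Re (cinner (D \<cdot> x) x)" "\<And>x. Re (cinner (D \<cdot> x) x) \<le> R * (norm x)\<^sup>2"
  shows "norm (D \<cdot> x) \<le> R * norm x"
proof -
  define a b where "a = Re (cinner (D \<cdot> x) x)" and "b = (norm (D \<cdot> x))\<^sup>2"
  define y where "y = D \<cdot> x"
  have xy: "Re (cinner (D \<cdot> x) y) = b" by (simp add: b_def y_def power2_norm_eq_inner inner_eq_Re_cinner)
  have yx: "Re (cinner (D \<cdot> y) x) = b"
    by (simp add: star_cinner sa) (simp add: b_def y_def power2_norm_eq_inner inner_eq_Re_cinner)
  have "0 \<le> Re (cinner (D \<cdot> (x - (1 / R) *\<^sub>R y)) (x - (1 / R) *\<^sub>R y))" by (rule form)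
  also have "\<dots> = a - (1 / R) * b - (1 / R) * b + (1 / R) * ((1 / R) * Re (cinner (D \<cdot> y) y))"
    using xy yx by (simp add: app_diff app_scaleR scaleR_eq_scaleC app_scaleC cinner_simps a_def algebra_simps)
  also have "\<dots> \<le> a - (1 / R) * b - (1 / R) * b + (1 / R) * ((1 / R) * (R * b))"
  proof -
    have "Re (cinner (D \<cdot> y) y) \<le> R * b" using form(2)[of y] by (simp add: b_def y_def)
    then have "(1 / R) * Re (cinner (D \<cdot> y) y) \<le> (1 / R) * (R * b)" using R by (simp only: mult_left_mono zero_le_divide_1_iff less_imp_le)
    then have "(1 / R) * ((1 / R) * Re (cinner (D \<cdot> y) y)) \<le> (1 / R) * ((1 / R) * (R * b))"
      using R by (simp only: mult_left_mono zero_le_divide_1_iff less_imp_le)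
    then show ?thesis by linarith
  qed
  also have "\<dots> = a - b / R" using R by (simp add: field_simps)
  finally have "b \<le> R * a" using R by (simp add: field_simps)
  also have "\<dots> \<le> R * (R * (norm x)\<^sup>2)" using form(2)[of x] R by (intro mult_left_mono) (simp_all add: a_def)
  finally have "(norm (D \<cdot> x))\<^sup>2 \<le> (R * norm x)\<^sup>2" by (simp add: b_def power2_eq_square algebra_simps)
  from power2_le_imp_le[OF this] R show ?thesis by simp
qed

lemma geometric_decay:
  fixes a K \<rho> \<sigma> :: real
  assumes "0 \<le> \<rho>" "\<rho> < \<sigma>" and le: "\<And>n. \<sigma> ^ n * a \<le> K * \<rho> ^ n"
  shows "a \<le> 0"
proof -
  have s: "\<sigma> > 0" using assms by simp
  have "a \<le> K * (\<rho> / \<sigma>) ^ n" for n using le[of n] s by (simp add: power_divide field_simps)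
  moreover have "(\<lambda>n. K * (\<rho> / \<sigma>) ^ n) \<longlonglongrightarrow> K * 0"
    using assms s by (intro tendsto_mult tendsto_const LIMSEQ_power_zero) simp
  ultimately show ?thesis using LIMSEQ_le_const[of "\<lambda>n. K * (\<rho> / \<sigma>) ^ n" "K * 0" a] by simp
qed

text \<open>\<open>P\<close> is the spectral projection of the real part of \<open>N\<close> for the
  half-line up to \<open>t\<close>, described through the form; the strictness clause assigns the
  boundary value \<open>t\<close> to \<open>P\<close>. The description is the same for
  \<open>N\<close> and \<open>star N\<close>.\<close>

definition half_plane :: "'h::complex_hilbert_space cop \<Rightarrow> real \<Rightarrow> 'h cop \<Rightarrow> bool" where
  "half_plane N t P \<longleftrightarrow> pr P \<and>
    (\<forall>S. S * (N + star N) = (N + star N) * S \<longrightarrow> S * P = P * S) \<and>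
    (\<forall>x. P \<cdot> x = x \<longrightarrow> Re (cinner (N \<cdot> x) x) \<le> t * (norm x)\<^sup>2) \<and>
    (\<forall>x. P \<cdot> x = 0 \<longrightarrow> t * (norm x)\<^sup>2 \<le> Re (cinner (N \<cdot> x) x) \<and>
      (t * (norm x)\<^sup>2 = Re (cinner (N \<cdot> x) x) \<longrightarrow> x = 0))"

lemma half_plane_exists: "\<exists>P. half_plane N t P \<and> (\<forall>M. vn M \<longrightarrow> N \<in> M \<longrightarrow> P \<in> M)"
proof -
  define A where "A = (1 / 2) *\<^sub>R (N + star N) - t *\<^sub>R 1"
  have As: "star A = A" by (simp add: A_def add.commute)
  obtain P where *: "pr P \<and> (\<forall>M. vn M \<longrightarrow> A \<in> M \<longrightarrow> P \<in> M) \<and> (\<forall>S. S * A = A * S \<longrightarrow> S * P = P * S) \<and>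
    (\<forall>x. P \<cdot> x = x \<longrightarrow> Re (cinner (A \<cdot> x) x) \<le> 0) \<and>
    (\<forall>x. P \<cdot> x = 0 \<longrightarrow> Re (cinner (A \<cdot> x) x) \<ge> 0 \<and> (Re (cinner (A \<cdot> x) x) = 0 \<longrightarrow> x = 0))"
    by (rule exE[OF spectral_projection_exists[OF As]])
  then have P: "pr P" "\<And>M. vn M \<Longrightarrow> A \<in> M \<Longrightarrow> P \<in> M" "\<And>S. S * A = A * S \<Longrightarrow> S * P = P * S"
    "\<And>x. P \<cdot> x = x \<Longrightarrow> Re (cinner (A \<cdot> x) x) \<le> 0"
    "\<And>x. P \<cdot> x = 0 \<Longrightarrow> Re (cinner (A \<cdot> x) x) \<ge> 0 \<and> (Re (cinner (A \<cdot> x) x) = 0 \<longrightarrow> x = 0)"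
    by simp_all
  have form: "Re (cinner (A \<cdot> x) x) = Re (cinner (N \<cdot> x) x) - t * (norm x)\<^sup>2" for x
  proof -
    have "Re (cinner (star N \<cdot> x) x) = Re (cinner (N \<cdot> x) x)"
      by (subst cinner_commute) (simp add: star_cinner')
    then show ?thesis
      by (simp add: A_def scaleR_eq_scaleC cinner_simps cinner_self del: of_real_power)
  qed
  have "P \<in> M" if "vn M" "N \<in> M" for M
  proof -
    interpret vn M by fact
    show ?thesis by (rule P(2)[OF that(1)]) (unfold A_def, intro ins that)
  qed
  moreover have "S * P = P * S" if "S * (N + star N) = (N + star N) * S" for S
  proof (rule P(3))
    have "S * ((1 / 2) *\<^sub>R (N + star N)) = (1 / 2) *\<^sub>R (N + star N) * S"
      unfolding mult_scaleR_right mult_scaleR_left that ..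
    then show "S * A = A * S" by (simp add: A_def right_diff_distrib left_diff_distrib)
  qed
  ultimately show ?thesis
    unfolding half_plane_def using P(1,4,5) unfolding form by (intro exI[of _ P]) auto
qed

text \<open>
  This replaces Fuglede's theorem. Vectors \<open>x\<close> in the half plane to the left of \<open>t\<close> satisfy
  \<open>\<parallel>(N - c)\<^sup>n x\<parallel> \<le> \<rho>\<^sup>n \<parallel>x\<parallel>\<close> for discs with a far away centre \<open>c\<close>, and this growth bound is inherited
  by \<open>S x\<close> for every \<open>S\<close> commuting with \<open>N\<close>, even if \<open>S\<close> does not commute with \<open>N\<^sup>*\<close>.
\<close>

lemma half_plane_separation:
  fixes N :: "'h::complex_hilbert_space cop"
  assumes normal: "star N * N = N * star N" and P: "half_plane N t P" and Q: "half_plane N (t + e) Q" and e: "e > 0"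
    and S: "S * N = N * S"
  shows "(1 - Q) * S * P = 0"
proof -
  define L where "L = norm N"
  have L: "L \<ge> 0" by (simp add: L_def)
  \<comment> \<open>\<open>R \<ge> L + t\<close> makes the real part of \<open>N - c\<close>
    nonnegative, and \<open>R > L\<^sup>2 / e\<close> makes the disc flat enough that
    \<open>\<rho> < R + e\<close> below.\<close>
  define R where "R = L + \<bar>t\<bar> + L\<^sup>2 / e + 1"
  have R: "R > 0" "R \<ge> L + t" using L e by (auto simp: R_def add_nonneg_pos add_increasing2 divide_nonneg_pos)
  define c where "c = t - R"
  define A where "A = (1 / 2) *\<^sub>R (N + star N) - c *\<^sub>R 1"
  define B where "B = csc (- \<i> / 2) * (N - star N)"
  have As: "star A = A" and Bs: "star B = B"
  proof -
    show "star A = A" by (simp add: A_def add.commute)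
    have "star B = csc (\<i> / 2) * (star N - N)" by (simp add: B_def csc_commute)
    also have "\<dots> = - csc (\<i> / 2) * (N - star N)" by (simp add: algebra_simps)
    finally show "star B = B" by (simp add: B_def csc_minus)
  qed
  define N' where "N' = N - c *\<^sub>R 1"
  have N': "N' \<cdot> x = A \<cdot> x + \<i> *\<^sub>C (B \<cdot> x)" for x
  proof -
    have h: "\<i> * (- \<i> / 2) = complex_of_real (1 / 2)" by simp
    have "\<i> *\<^sub>C (B \<cdot> x) = complex_of_real (1 / 2) *\<^sub>C (N \<cdot> x - star N \<cdot> x)"
      by (simp add: B_def scaleC_scaleC)
    also have "\<dots> = (1 / 2) *\<^sub>R (N \<cdot> x - star N \<cdot> x)" by (rule scaleR_eq_scaleC[symmetric])
    finally have "A \<cdot> x + \<i> *\<^sub>C (B \<cdot> x) = ((1 / 2) *\<^sub>R (N \<cdot> x) + (1 / 2) *\<^sub>R (N \<cdot> x)) - c *\<^sub>R x"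
      by (simp add: A_def algebra_simps)
    then show ?thesis by (simp add: N'_def flip: scaleR_left_distrib)
  qed
  have AB: "A * B = B * A"
  proof -
    have "(N + star N) * (N - star N) = (N - star N) * (N + star N)"
      using normal by (simp add: algebra_simps)
    then have *: "(N + star N) * (csc (- \<i> / 2) * (N - star N)) = csc (- \<i> / 2) * (N - star N) * (N + star N)"
      by (metis csc_commute mult.assoc)
    show ?thesis unfolding A_def B_def left_diff_distrib right_diff_distrib[of _ _ "c *\<^sub>R 1"]
        mult_scaleR_left mult_scaleR_right * by simp
  qed
  \<comment> \<open>The real and imaginary parts of a normal operator commute, so the cross terms
    cancel.\<close>
  have pyth: "(norm (N' \<cdot> x))\<^sup>2 = (norm (A \<cdot> x))\<^sup>2 + (norm (B \<cdot> x))\<^sup>2" for x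
  proof -
    have "cnj (cinner (A \<cdot> x) (B \<cdot> x)) = cinner (A \<cdot> x) (B \<cdot> x)"
    proof -
      have "cinner (A \<cdot> x) (B \<cdot> x) = cinner ((B * A) \<cdot> x) x" by (simp add: star_cinner' Bs)
      also have "\<dots> = cinner ((A * B) \<cdot> x) x" by (simp only: AB)
      also have "\<dots> = cinner (B \<cdot> x) (A \<cdot> x)" by (simp add: star_cinner As)
      finally show ?thesis using cinner_commute by metis
    qed
    then have im: "Im (cinner (A \<cdot> x) (B \<cdot> x)) = 0" by (simp add: complex_eq_iff)
    have "Re (cinner (B \<cdot> x) (A \<cdot> x)) = Re (cinner (A \<cdot> x) (B \<cdot> x))" "Im (cinner (B \<cdot> x) (A \<cdot> x)) = 0"
      using im by (subst cinner_commute, simp)+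
    then show ?thesis
      by (simp add: N' power2_norm_eq_inner inner_eq_Re_cinner cinner_simps im)
  qed
  have nB: "norm (B \<cdot> x) \<le> L * norm x" for x
  proof -
    have "norm (star N \<cdot> x) \<le> L * norm x" "norm (N \<cdot> x) \<le> L * norm x"
      using norm_app[of "star N" x] norm_app[of N x] by (simp_all add: L_def)
    then show ?thesis
      using norm_triangle_ineq4[of "N \<cdot> x" "star N \<cdot> x"] by (simp add: B_def norm_scaleC norm_divide)
  qed
  have prP: "pr P" and PA: "\<And>S. S * (N + star N) = (N + star N) * S \<Longrightarrow> S * P = P * S"
    and Pf: "\<And>x. P \<cdot> x = x \<Longrightarrow> Re (cinner (N \<cdot> x) x) \<le> t * (norm x)\<^sup>2"
    using P by (auto simp: half_plane_def)
  have prQ: "pr Q" and QA: "\<And>S. S * (N + star N) = (N + star N) * S \<Longrightarrow> S * Q = Q * S"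
    and Qf: "\<And>x. Q \<cdot> x = 0 \<Longrightarrow> (t + e) * (norm x)\<^sup>2 \<le> Re (cinner (N \<cdot> x) x)"
    using Q by (auto simp: half_plane_def)
  have formA: "Re (cinner (A \<cdot> x) x) = Re (cinner (N \<cdot> x) x) - c * (norm x)\<^sup>2" for x
  proof -
    have "Re (cinner (star N \<cdot> x) x) = Re (cinner (N \<cdot> x) x)"
      by (subst cinner_commute) (simp add: star_cinner')
    then show ?thesis
      by (simp add: A_def scaleR_eq_scaleC cinner_simps cinner_self del: of_real_power)
  qed
  have NP: "N * P = P * N" and NQ: "N * Q = Q * N"
    using normal by (auto intro!: PA QA simp: algebra_simps)
  have AP: "A * P = P * A"
    by (rule PA) (simp add: A_def algebra_simps normal)
  define D where "D = P * A * P"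
  have Ds: "star D = D" by (simp add: D_def As pr_star prP mult.assoc)
  have Dform: "Re (cinner (D \<cdot> x) x) = Re (cinner (N \<cdot> P \<cdot> x) (P \<cdot> x)) - c * (norm (P \<cdot> x))\<^sup>2" for x
    by (simp add: D_def star_cinner[of P] pr_star prP formA)
  have bd: "norm (D \<cdot> x) \<le> R * norm x" for x
  proof (rule positive_form_bound[OF Ds R(1)])
    fix x
    have low: "- L * (norm (P \<cdot> x))\<^sup>2 \<le> Re (cinner (N \<cdot> P \<cdot> x) (P \<cdot> x))"
    proof -
      have "\<bar>Re (cinner (N \<cdot> P \<cdot> x) (P \<cdot> x))\<bar> \<le> norm (N \<cdot> P \<cdot> x) * norm (P \<cdot> x)"
        using abs_Re_le_cmod cmod_cinner_le order_trans by blast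
      also have "\<dots> \<le> L * norm (P \<cdot> x) * norm (P \<cdot> x)"
        unfolding L_def by (intro mult_right_mono norm_app) simp
      finally show ?thesis by (simp add: power2_eq_square abs_le_iff)
    qed
    have "0 \<le> (- L - c) * (norm (P \<cdot> x))\<^sup>2" using R by (simp add: c_def)
    then show "0 \<le> Re (cinner (D \<cdot> x) x)" unfolding Dform using low by (simp add: algebra_simps)
    have "Re (cinner (N \<cdot> P \<cdot> x) (P \<cdot> x)) \<le> t * (norm (P \<cdot> x))\<^sup>2"
      by (rule Pf) (simp add: pr_app_idem prP)
    then have "Re (cinner (D \<cdot> x) x) \<le> R * (norm (P \<cdot> x))\<^sup>2" unfolding Dform by (simp add: c_def algebra_simps)
    also have "\<dots> \<le> R * (norm x)\<^sup>2" using R pr_norm_le[OF prP, of x] by (simp add: mult_left_mono power_mono)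
    finally show "Re (cinner (D \<cdot> x) x) \<le> R * (norm x)\<^sup>2" .
  qed
  \<comment> \<open>On \<open>P\<close> the real part of \<open>N - c\<close> has norm at most
    \<open>R\<close> and the imaginary part at most \<open>L\<close>; off \<open>Q\<close> the real
    part is at least \<open>R + e\<close>.\<close>
  define \<rho> where "\<rho> = sqrt (R\<^sup>2 + L\<^sup>2)"
  have \<rho>: "0 \<le> \<rho>" "\<rho> < R + e"
  proof -
    show "0 \<le> \<rho>" by (simp add: \<rho>_def)
    have "L\<^sup>2 / e < R" using L by (simp add: R_def)
    then have "L\<^sup>2 < R * e" using e by (simp add: field_simps)
    moreover have "0 < e\<^sup>2" "0 < R * e" using e R by simp_all
    ultimately have "L\<^sup>2 < e\<^sup>2 + 2 * (R * e)" by linarith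
    then have "R\<^sup>2 + L\<^sup>2 < (R + e)\<^sup>2" by (simp add: power2_sum)
    then show "\<rho> < R + e" unfolding \<rho>_def using R e by (intro real_less_lsqrt) auto
  qed
  have up: "norm (N' \<cdot> x) \<le> \<rho> * norm x" if x: "P \<cdot> x = x" for x
  proof -
    have "D \<cdot> x = A \<cdot> x"
    proof -
      have "D \<cdot> x = (P * A) \<cdot> x" by (simp add: D_def x)
      also have "\<dots> = A \<cdot> x" unfolding AP[symmetric] by (simp add: x)
      finally show ?thesis .
    qed
    then have "norm (A \<cdot> x) \<le> R * norm x" using bd[of x] by simp
    then have "(norm (A \<cdot> x))\<^sup>2 \<le> (R * norm x)\<^sup>2" by (intro power_mono) simp_all
    moreover have "(norm (B \<cdot> x))\<^sup>2 \<le> (L * norm x)\<^sup>2" by (intro power_mono nB) simp_all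
    ultimately have "(norm (N' \<cdot> x))\<^sup>2 \<le> (R\<^sup>2 + L\<^sup>2) * (norm x)\<^sup>2"
      unfolding pyth by (simp add: power_mult_distrib distrib_right)
    also have "\<dots> = (\<rho> * norm x)\<^sup>2" by (simp add: \<rho>_def power_mult_distrib)
    finally have "(norm (N' \<cdot> x))\<^sup>2 \<le> (\<rho> * norm x)\<^sup>2" .
    from power2_le_imp_le[OF this] \<rho> show ?thesis by simp
  qed
  have lo: "(R + e) * norm y \<le> norm (N' \<cdot> y)" if y: "Q \<cdot> y = 0" for y
  proof -
    have "(R + e) * (norm y)\<^sup>2 \<le> Re (cinner (N' \<cdot> y) y)"
      using Qf[OF y] by (simp add: N'_def scaleR_eq_scaleC cinner_simps cinner_self c_def algebra_simps del: of_real_power)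
    also have "\<dots> \<le> norm (N' \<cdot> y) * norm y" using complex_Re_le_cmod cmod_cinner_le order_trans by blast
    finally show ?thesis by (cases "y = 0") (simp_all add: power2_eq_square)
  qed
  have N'P: "N' * P = P * N'" and N'Q: "N' * Q = Q * N'" and N'S: "N' * S = S * N'"
    using NP NQ S by (simp_all add: N'_def algebra_simps)
  show ?thesis
  proof (rule cop_eqI)
    fix x
    have comm_pow: "T * N' ^ n = N' ^ n * T" if "N' * T = T * N'" for T n
      using power_commuting_commutes[OF that] by simp
    have upn: "P \<cdot> z = z \<Longrightarrow> norm (N' ^ n \<cdot> z) \<le> \<rho> ^ n * norm z" for n z
    proof (induction n)
      case (Suc n)
      have "P \<cdot> N' ^ n \<cdot> z = N' ^ n \<cdot> z"
        using comm_pow[OF N'P, of n] Suc(2) by (metis app_simps(6))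
      then have "norm (N' \<cdot> N' ^ n \<cdot> z) \<le> \<rho> * norm (N' ^ n \<cdot> z)" by (rule up)
      also have "\<dots> \<le> \<rho> * (\<rho> ^ n * norm z)" using Suc \<rho> by (intro mult_left_mono) auto
      finally show ?case by (simp add: mult.assoc)
    qed simp
    have lon: "Q \<cdot> z = 0 \<Longrightarrow> (R + e) ^ n * norm z \<le> norm (N' ^ n \<cdot> z)" for n z
    proof (induction n)
      case (Suc n)
      have "Q \<cdot> N' ^ n \<cdot> z = 0"
        using comm_pow[OF N'Q, of n] Suc(2) by (metis app_simps(6) app_zero)
      then have "(R + e) * norm (N' ^ n \<cdot> z) \<le> norm (N' \<cdot> N' ^ n \<cdot> z)" by (rule lo)
      moreover have "(R + e) * ((R + e) ^ n * norm z) \<le> (R + e) * norm (N' ^ n \<cdot> z)"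
        using Suc R e by (intro mult_left_mono) auto
      ultimately show ?case by (simp add: mult.assoc)
    qed simp
    define y where "y = (1 - Q) \<cdot> S \<cdot> P \<cdot> x"
    have Qy: "Q \<cdot> y = 0" by (simp add: y_def app_diff pr_app_idem prQ)
    have "(R + e) ^ n * norm y \<le> (norm S * norm x) * \<rho> ^ n" for n
    proof -
      have "N' * (1 - Q) = (1 - Q) * N'" using N'Q by (simp add: algebra_simps)
      then have cy: "N' ^ n \<cdot> y = (1 - Q) \<cdot> S \<cdot> N' ^ n \<cdot> P \<cdot> x"
        using comm_pow[of "1 - Q" n] comm_pow[OF N'S, of n] unfolding y_def by (metis app_simps(6))
      have "(R + e) ^ n * norm y \<le> norm (N' ^ n \<cdot> y)" by (rule lon[OF Qy])
      also have "\<dots> \<le> norm (S \<cdot> N' ^ n \<cdot> P \<cdot> x)" unfolding cy by (rule pr_norm_le[OF pr_compl[OF prQ]])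
      also have "\<dots> \<le> norm S * norm (N' ^ n \<cdot> P \<cdot> x)" by (rule norm_app)
      also have "\<dots> \<le> norm S * (\<rho> ^ n * norm (P \<cdot> x))"
        by (intro mult_left_mono upn) (simp_all add: pr_app_idem prP)
      also have "\<dots> \<le> norm S * (\<rho> ^ n * norm x)"
        using \<rho> by (intro mult_left_mono pr_norm_le prP) simp_all
      finally show ?thesis by (simp add: algebra_simps)
    qed
    then have "norm y \<le> 0" by (rule geometric_decay[OF \<rho>])
    then show "((1 - Q) * S * P) \<cdot> x = 0 \<cdot> x" by (simp add: y_def)
  qed
qed

text \<open>The vector \<open>z\<close> lies in every half plane \<open>t + e\<close>, so its form
  is at most \<open>t\<close> times the squared norm. Since \<open>P\<close> kills \<open>z\<close>,
  the strictness clause leaves only \<open>z = 0\<close>.\<close>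

lemma half_plane_invariant:
  fixes N :: "'h::complex_hilbert_space cop"
  assumes normal: "star N * N = N * star N" and P: "half_plane N t P" and S: "S * N = N * S"
  shows "(1 - P) * S * P = 0"
proof (rule cop_eqI)
  fix x
  have prP: "pr P" and PA: "\<And>S. S * (N + star N) = (N + star N) * S \<Longrightarrow> S * P = P * S"
    using P by (auto simp: half_plane_def)
  define z where "z = (1 - P) \<cdot> S \<cdot> P \<cdot> x"
  have Pz: "P \<cdot> z = 0" by (simp add: z_def app_diff pr_app_idem prP)
  have "Re (cinner (N \<cdot> z) z) \<le> t * (norm z)\<^sup>2"
  proof (rule field_le_epsilon)
    fix d :: real assume "d > 0"
    define e where "e = d / ((norm z)\<^sup>2 + 1)"
    have nz: "(norm z)\<^sup>2 + 1 > 0" by (simp add: add_nonneg_pos)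
    then have e: "e > 0" "e * (norm z)\<^sup>2 \<le> d" using \<open>d > 0\<close> by (simp_all add: e_def field_simps)
    obtain Q where Q: "half_plane N (t + e) Q" using half_plane_exists by blast
    have prQ: "pr Q" and QA: "\<And>S. S * (N + star N) = (N + star N) * S \<Longrightarrow> S * Q = Q * S"
      and Qf: "\<And>x. Q \<cdot> x = x \<Longrightarrow> Re (cinner (N \<cdot> x) x) \<le> (t + e) * (norm x)\<^sup>2"
      using Q by (auto simp: half_plane_def)
    have "(N + star N) * Q = Q * (N + star N)" by (rule QA) simp
    then have "Q * P = P * Q" by (intro PA) simp
    then have "(1 - Q) * (1 - P) = (1 - P) * (1 - Q)" by (simp add: algebra_simps)
    then have "((1 - Q) * (1 - P)) \<cdot> S \<cdot> P \<cdot> x = ((1 - P) * (1 - Q)) \<cdot> S \<cdot> P \<cdot> x" by (rule arg_cong)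
    then have "(1 - Q) \<cdot> z = (1 - P) \<cdot> ((1 - Q) * S * P) \<cdot> x" by (simp only: z_def app_simps(6))
    then have "(1 - Q) \<cdot> z = 0" by (simp only: half_plane_separation[OF normal P Q e(1) S] app_simps(1) app_zero)
    then have "Re (cinner (N \<cdot> z) z) \<le> (t + e) * (norm z)\<^sup>2" by (intro Qf) simp
    then show "Re (cinner (N \<cdot> z) z) \<le> t * (norm z)\<^sup>2 + d" using e(2) by (simp add: distrib_right)
  qed
  then have "z = 0" using P Pz unfolding half_plane_def by (meson antisym)
  then show "((1 - P) * S * P) \<cdot> x = 0 \<cdot> x" by (simp add: z_def)
qed

text \<open>\<open>star S\<close> commutes with \<open>star N\<close>, which has the same half
  planes as \<open>N\<close>; invariance under \<open>S\<close> and \<open>star S\<close> makes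
  \<open>P\<close> reducing.\<close>

lemma half_plane_hyperinvariant:
  fixes N :: "'h::complex_hilbert_space cop"
  assumes normal: "star N * N = N * star N" and P: "half_plane N t P" and S: "S * N = N * S"
  shows "S * P = P * S"
proof -
  have prP: "pr P" using P by (simp add: half_plane_def)
  have 1: "(1 - P) * S * P = 0" by (rule half_plane_invariant[OF normal P S])
  have "Re (cinner (star N \<cdot> x) x) = Re (cinner (N \<cdot> x) x)" for x
    by (subst cinner_commute) (simp add: star_cinner')
  then have hp: "half_plane (star N) t P" using P by (simp add: half_plane_def add.commute)
  have n': "star (star N) * star N = star N * star (star N)" by (simp add: normal)
  have "star S * star N = star N * star S" using arg_cong[OF S, of star] by simp
  then have "(1 - P) * star S * P = 0" by (rule half_plane_invariant[OF n' hp])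
  then have "star ((1 - P) * star S * P) = 0" by simp
  then have 2: "P * S * (1 - P) = 0" by (simp add: pr_star prP mult.assoc)
  show ?thesis using 1 2 by (simp add: algebra_simps)
qed

text \<open>Even indices cut the real part and odd ones the imaginary part, which is the real part
  of \<open>- \<i> N\<close>; \<open>k div 2\<close> enumerates the rational levels.\<close>

definition cut :: "'h::complex_hilbert_space cop \<Rightarrow> nat \<Rightarrow> 'h cop" where
  "cut N k = (SOME P. half_plane (if even k then N else csc (- \<i>) * N) (from_nat_into \<rat> (k div 2)) P \<and>
     (\<forall>M. vn M \<longrightarrow> (if even k then N else csc (- \<i>) * N) \<in> M \<longrightarrow> P \<in> M))"

lemma cut_half_plane:
  "half_plane (if even k then N else csc (- \<i>) * N) (from_nat_into \<rat> (k div 2)) (cut N k)"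
  and cut_in_vn: "vn M \<Longrightarrow> (if even k then N else csc (- \<i>) * N) \<in> M \<Longrightarrow> cut N k \<in> M"
  unfolding cut_def
  using someI_ex[OF half_plane_exists[of "if even k then N else csc (- \<i>) * N" "from_nat_into \<rat> (k div 2)"]]
  by blast+

lemma pr_cut: "pr (cut N k)"
  using cut_half_plane[of k N] by (simp add: half_plane_def)

lemma (in vn) cut_in: "N \<in> M \<Longrightarrow> cut N k \<in> M"
  by (rule cut_in_vn) (auto intro: ins vn_axioms)

lemma cut_hyperinvariant:
  assumes normal: "star N * N = N * star N" and S: "S * N = N * S"
  shows "S * cut N k = cut N k * S"
proof (rule half_plane_hyperinvariant[OF _ cut_half_plane])
  have c: "csc a * N * (csc b * star N) = csc (a * b) * (N * star N)"
    "csc b * star N * (csc a * N) = csc (a * b) * (star N * N)" for a b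
    by (rule cop_eqI, simp add: app_scaleC scaleC_scaleC mult.commute)+
  have pull: "S * (csc a * T) = csc a * (S * T)" for a and T :: "'a cop"
    by (rule cop_eqI) (simp add: app_scaleC)
  show "star (if even k then N else csc (- \<i>) * N) * (if even k then N else csc (- \<i>) * N) =
      (if even k then N else csc (- \<i>) * N) * star (if even k then N else csc (- \<i>) * N)"
    using normal c[where a = "- \<i>" and b = "\<i>"] by (simp add: csc_commute[of "star N"])
  show "S * (if even k then N else csc (- \<i>) * N) = (if even k then N else csc (- \<i>) * N) * S"
    using S by (simp add: pull mult.assoc)
qed

text \<open>If the quotients were in the opposite strict order, a rational \<open>t\<close> between
  them would give a half plane which neither contains \<open>S\<close> nor misses it.\<close>

lemma atom_form:
  assumes R: "\<And>t::real. t \<in> \<rat> \<Longrightarrow> \<exists>P. half_plane N t P \<and> (P * S = S \<or> P * S = 0)"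
    and x: "S \<cdot> x = x" "x \<noteq> 0" and y: "S \<cdot> y = y" "y \<noteq> 0"
  shows "Re (cinner (N \<cdot> x) x) / (norm x)\<^sup>2 \<le> Re (cinner (N \<cdot> y) y) / (norm y)\<^sup>2"
proof (rule ccontr)
  assume "\<not> ?thesis"
  then obtain t where t: "t \<in> \<rat>" "Re (cinner (N \<cdot> y) y) / (norm y)\<^sup>2 < t" "t < Re (cinner (N \<cdot> x) x) / (norm x)\<^sup>2"
    using Rats_dense_in_real[of "Re (cinner (N \<cdot> y) y) / (norm y)\<^sup>2" "Re (cinner (N \<cdot> x) x) / (norm x)\<^sup>2"] by auto
  then have t': "Re (cinner (N \<cdot> y) y) < t * (norm y)\<^sup>2" "t * (norm x)\<^sup>2 < Re (cinner (N \<cdot> x) x)"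
    using x y by (simp_all add: divide_less_eq less_divide_eq)
  obtain P where P: "half_plane N t P" "P * S = S \<or> P * S = 0" using R[OF t(1)] by blast
  have "P \<cdot> x = (P * S) \<cdot> x" "P \<cdot> y = (P * S) \<cdot> y" by (simp_all only: app_simps(6) x y)
  then have "P \<cdot> x = S \<cdot> x \<or> P \<cdot> y = 0 \<cdot> y" using P(2) by (elim disjE) (simp_all only:, simp_all)
  then have "P \<cdot> x = x \<or> P \<cdot> y = 0" by (simp only: x app_simps(1))
  then show False using P(1) t' by (auto simp: half_plane_def not_less[symmetric])
qed

text \<open>On the range of an unsplit \<open>S\<close> the numerical values of \<open>N\<close> are
  constant, in their real and imaginary parts, so the form of the compressed \<open>N - c\<close>
  vanishes.\<close>

lemma atom_eigenvalue:
  fixes N :: "'h::complex_hilbert_space cop"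
  assumes S: "pr S" "N * S = S * N" and at: "\<And>k. cut N k * S = S \<or> cut N k * S = 0"
  shows "\<exists>c. N * S = csc c * S"
proof (cases "S = 0")
  case False
  then obtain x0 where x0: "S \<cdot> x0 = x0" "x0 \<noteq> 0"
    using pr_app_idem[OF S(1)] by (metis app_simps(1) cop_eqI)
  have cuts: "\<exists>P. half_plane N t P \<and> (P * S = S \<or> P * S = 0)"
    "\<exists>P. half_plane (csc (- \<i>) * N) t P \<and> (P * S = S \<or> P * S = 0)" if t: "t \<in> \<rat>" for t :: real
  proof -
    obtain m where m: "from_nat_into \<rat> m = t"
      using from_nat_into_surj[OF countable_rat t] by blast
    show "\<exists>P. half_plane N t P \<and> (P * S = S \<or> P * S = 0)"
      using cut_half_plane[of "2 * m" N] at[of "2 * m"] m by auto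
    show "\<exists>P. half_plane (csc (- \<i>) * N) t P \<and> (P * S = S \<or> P * S = 0)"
      using cut_half_plane[of "2 * m + 1" N] at[of "2 * m + 1"] m by auto
  qed
  define a b where "a = Re (cinner (N \<cdot> x0) x0) / (norm x0)\<^sup>2" and "b = Im (cinner (N \<cdot> x0) x0) / (norm x0)\<^sup>2"
  have form: "cinner (N \<cdot> x) x = Complex a b * of_real ((norm x)\<^sup>2)" if x: "S \<cdot> x = x" "x \<noteq> 0" for x
  proof -
    have "Re (cinner (N \<cdot> x) x) / (norm x)\<^sup>2 = a"
      unfolding a_def by (intro antisym atom_form[where S = S] cuts(1) x x0)
    moreover have "Re (cinner ((csc (- \<i>) * N) \<cdot> x) x) / (norm x)\<^sup>2 = Re (cinner ((csc (- \<i>) * N) \<cdot> x0) x0) / (norm x0)\<^sup>2"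
      by (intro antisym atom_form[where S = S] cuts(2) x x0)
    then have "Im (cinner (N \<cdot> x) x) / (norm x)\<^sup>2 = b" by (simp add: b_def cinner_simps)
    ultimately show ?thesis using x by (simp add: complex_eq_iff field_simps del: of_real_power)
  qed
  have "S * (N - csc (Complex a b)) * S = 0"
  proof (rule quadratic_form_zero)
    fix x
    have "cinner ((S * (N - csc (Complex a b)) * S) \<cdot> x) x = cinner (N \<cdot> S \<cdot> x - Complex a b *\<^sub>C (S \<cdot> x)) (S \<cdot> x)"
      by (simp add: star_cinner[of S] pr_star S)
    also have "\<dots> = 0"
      using form[of "S \<cdot> x"] by (cases "S \<cdot> x = 0") (simp_all add: pr_app_idem S cinner_simps cinner_self)
    finally show "cinner ((S * (N - csc (Complex a b)) * S) \<cdot> x) x = 0" .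
  qed
  then have "S * N * S - csc (Complex a b) * S = 0"
    by (simp add: algebra_simps csc_commute pr_idem S)
  moreover have "S * N * S = N * S" using S by (metis mult.assoc pr_idem)
  ultimately show ?thesis by auto
qed (auto intro: exI[of _ 0])

section \<open>Operators similar to irreducible ones\<close>

text \<open>
  \<open>{T, T\<^sup>*}' \<inter> M = \<complex>I\<close>, stated for self-adjoint elements of the commutant only: these commute
  with \<open>T\<^sup>*\<close> as soon as they commute with \<open>T\<close>.
\<close>

definition irred :: "'h::complex_hilbert_space cop set \<Rightarrow> 'h cop \<Rightarrow> bool" where
  "irred M T \<longleftrightarrow> T \<in> M \<and> (\<forall>R\<in>M. star R = R \<longrightarrow> R * T = T * R \<longrightarrow> (\<exists>c. R = csc c))"

lemma neumann_inverse:
  fixes Z :: "'h::complex_hilbert_space cop"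
  assumes Z: "norm Z \<le> 1 / 2"
  shows "\<exists>G. G * (1 - Z) = 1 \<and> (1 - Z) * G = 1 \<and> (\<forall>M. vn M \<longrightarrow> Z \<in> M \<longrightarrow> G \<in> M)"
proof -
  have nZ: "norm (Z ^ n) \<le> (1 / 2) ^ n" for n
  proof (induction n)
    case 0
    have "norm (1 :: 'h cop) \<le> 1" by (rule norm_cop_le) simp_all
    then show ?case by simp
  next
    case (Suc n)
    have "norm (Z ^ Suc n) \<le> norm Z * norm (Z ^ n)" by (simp add: norm_mult_ineq)
    also have "\<dots> \<le> 1 / 2 * (1 / 2) ^ n" using Z Suc by (intro mult_mono) auto
    finally show ?case by simp
  qed
  have "summable (\<lambda>n. (1 / 2 :: real) ^ n)" by (rule summable_geometric) simp
  from summable_comparison_test'[OF this, of 0 "\<lambda>n. Z ^ n"] nZ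
  have summ: "summable (\<lambda>n. Z ^ n)" by simp
  define G where "G = (\<Sum>n. Z ^ n)"
  have tail: "(\<Sum>n. Z ^ Suc n) = G - 1" using suminf_split_head[OF summ] by (simp add: G_def)
  have "Z * G = G - 1" unfolding G_def suminf_mult[OF summ, symmetric] using tail by (simp add: G_def)
  moreover have "G * Z = G - 1"
    unfolding G_def suminf_mult2[OF summ] using tail by (simp add: G_def power_commutes)
  moreover have "G \<in> M" if "vn M" "Z \<in> M" for M
  proof -
    interpret vn M by fact
    show ?thesis unfolding G_def by (rule suminf_in[OF _ summ]) (intro ins that)
  qed
  ultimately show ?thesis by (intro exI[of _ G]) (simp add: algebra_simps)
qed

lemma normal_kernel:
  fixes Z :: "'h::complex_hilbert_space cop"
  assumes "star Z * Z = Z * star Z" shows "kp (star Z) = kp Z"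
proof (rule kp_eqI[OF pr_kp])
  fix x
  have "(norm (Z \<cdot> x))\<^sup>2 = (norm (star Z \<cdot> x))\<^sup>2"
    unfolding norm_app_sq star_star by (simp only: assms flip: app_simps(6))
  then have "norm (Z \<cdot> x) = norm (star Z \<cdot> x)" by simp
  then show "kp Z \<cdot> x = x \<longleftrightarrow> star Z \<cdot> x = 0" by (metis kp_iff norm_eq_zero)
qed

lemma normal_shift:
  fixes N :: "'h::complex_hilbert_space cop"
  assumes "star N * N = N * star N"
  shows "star (csc c - N) * (csc c - N) = (csc c - N) * star (csc c - N)"
  using assms by (simp add: left_diff_distrib right_diff_distrib csc_mult mult.commute[of c]
      csc_commute[of N] csc_commute[of "star N"])

context sepfac
begin

text \<open>The cuts of \<open>S\<close> commute with everything that commutes with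
  \<open>S\<close>, hence are trivial; then no cut splits 1, and \<open>S\<close> is an eigenvalue
  times 1.\<close>

lemma self_adjoint_scalar:
  assumes triv: "\<And>q. q \<in> M \<Longrightarrow> pr q \<Longrightarrow> (\<And>T. T \<in> TT \<Longrightarrow> T * q = q * T) \<Longrightarrow> q = 0 \<or> q = 1"
    and S: "S \<in> M" "star S = S" and comm: "\<And>T. T \<in> TT \<Longrightarrow> T * S = S * T"
  shows "\<exists>c. S = csc c"
proof -
  have "cut S k * 1 = 1 \<or> cut S k * 1 = 0" for k
    using triv[OF cut_in[OF S(1)] pr_cut cut_hyperinvariant[OF _ comm]] S(2) by auto
  then have "\<exists>c. S * 1 = csc c * 1" by (intro atom_eigenvalue) simp_all
  then show ?thesis by simp
qed

text \<open>An atom lies below an eigenprojection of \<open>N\<close>, whose smallness is the kernel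
  condition. If 1 were the sum of two atoms, the two eigenvalues would give a quadratic equation for
  \<open>N\<close>.\<close>

lemma small_triple_exists:
  assumes N: "N \<in> M" and normal: "star N * N = N * star N" and nt: "(1 :: 'h cop) \<noteq> 0"
    and ker: "\<And>c. ple M (1 - rp (csc c - N)) (rp (csc c - N))"
    and quad: "\<And>a b. (N - csc a) * (N - csc b) \<noteq> 0"
  shows "\<exists>E1 E2 E3. (\<forall>E\<in>{E1, E2, E3}. E \<in> M \<and> pr E \<and> E \<noteq> 0 \<and> ple M E (1 - E) \<and>
      (\<forall>S\<in>M. S * N = N * S \<longrightarrow> E * S = S * E)) \<and>
    E1 * E2 = 0 \<and> E1 * E3 = 0 \<and> E2 * E3 = 0 \<and> E1 + E2 + E3 = 1"
proof -
  define BB where "BB = {E\<in>M. pr E \<and> (\<forall>S\<in>M. S * N = N * S \<longrightarrow> E * S = S * E)}"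
  have EN: "E * N = N * E" if "E \<in> BB" for E using that N by (auto simp: BB_def)
  have comm: "E * F = F * E" if "E \<in> BB" "F \<in> BB" for E F using that EN[of F] by (auto simp: BB_def)
  have atom: "\<exists>c. N * S = csc c * S" if "S \<in> BB" "\<And>k. cut N k * S = S \<or> cut N k * S = 0" for S
    using atom_eigenvalue[of S N] that EN[of S] by (auto simp: BB_def)
  interpret B: bool_alg M \<Phi> \<xi> BB "cut N"
  proof unfold_locales
    show "E \<in> BB \<Longrightarrow> E \<in> M" "E \<in> BB \<Longrightarrow> pr E" for E by (auto simp: BB_def)
    show "1 \<in> BB" by (simp add: BB_def one_in)
    show "E \<in> BB \<Longrightarrow> 1 - E \<in> BB" for E
      by (auto simp: BB_def pr_compl algebra_simps intro!: ins)
    show "E * F \<in> BB" if "E \<in> BB" "F \<in> BB" for E F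
    proof -
      have "E * F * S = S * (E * F)" if "S \<in> M" "S * N = N * S" for S
      proof -
        have "E * S = S * E" "F * S = S * F" using that \<open>E \<in> BB\<close> \<open>F \<in> BB\<close> by (auto simp: BB_def)
        then show ?thesis by (metis mult.assoc)
      qed
      then show ?thesis using that comm[OF that] by (auto simp: BB_def pr_mult intro: ins)
    qed
    show "E * F = F * E" if "E \<in> BB" "F \<in> BB" for E F by (rule comm[OF that])
    show "L \<in> BB" if X: "\<And>n. X n \<in> BB" and L: "slim X L" for X L
    proof -
      have "L * S = S * L" if "S \<in> M" "S * N = N * S" for S
        using slim_commute[OF L, of S] X that by (simp add: BB_def)
      then show ?thesis using X slim_in[OF _ L] pr_slim[OF L] by (simp add: BB_def)
    qed
    show "cut N k \<in> BB" for k
      using cut_in[OF N] pr_cut cut_hyperinvariant[OF normal] by (simp add: BB_def)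
    show "ple M S (1 - S)" if S: "S \<in> BB" "\<And>k. cut N k * S = S \<or> cut N k * S = 0" for S
    proof -
      obtain c where c: "N * S = csc c * S" using atom[OF S] by blast
      have S': "S \<in> M" "pr S" using S(1) by (auto simp: BB_def)
      define Z where "Z = csc c - N"
      have Zn: "star Z * Z = Z * star Z"
        unfolding Z_def by (rule normal_shift[OF normal])
      define k where "k = kp Z"
      have k: "pr k" by (simp add: k_def pr_kp)
      have "Z * S = 0" using c by (simp add: Z_def algebra_simps)
      then have kS: "k * S = S" unfolding k_def by (rule kp_absorb)
      have rpk: "rp Z = 1 - k" by (simp add: rp_def k_def normal_kernel[OF Zn])
      have "ple M S k" by (rule ple_le[OF S' kS])
      moreover have "ple M k (1 - k)" using ker[of c] by (simp add: rpk flip: Z_def)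
      ultimately have "ple M S (1 - k)" by (rule ple_trans)
      moreover have "S * k = S" using kS k S' pr_le_sym by blast
      then have "(1 - S) * (1 - k) = 1 - k" by (simp add: algebra_simps)
      ultimately show ?thesis by (rule ple_mono)
    qed
    show "\<exists>k. (cut N k * E \<noteq> E \<and> cut N k * E \<noteq> 0) \<or> (cut N k * F \<noteq> F \<and> cut N k * F \<noteq> 0)"
      if EF: "E \<in> BB" "F \<in> BB" "E + F = 1" for E F
    proof (rule ccontr)
      assume "\<not> ?thesis"
      then obtain a b where ab: "N * E = csc a * E" "N * F = csc b * F"
        using atom[OF EF(1)] atom[OF EF(2)] by blast
      have "(N - csc a) * E = 0" "(N - csc b) * F = 0" by (simp_all add: left_diff_distrib ab)
      then have "(N - csc b) * (N - csc a) * E = 0" "(N - csc a) * (N - csc b) * F = 0"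
        by (simp_all only: mult.assoc mult_zero_right)
      moreover have "(N - csc b) * (N - csc a) = (N - csc a) * (N - csc b)"
        by (simp add: algebra_simps csc_commute[of N] csc_mult mult.commute)
      ultimately have "(N - csc a) * (N - csc b) * (E + F) = 0" by (simp add: distrib_left)
      then show False using quad EF(3) by simp
    qed
    show "(1 :: 'h cop) \<noteq> 0" by (rule nt)
  qed
  obtain A B C where t: "B.triple A B C" and nz: "A \<noteq> 0" "B \<noteq> 0" "C \<noteq> 0"
    using B.nonzero_triple_exists by blast
  have t': "A \<in> BB" "B \<in> BB" "C \<in> BB" "A * B = 0" "A * C = 0" "B * C = 0" "A + B + C = 1"
    "ple M A (1 - A)" "ple M B (1 - B)" "ple M C (1 - C)"
    using t by (auto simp: B.triple_def B.small_def)
  then have "\<forall>E\<in>{A, B, C}. E \<in> BB \<and> E \<noteq> 0 \<and> ple M E (1 - E)" using nz by simp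
  then show ?thesis using t' by (intro exI[of _ A] exI[of _ B] exI[of _ C]) (simp add: BB_def)
qed

text \<open>
  With \<open>X\<^sup>2 = H = 1 + \<epsilon> K\<close> a self-adjoint \<open>R\<close> commutes with \<open>X N X\<^sup>-\<^sup>1\<close> iff \<open>S = X\<^sup>-\<^sup>1 R X\<close> commutes with \<open>N\<close> and
  \<open>H S = S\<^sup>* H\<close>; as \<open>K\<close> is off-diagonal for spectral projections of \<open>N\<close>, comparing the diagonal
  blocks shows that \<open>S\<close> is self-adjoint, and hence that it commutes with \<open>K\<close>.
\<close>

lemma similar_to_irreducible:
  assumes N: "N \<in> M" and normal: "star N * N = N * star N" and nt: "(1 :: 'h cop) \<noteq> 0"
    and ker: "\<And>c. ple M (1 - rp (csc c - N)) (rp (csc c - N))"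
    and quad: "\<And>a b. (N - csc a) * (N - csc b) \<noteq> 0"
  shows "\<exists>X\<in>M. \<exists>Y\<in>M. X * Y = 1 \<and> Y * X = 1 \<and> irred M (X * N * Y)"
proof -
  obtain E1 E2 E3 where **: "(\<forall>E\<in>{E1, E2, E3}. E \<in> M \<and> pr E \<and> E \<noteq> 0 \<and> ple M E (1 - E) \<and>
      (\<forall>S\<in>M. S * N = N * S \<longrightarrow> E * S = S * E)) \<and>
    E1 * E2 = 0 \<and> E1 * E3 = 0 \<and> E2 * E3 = 0 \<and> E1 + E2 + E3 = 1"
    using small_triple_exists[OF N normal nt ker quad] by (elim exE) (rule that)
  then have E: "\<And>E. E \<in> {E1, E2, E3} \<Longrightarrow> E \<in> M \<and> pr E \<and> E \<noteq> 0 \<and> ple M E (1 - E) \<and>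
      (\<forall>S\<in>M. S * N = N * S \<longrightarrow> E * S = S * E)"
    and orth: "E1 * E2 = 0" "E1 * E3 = 0" "E2 * E3 = 0" and sum: "E1 + E2 + E3 = 1"
    by blast+
  have EE: "E1 \<in> M" "pr E1" "E2 \<in> M" "pr E2" "E3 \<in> M" "pr E3" "E1 \<noteq> 0" "E2 \<noteq> 0" "E3 \<noteq> 0"
    "ple M E1 (1 - E1)" "ple M E2 (1 - E2)" "ple M E3 (1 - E3)" using E by simp_all
  obtain K where KM: "K \<in> M" and *: "star K = K \<and> E1 * K * E1 = 0 \<and> E2 * K * E2 = 0 \<and> E3 * K * E3 = 0 \<and>
    (\<forall>q\<in>M. pr q \<longrightarrow> q * E1 = E1 * q \<longrightarrow> q * E2 = E2 * q \<longrightarrow> q * E3 = E3 * q \<longrightarrow> q * K = K * q \<longrightarrow>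
      q = 0 \<or> q = 1)"
    by (rule bexE[OF irreducible_offdiagonal[OF EE(1-6) orth sum EE(7-12)]])
  then have K: "star K = K" "\<And>E. E \<in> {E1, E2, E3} \<Longrightarrow> E * K * E = 0"
    and Kirr: "\<And>q. q \<in> M \<Longrightarrow> pr q \<Longrightarrow> (\<And>T. T \<in> {E1, E2, E3, K} \<Longrightarrow> T * q = q * T) \<Longrightarrow> q = 0 \<or> q = 1"
    by auto
  \<comment> \<open>Small enough for \<open>H\<close> to have both a self-adjoint root and a Neumann
    inverse.\<close>
  define \<epsilon> where "\<epsilon> = 1 / (2 * (1 + norm K))"
  have pos: "1 + norm K > 0" by (simp add: add_pos_nonneg)
  then have \<epsilon>: "\<epsilon> > 0" "\<epsilon> * norm K \<le> 1 / 2" by (simp_all add: \<epsilon>_def field_simps)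
  define H where "H = 1 + \<epsilon> *\<^sub>R K"
  have HM: "H \<in> M" and Hs: "star H = H" by (auto simp: H_def K intro!: ins KM)
  have nH: "norm (- (\<epsilon> *\<^sub>R K)) \<le> 1 / 2" using \<epsilon> by simp
  have "norm (1 - H) \<le> 1" using nH by (simp add: H_def)
  then obtain X where X: "star X = X" "X * X = H" "\<And>S. S * H = H * S \<Longrightarrow> S * X = X * S" "X \<in> M"
    using sqrt_exists[OF Hs] vn_axioms HM by metis
  obtain G where G: "G * H = 1" "H * G = 1" "G \<in> M"
    using neumann_inverse[OF nH] vn_axioms by (auto simp: H_def intro!: ins KM)
  have XG: "X * G = G * X"
  proof -
    have "X * H = H * X" by (simp add: X(2)[symmetric] mult.assoc)
    then have "G * (X * H) * G = G * (H * X) * G" by simp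
    then show ?thesis using G by (metis mult.assoc mult_1_left mult_1_right)
  qed
  define Y where "Y = G * X"
  have YX: "Y * X = 1"
  proof -
    have "Y * X = G * (X * X)" by (simp only: Y_def mult.assoc)
    then show ?thesis by (simp only: X(2) G(1))
  qed
  have XY: "X * Y = 1"
  proof -
    have "X * Y = X * X * G" by (simp only: Y_def XG[symmetric] mult.assoc)
    then show ?thesis by (simp only: X(2) G(2))
  qed
  have YM: "Y \<in> M" unfolding Y_def by (intro ins G X)
  have scal: "\<exists>c. R = csc c" if R: "R \<in> M" "star R = R" "R * (X * N * Y) = X * N * Y * R" for R
  proof -
    define S where "S = Y * R * X"
    have SM: "S \<in> M" unfolding S_def by (intro ins YM R X)
    have SN: "S * N = N * S"
    proof -
      have "Y * (R * (X * N * Y)) * X = Y * (X * N * Y * R) * X" by (simp only: R)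
      then have "Y * R * X * N * (Y * X) = (Y * X) * N * Y * R * X" by (simp only: mult.assoc)
      then show ?thesis by (simp add: YX S_def mult.assoc)
    qed
    have HS: "H * S = star S * H"
    proof -
      have "H * S = X * (X * Y) * R * X" by (simp add: S_def mult.assoc flip: X(2))
      moreover have "star S * H = X * R * (star Y * X) * X"
        by (simp only: S_def star_simps R(2) X(1) X(2)[symmetric] mult.assoc)
      moreover have "star Y * X = 1" using arg_cong[OF XY, of star] by (simp add: X(1))
      ultimately show ?thesis by (simp add: XY)
    qed
    have blk: "E * S = star S * E" if "E \<in> {E1, E2, E3}" for E
    proof -
      have pE: "pr E" and ES: "E * S = S * E" using E[OF that] SM SN by auto
      have ES': "E * star S = star S * E" using arg_cong[OF ES, of star] pE by (simp add: pr_star)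
      have EHE: "E * H * E = E" using K(2)[OF that] pE by (simp add: H_def algebra_simps pr_idem)
      have "E * (H * S) * E = (E * H * E) * S" by (simp add: ES mult.assoc)
      moreover have "E * (star S * H) * E = star S * (E * H * E)" by (simp add: mult.assoc[symmetric] ES')
      ultimately show ?thesis unfolding EHE HS by simp
    qed
    have "(E1 + E2 + E3) * S = star S * (E1 + E2 + E3)" using blk by (simp add: distrib_left distrib_right)
    then have Ss: "star S = S" by (simp add: sum)
    have "K * S = S * K"
    proof -
      have "\<epsilon> *\<^sub>R (K * S) = \<epsilon> *\<^sub>R (S * K)" using HS unfolding Ss by (simp add: H_def algebra_simps)
      then show ?thesis using \<epsilon> by simp
    qed
    moreover have "E * S = S * E" if "E \<in> {E1, E2, E3}" for E using E[OF that] SM SN by auto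
    ultimately have comm: "T * S = S * T" if "T \<in> {E1, E2, E3, K}" for T using that by auto
    have "\<exists>c. S = csc c"
      by (rule self_adjoint_scalar[where TT = "{E1, E2, E3, K}", OF Kirr SM Ss comm])
    then obtain c where c: "S = csc c" by blast
    have "R = (X * Y) * R * (X * Y)" by (simp add: XY)
    also have "\<dots> = X * S * Y" by (simp add: S_def mult.assoc)
    also have "\<dots> = csc c * (X * Y)" by (simp add: c csc_commute mult.assoc)
    finally show ?thesis by (auto simp: XY)
  qed
  have "irred M (X * N * Y)" unfolding irred_def using scal by (auto intro!: ins X N YM)
  then show ?thesis using X(4) YM XY YX by blast
qed

section \<open>Necessity of the conditions\<close>

text \<open>The real and imaginary parts of \<open>R\<close> commute with \<open>T\<close>, so
  \<open>irred\<close> makes both of them scalar.\<close>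

lemma irred_commutant:
  assumes irr: "irred M T" and R: "R \<in> M" and RT: "R * T = T * R" "R * star T = star T * R"
  shows "\<exists>c. R = csc c"
proof -
  have sRT: "star R * T = T * star R" using arg_cong[OF RT(2), of star] by simp
  have 1: "star (csc \<i> * (R - star R)) = csc \<i> * (R - star R)"
    by (simp add: csc_commute algebra_simps flip: csc_minus)
  have "(R + star R) * T = T * (R + star R)" using RT sRT by (simp add: distrib_left distrib_right)
  then have "\<exists>c. R + star R = csc c"
  proof -
    have "R + star R \<in> M" "star (R + star R) = R + star R" by (auto intro!: ins R simp: add.commute)
    then show ?thesis using irr \<open>(R + star R) * T = T * (R + star R)\<close> unfolding irred_def by blast
  qed
  moreover have "csc \<i> * (R - star R) * T = T * (csc \<i> * (R - star R))"
  proof -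
    have "csc \<i> * (R - star R) * T = csc \<i> * (T * (R - star R))"
      using RT sRT by (simp add: left_diff_distrib right_diff_distrib mult.assoc)
    also have "\<dots> = T * csc \<i> * (R - star R)" by (simp only: csc_commute mult.assoc)
    finally show ?thesis by (simp only: mult.assoc)
  qed
  then have "\<exists>c. csc \<i> * (R - star R) = csc c"
    using irr 1 unfolding irred_def by (blast intro: ins R)
  ultimately obtain a b where ab: "R + star R = csc a" "csc \<i> * (R - star R) = csc b" by blast
  have "csc (- \<i>) * (csc \<i> * (R - star R)) = csc (- \<i> * b)" unfolding ab csc_mult ..
  then have "R - star R = csc (- \<i> * b)" by (simp add: csc_mult flip: mult.assoc)
  moreover have "R + R = (R + star R) + (R - star R)" by simp
  ultimately have "R + R = csc a + csc (- \<i> * b)" by (simp only: ab(1))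
  then have "csc (1 / 2) * (R + R) = csc ((1 / 2) * (a - \<i> * b))" by (simp add: csc_mult csc_add)
  moreover have "csc (1 / 2) * (R + R) = R"
  proof -
    have h: "csc (1 / 2) + csc (1 / 2) = (1 :: 'h cop)" using csc_add[of "1 / 2" "1 / 2"] by simp
    have "csc (1 / 2) * (R + R) = (csc (1 / 2) + csc (1 / 2)) * R"
      by (simp only: distrib_left distrib_right)
    then show ?thesis by (simp only: h mult_1_left)
  qed
  ultimately show ?thesis by metis
qed

lemma irreducible_kernel_condition:
  assumes XY: "X \<in> M" "Y \<in> M" "X * Y = 1" "Y * X = 1" and N: "N \<in> M" and normal: "star N * N = N * star N"
    and irr: "irred M (X * N * Y)" and big: "T0 \<in> M" "\<And>c. T0 \<noteq> csc c"
  shows "ple M (1 - rp (csc c - N)) (rp (csc c - N))"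
proof -
  define B where "B = csc c - N"
  define T where "T = X * N * Y"
  define A where "A = csc c - T"
  have BM: "B \<in> M" unfolding B_def by (intro ins N)
  have TM: "T \<in> M" unfolding T_def by (intro ins N XY)
  have AM: "A \<in> M" unfolding A_def by (intro ins TM)
  have AX: "A * X = X * B"
  proof -
    have "T * X = X * N * (Y * X)" by (simp add: T_def mult.assoc)
    then show ?thesis by (simp add: A_def B_def algebra_simps XY csc_commute)
  qed
  have YA: "Y * A = B * Y"
  proof -
    have "Y * T = (Y * X) * N * Y" by (simp add: T_def mult.assoc)
    then show ?thesis by (simp add: A_def B_def algebra_simps XY csc_commute)
  qed
  have Bn: "star B * B = B * star B"
    unfolding B_def by (rule normal_shift[OF normal])
  \<comment> \<open>A positive operator whose kernel is the common kernel of \<open>A\<close> and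
    \<open>star A\<close>.\<close>
  define W where "W = A * star A + star A * A"
  define k where "k = kp W"
  have Wx: "A \<cdot> x = 0 \<and> star A \<cdot> x = 0" if "W \<cdot> x = 0" for x
  proof -
    have "Re (cinner (W \<cdot> x) x) = (norm (star A \<cdot> x))\<^sup>2 + (norm (A \<cdot> x))\<^sup>2"
      by (simp add: W_def cinner_simps norm_app_sq)
    then show ?thesis using that by (simp add: sum_power2_eq_zero_iff)
  qed
  have k: "k \<in> M" "pr k" unfolding k_def W_def by (intro kp_in ins AM, rule pr_kp)
  have ker: "W \<cdot> k \<cdot> x = 0" for x using kp_right[of W] unfolding k_def by (metis app_simps(1,6))
  have Ak: "A * k = 0" "star A * k = 0" by (rule cop_eqI; use Wx[OF ker] in simp)+
  have kA: "k * A = 0" using arg_cong[OF Ak(2), of star] k by (simp add: pr_star)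
  have "k * T = T * k" using Ak(1) kA by (simp add: A_def algebra_simps csc_commute[of k])
  then have "\<exists>c. k = csc c" using irr k by (simp add: irred_def pr_star flip: T_def)
  then have k01: "k = 0 \<or> k = 1" using scalar_projection[OF k(2)] by blast
  have "k = 0"
  proof (rule ccontr)
    assume "k \<noteq> 0"
    then have "A = 0" using k01 Ak by simp
    then have Tc: "T = csc c" by (simp add: A_def)
    have "\<exists>c. T0 = csc c"
      by (rule irred_commutant[OF irr big(1)]) (simp_all add: Tc csc_commute flip: T_def)
    then show False using big(2) by blast
  qed
  then have inj: "x = 0" if "A \<cdot> x = 0" "star A \<cdot> x = 0" for x
  proof -
    have "W \<cdot> x = 0" using that by (simp add: W_def)
    then have "k \<cdot> x = x" by (simp add: k_def kp_iff)
    then show ?thesis by (simp add: \<open>k = 0\<close>)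
  qed
  have r1: "1 - rp B = kp B" by (simp add: rp_def normal_kernel[OF Bn])
  \<comment> \<open>\<open>X\<close> takes the kernel of \<open>B\<close> into that of
    \<open>A\<close>, on which \<open>rp A\<close> is injective because \<open>A\<close> and
    \<open>star A\<close> have no common kernel; \<open>Y\<close> takes the range of
    \<open>A\<close> into that of \<open>B\<close>.\<close>
  have "ple M (kp B) (rp B)"
  proof (rule ple_injI)
    show "Y * rp A * X \<in> M" by (intro ins rp_in XY AM)
    show "kp B \<in> M" by (rule kp_in[OF BM])
    show "pr (kp B)" by (rule pr_kp)
    have "(1 - rp B) * Y * A = 0" by (simp add: mult.assoc YA) (simp add: algebra_simps rp_left mult_ctx[OF rp_left])
    then have "(1 - rp B) * Y * rp A = 0" by (rule rp_absorb)
    then have "rp B * (Y * rp A) = Y * rp A" by (simp add: algebra_simps)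
    then show "rp B * (Y * rp A * X) = Y * rp A * X" by (simp only: mult.assoc[symmetric])
    fix x assume x: "kp B \<cdot> x = x" "(Y * rp A * X) \<cdot> x = 0"
    have "B \<cdot> x = 0" using x(1) by (simp add: kp_iff)
    then have 1: "A \<cdot> X \<cdot> x = 0" using AX by (metis app_simps(6) app_zero)
    have "X \<cdot> (Y * rp A * X) \<cdot> x = rp A \<cdot> X \<cdot> x" using XY(3) by (metis app_simps(2,6))
    then have "rp A \<cdot> X \<cdot> x = 0" using x(2) by simp
    then have "X \<cdot> x - kp (star A) \<cdot> X \<cdot> x = 0" by (simp only: rp_def app_simps)
    then have "kp (star A) \<cdot> X \<cdot> x = X \<cdot> x" by (metis eq_iff_diff_eq_0)
    then have "star A \<cdot> X \<cdot> x = 0" by (simp only: kp_iff)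
    then have "X \<cdot> x = 0" using inj 1 by blast
    then show "x = 0" using XY(4) by (metis app_simps(2,6) app_zero)
  qed
  then show ?thesis by (simp add: r1 flip: B_def)
qed

text \<open>
  For an idempotent \<open>e\<close> the self-adjoint element \<open>(e - e\<^sup>*)\<^sup>2\<close> commutes with \<open>e\<close>. If it is a scalar, then
  \<open>e\<close> generates \<open>2 \<times> 2\<close> matrix units \<open>P, b, b\<^sup>*, 1 - P\<close> (up to scaling), and the entries of elements
  of \<open>M\<close> with respect to them lie in the relative commutant.
\<close>

lemma irreducible_idempotent:
  assumes e: "e \<in> M" "e * e = e" and irr: "irred M e" and big: "T0 \<in> M" "\<And>c. T0 \<noteq> csc c"
  shows "\<exists>P b. \<forall>m\<in>M. \<exists>s1 s2 s3 s4. m = csc s1 * P + csc s2 * b + csc s3 * star b + csc s4 * (1 - P)"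
proof -
  have ee: "e * (e * x) = e * x" for x using e by (simp flip: mult.assoc)
  have see: "star e * star e = star e" using arg_cong[OF e(2), of star] by simp
  have see': "star e * (star e * x) = star e * x" for x using see by (simp flip: mult.assoc)
  have nonscalar: "e \<noteq> csc c" for c
  proof
    assume c: "e = csc c"
    have "\<exists>c. T0 = csc c" by (rule irred_commutant[OF irr big(1)]) (simp_all add: c csc_commute)
    then show False using big(2) by blast
  qed
  have nonsa: "star e \<noteq> e"
  proof
    assume "star e = e"
    then have "\<exists>c. e = csc c" by (intro irred_commutant[OF irr e(1)]) simp_all
    then show False using nonscalar by blast
  qed
  define d where "d = e + star e - e * star e - star e * e"
  have dM: "d \<in> M" unfolding d_def by (intro ins e)
  have ds: "star d = d" by (simp add: d_def algebra_simps)
  have ed: "e * d = e - e * star e * e" "d * e = e - e * star e * e"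
    by (simp_all add: d_def algebra_simps e ee)
  have de: "d * e = e * d" by (simp only: ed)
  have "d * star e = star e * d" using arg_cong[OF de, of star] ds by simp
  then obtain c where c: "d = csc c" using irred_commutant[OF irr dM de] by blast
  have "star d * 1 = d * 1" by (simp add: ds)
  have skew: "star (e - star e) * (e - star e) = - d"
    by (simp add: d_def algebra_simps e see)
  have nt: "\<exists>x::'h. x \<noteq> 0"
  proof (rule ccontr)
    assume "\<not> ?thesis"
    then have "T0 = csc 0" by (intro cop_eqI) simp
    then show False using big(2) by blast
  qed
  obtain r where r: "d = r *\<^sub>R 1"
  proof -
    have *: "csc (cnj c) = (csc c :: 'h cop)" using ds by (simp add: c)
    obtain x :: 'h where x: "x \<noteq> 0" using nt by blast
    have "cnj c *\<^sub>C x = c *\<^sub>C x" using * by (metis csc_app)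
    then have "(cnj c - c) *\<^sub>C x = 0" by (simp add: diff_conv_add_uminus scaleC_add_left scaleC_minus_left del: add_uminus_conv_diff)
    then have "cnj c = c" using x by (metis eq_iff_diff_eq_0 mult_eq_0_iff norm_eq_zero norm_scaleC)
    then have "c = of_real (Re c)" by (simp add: complex_eq_iff)
    then have "d = Re c *\<^sub>R 1" by (metis c csc_of_real)
    then show thesis by (rule that)
  qed
  have r0: "r \<noteq> 0"
  proof
    assume "r = 0"
    then have "star (e - star e) * (e - star e) = 0" using skew by (simp add: r)
    then have "e - star e = 0" by (simp only: cop_eq_0_iff_star_mult)
    then show False using nonsa by simp
  qed
  \<comment> \<open>Comparing \<open>e * d = r *\<^sub>R e\<close> with the definition of
    \<open>d\<close> gives \<open>e * star e * e = \<kappa> *\<^sub>R e\<close>, so dividing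
    \<open>e * star e\<close> by \<open>\<kappa>\<close> yields a projection.\<close>
  define \<kappa> where "\<kappa> = 1 - r"
  have ese: "e * star e * e = \<kappa> *\<^sub>R e"
  proof -
    have "e * d = r *\<^sub>R e" by (simp add: r)
    then show ?thesis unfolding ed by (simp add: \<kappa>_def algebra_simps)
  qed
  have k0: "\<kappa> \<noteq> 0"
  proof
    assume "\<kappa> = 0"
    then have "star (e * star e) * (e * star e) = 0" using ese by (simp flip: mult.assoc)
    then have "e * star e = 0" by (simp only: cop_eq_0_iff_star_mult)
    then have "star (star e) * star e = 0" by simp
    then have "star e = 0" by (simp only: cop_eq_0_iff_star_mult)
    then have "e = 0" by (metis star_simps(1) star_star)
    then show False using nonscalar[of 0] by simp
  qed
  define P where "P = (1 / \<kappa>) *\<^sub>R (e * star e)"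
  define b where "b = e - P"
  have Ps: "star P = P" by (simp add: P_def)
  have eP: "e * P = P" by (simp add: P_def ee)
  have Pe: "P * e = e" using k0 by (simp add: P_def ese)
  have PP: "P * P = P"
  proof -
    have "P * ((1 / \<kappa>) *\<^sub>R (e * star e)) = (1 / \<kappa>) *\<^sub>R (P * e * star e)" by (simp add: mult.assoc)
    then show ?thesis unfolding Pe P_def[symmetric] .
  qed
  have Pse: "P * star e = P" "star e * P = star e"
    using arg_cong[OF eP, of star] arg_cong[OF Pe, of star] by (simp_all add: Ps)
  have eP_eq: "e * star e = \<kappa> *\<^sub>R P" using k0 by (simp add: P_def)
  have Pb: "P * b = b" and bP: "b * P = 0" by (simp_all add: b_def algebra_simps Pe PP eP)
  have sbP: "star b * P = star b" and Psb: "P * star b = 0"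
    using arg_cong[OF Pb, of star] arg_cong[OF bP, of star] by (simp_all add: Ps)
  have bb: "b * star b = (\<kappa> - 1) *\<^sub>R P"
    by (simp add: b_def Ps algebra_simps eP_eq eP Pse PP)
  have sese: "star e * e = e + star e - \<kappa> *\<^sub>R P - r *\<^sub>R 1"
    using r by (simp add: d_def eP_eq algebra_simps)
  have sbb: "star b * b = (\<kappa> - 1) *\<^sub>R (1 - P)"
    by (simp add: b_def Ps algebra_simps sese Pse Pe PP \<kappa>_def)
  have b2: "b * b = 0" and sb2: "star b * star b = 0"
    using Pb bP sbP Psb by (metis mult.assoc mult_zero_left mult_zero_right)+
  have k1: "\<kappa> - 1 \<noteq> 0" using r0 by (simp add: \<kappa>_def)
  have PM: "P \<in> M" and bM: "b \<in> M" by (auto simp: P_def b_def intro!: ins e)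
  have e_eq: "e = P + b" by (simp add: b_def)
  have corner: "\<exists>s. P * m * P = csc s * P" if m: "m \<in> M" for m
  proof -
    define x where "x = P * m * P"
    have x: "P * x = x" "x * P = x" by (simp_all add: x_def mult.assoc PP) (simp add: mult_ctx[OF PP])
    have xM: "x \<in> M" unfolding x_def by (intro ins PM m)
    \<comment> \<open>The corner entry \<open>x\<close> is copied to the other diagonal place. As
      \<open>b * star b\<close> and \<open>star b * b\<close> are multiples of \<open>P\<close> and
      \<open>1 - P\<close>, the result commutes with \<open>e\<close> and
      \<open>star e\<close>.\<close>
    define \<Theta> where "\<Theta> = x + (1 / (\<kappa> - 1)) *\<^sub>R (star b * x * b)"
    have \<Theta>M: "\<Theta> \<in> M" unfolding \<Theta>_def by (intro ins xM bM)
    have bx: "b * x = 0" using x bP by (metis mult.assoc mult_zero_left)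
    have xsb: "x * star b = 0" using x Psb by (metis mult.assoc mult_zero_right)
    have P\<Theta>: "P * \<Theta> = x" "\<Theta> * P = x"
      by (simp_all add: \<Theta>_def algebra_simps x mult_ctx[OF Psb] bP)
    have "b * \<Theta> = (1 / (\<kappa> - 1)) *\<^sub>R (b * star b * x * b)" by (simp add: \<Theta>_def distrib_left bx mult.assoc)
    also have "\<dots> = P * x * b" using k1 by (simp add: bb)
    finally have b\<Theta>: "b * \<Theta> = x * b" by (simp only: x)
    have \<Theta>b: "\<Theta> * b = x * b" by (simp add: \<Theta>_def algebra_simps b2)
    have sb\<Theta>: "star b * \<Theta> = star b * x" by (simp add: \<Theta>_def algebra_simps mult_ctx[OF sb2])
    have "\<Theta> * star b = (1 / (\<kappa> - 1)) *\<^sub>R (star b * x * (b * star b))"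
      by (simp add: \<Theta>_def distrib_right xsb mult.assoc)
    also have "\<dots> = star b * (x * P)" using k1 by (simp add: bb mult.assoc)
    finally have \<Theta>sb: "\<Theta> * star b = star b * x" by (simp only: x)
    have "\<Theta> * e = e * \<Theta>" by (simp add: e_eq distrib_left distrib_right P\<Theta> b\<Theta> \<Theta>b)
    moreover have "\<Theta> * star e = star e * \<Theta>" by (simp add: e_eq Ps distrib_left distrib_right P\<Theta> sb\<Theta> \<Theta>sb)
    ultimately obtain s where "\<Theta> = csc s" using irred_commutant[OF irr \<Theta>M] by blast
    then have "x = csc s * P" using P\<Theta>(2) by simp
    then show ?thesis unfolding x_def by blast
  qed
  show ?thesis
  proof (rule exI[of _ P], rule exI[of _ b], rule ballI)
    fix m assume m: "m \<in> M"
    \<comment> \<open>Writing \<open>1 - P\<close> as a multiple of \<open>star b * b\<close> moves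
      every block of \<open>m\<close> into the corner of \<open>P\<close>, which is scalar by
      \<open>corner\<close>.\<close>
    define q where "q = 1 / (\<kappa> - 1)"
    have Q: "1 - P = q *\<^sub>R (star b * b)" using k1 by (simp add: sbb q_def)
    obtain s1 where s1: "P * m * P = csc s1 * P" using corner[OF m] by blast
    have mem: "m * star b \<in> M" "b * m \<in> M" "b * m * star b \<in> M" by (intro ins m bM)+
    obtain s2 where s2: "P * (m * star b) * P = csc s2 * P" using corner[OF mem(1)] by blast
    obtain s3 where s3: "P * (b * m) * P = csc s3 * P" using corner[OF mem(2)] by blast
    obtain s4 where s4: "P * (b * m * star b) * P = csc s4 * P" using corner[OF mem(3)] by blast
    have "P * m * (1 - P) = q *\<^sub>R ((P * (m * star b) * P) * b)"
      unfolding Q by (simp add: mult.assoc mult_ctx[OF sbP] Pb)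
    then have 2: "P * m * (1 - P) = csc (of_real q * s2) * b"
      unfolding s2 by (simp add: mult.assoc Pb csc_of_real flip: csc_mult)
    have "(1 - P) * m * P = q *\<^sub>R (star b * (P * (b * m) * P))"
      unfolding Q by (simp add: mult.assoc mult_ctx[OF sbP] mult_ctx[OF Pb])
    then have 3: "(1 - P) * m * P = csc (of_real q * s3) * star b"
      unfolding s3 by (simp add: mult.assoc csc_of_real csc_commute[of "star b"] sbP flip: csc_mult)
        (metis csc_commute mult.assoc sbP)
    have "(1 - P) * m * (1 - P) = q *\<^sub>R q *\<^sub>R (star b * (P * (b * m * star b) * P) * b)"
      unfolding Q by (simp add: mult.assoc mult_ctx[OF sbP] mult_ctx[OF Pb] Pb)
    also have "star b * (P * (b * m * star b) * P) * b = csc s4 * (star b * b)"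
      unfolding s4 by (metis Pb csc_commute mult.assoc)
    also have "q *\<^sub>R q *\<^sub>R (csc s4 * (star b * b)) = csc (of_real q * s4) * (1 - P)"
      unfolding Q by (simp add: csc_of_real flip: csc_mult)
    finally have 4: "(1 - P) * m * (1 - P) = csc (of_real q * s4) * (1 - P)" .
    have "m = P * m * P + P * m * (1 - P) + (1 - P) * m * P + (1 - P) * m * (1 - P)"
      by (simp add: algebra_simps)
    then have "m = csc s1 * P + csc (of_real q * s2) * b + csc (of_real q * s3) * star b + csc (of_real q * s4) * (1 - P)"
      unfolding s1 2 3 4 .
    then show "\<exists>s1 s2 s3 s4. m = csc s1 * P + csc s2 * b + csc s3 * star b + csc s4 * (1 - P)"
      by (intro exI)
  qed
qed

text \<open>A double root is impossible: a normal operator with square 0 vanishes, and a scalar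
  \<open>N\<close> is only similar to itself. For distinct roots \<open>N = q + (p - q) f\<close>
  with \<open>f\<close> idempotent, and this affine relation carries irreducibility over to the
  conjugate \<open>e\<close> of \<open>f\<close>.\<close>

lemma irreducible_quadratic:
  assumes XY: "X \<in> M" "Y \<in> M" "X * Y = 1" "Y * X = 1" and N: "N \<in> M" and normal: "star N * N = N * star N"
    and irr: "irred M (X * N * Y)" and big: "T0 \<in> M" "\<And>c. T0 \<noteq> csc c"
    and quad: "(N - csc p) * (N - csc q) = 0"
  shows "\<exists>P b. \<forall>m\<in>M. \<exists>s1 s2 s3 s4. m = csc s1 * P + csc s2 * b + csc s3 * star b + csc s4 * (1 - P)"
proof -
  have nonscalar: "N \<noteq> csc c" for c
  proof
    assume c: "N = csc c"
    have T: "X * N * Y = csc c" by (simp add: c csc_commute mult.assoc XY)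
    have "\<exists>c. T0 = csc c" by (rule irred_commutant[OF irr big(1)]) (simp_all add: T csc_commute)
    then show False using big(2) by blast
  qed
  have pq: "p \<noteq> q"
  proof
    assume "p = q"
    define Z where "Z = N - csc p"
    have "star (- Z) * (- Z) = (- Z) * star (- Z)"
      using normal_shift[OF normal, of p] by (simp add: Z_def)
    then have Zn: "star Z * Z = Z * star Z" by simp
    have ZZ: "Z * Z = 0" using quad \<open>p = q\<close> by (simp add: Z_def)
    have "star (star Z * Z) * (star Z * Z) = star Z * (Z * star Z) * Z" by (simp add: mult.assoc)
    also have "\<dots> = star Z * star Z * (Z * Z)" by (simp only: Zn[symmetric] mult.assoc)
    finally have "star Z * Z = 0" by (simp add: ZZ cop_eq_0_iff_star_mult del: star_simps(6))
    then have "Z = 0" by (simp only: cop_eq_0_iff_star_mult)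
    then show False using nonscalar[of p] by (simp add: Z_def)
  qed
  define u where "u = 1 / (p - q)"
  have u: "u * (p - q) = 1" using pq by (simp add: u_def)
  define f where "f = csc u * (N - csc q)"
  have N_eq: "N = csc q + csc (p - q) * f"
    using pq by (simp add: f_def csc_mult u_def flip: mult.assoc)
  have ff: "f * f = f"
  proof -
    have "(N - csc q) * (N - csc q) = (N - csc p) * (N - csc q) + csc (p - q) * (N - csc q)"
      by (simp add: left_diff_distrib flip: csc_diff)
    then have sq: "(N - csc q) * (N - csc q) = csc (p - q) * (N - csc q)" by (simp add: quad)
    have "f * f = csc u * ((N - csc q) * csc u) * (N - csc q)" by (simp only: f_def mult.assoc)
    also have "\<dots> = csc u * (csc u * (N - csc q)) * (N - csc q)"
      by (simp only: csc_commute[of "N - csc q"])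
    also have "\<dots> = csc u * csc u * ((N - csc q) * (N - csc q))" by (simp only: mult.assoc)
    also have "\<dots> = csc (u * u * (p - q)) * (N - csc q)" by (simp add: sq csc_mult flip: mult.assoc)
    also have "u * u * (p - q) = u" using u by (simp add: mult.assoc)
    finally show ?thesis by (simp add: f_def)
  qed
  define e where "e = X * f * Y"
  have eM: "e \<in> M" unfolding e_def f_def by (intro ins XY N)
  have eT: "X * N * Y = csc q + csc (p - q) * e"
  proof -
    have "X * N * Y = X * csc q * Y + X * csc (p - q) * f * Y"
      by (subst N_eq) (simp add: distrib_left distrib_right mult.assoc)
    also have "\<dots> = csc q * (X * Y) + csc (p - q) * e" by (simp only: e_def csc_commute mult.assoc)
    finally show ?thesis by (simp add: XY)
  qed
  have ee: "e * e = e"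
  proof -
    have "e * e = X * f * (Y * X) * f * Y" by (simp only: e_def mult.assoc)
    also have "\<dots> = X * (f * f) * Y" by (simp add: XY mult.assoc)
    finally show ?thesis by (simp only: ff e_def)
  qed
  have "irred M e" unfolding irred_def
  proof (intro conjI ballI impI eM)
    fix R assume R: "R \<in> M" "star R = R" "R * e = e * R"
    have "R * (csc (p - q) * e) = csc (p - q) * e * R" by (metis R(3) csc_commute mult.assoc)
    then have "R * (X * N * Y) = X * N * Y * R"
      unfolding eT by (simp add: distrib_left distrib_right csc_commute[of R])
    then show "\<exists>c. R = csc c" using irr R by (simp add: irred_def)
  qed
  then show ?thesis by (rule irreducible_idempotent[OF eM ee _ big])
qed

end

section \<open>Transfer to the algebra of bounded operators\<close>

definition cops :: "('h::complex_hilbert_space \<Rightarrow>\<^sub>L 'h) set \<Rightarrow> 'h cop set" where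
  "cops M = {T. op_of T \<in> M}"

lemma blinfun_eq_iff: "S = T \<longleftrightarrow> (\<forall>x. blinfun_apply S x = blinfun_apply T x)"
  by (auto intro: blinfun_eqI)

lemma op_of_Cop: "T \<in> bounded_ops \<Longrightarrow> op_of (Cop T) = T"
  by (rule Cop_inverse)

lemma op_of_csc_mult: "op_of (csc c * T) = scaleC_op c (op_of T)"
  by (simp add: times_cop.rep_eq csc.rep_eq scaleC_op_def)

lemmas op_of_rep = times_cop.rep_eq plus_cop.rep_eq minus_cop.rep_eq one_cop.rep_eq zero_cop.rep_eq
  csc.rep_eq star.rep_eq

lemma limitin_sot:
  assumes "slim X L"
  shows "limitin strong_operator_topology (\<lambda>n. op_of (X n)) (op_of L) sequentially"
proof -
  have "limitin (product_topology (\<lambda>i. euclidean) UNIV) (\<lambda>n. blinfun_apply (op_of (X n)))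
      (blinfun_apply (op_of L)) sequentially"
    unfolding limitin_componentwise using assms by (simp add: slim_def app_def)
  then have lim: "limitin euclidean (\<lambda>n. blinfun_apply (op_of (X n))) (blinfun_apply (op_of L)) sequentially"
    by (simp add: euclidean_product_topology)
  show ?thesis
    unfolding limitin_def strong_operator_topology_topspace
  proof (intro conjI allI impI)
    fix U assume "openin strong_operator_topology U \<and> op_of L \<in> U"
    then obtain V where V: "open V" "U = blinfun_apply -` V" "blinfun_apply (op_of L) \<in> V"
      unfolding strong_operator_topology_def openin_pullback_topology by auto
    then have "\<forall>\<^sub>F n in sequentially. blinfun_apply (op_of (X n)) \<in> V"
      using lim by (simp add: limitin_def)
    then show "\<forall>\<^sub>F n in sequentially. op_of (X n) \<in> U" by (simp add: V(2))
  qed simp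
qed

lemma vn_cops:
  assumes M: "von_neumann_algebra M" shows "vn (cops M)"
proof
  note d = M[unfolded von_neumann_algebra_def]
  show "1 \<in> cops M" "S \<in> cops M \<Longrightarrow> T \<in> cops M \<Longrightarrow> S + T \<in> cops M"
    "S \<in> cops M \<Longrightarrow> T \<in> cops M \<Longrightarrow> S * T \<in> cops M" "T \<in> cops M \<Longrightarrow> csc c * T \<in> cops M"
    "T \<in> cops M \<Longrightarrow> star T \<in> cops M" for S T c
    using d by (simp_all add: cops_def op_of_rep scaleC_op_def)
  show "L \<in> cops M" if X: "\<And>n. X n \<in> cops M" and L: "slim X L" for X L
  proof -
    have "op_of L \<in> M"
      by (rule limitin_closedin[OF limitin_sot[OF L]]) (use d X in \<open>simp_all add: cops_def\<close>)
    then show ?thesis by (simp add: cops_def)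
  qed
qed

lemma in_bounded_ops: "von_neumann_algebra M \<Longrightarrow> T \<in> M \<Longrightarrow> T \<in> bounded_ops"
  by (auto simp: von_neumann_algebra_def)

lemma vector_functional_in_predual: "(\<lambda>T. cinner (blinfun_apply T x) y) \<in> predual M"
proof -
  define X Y where "X = (\<lambda>n::nat. if n = 0 then x else 0)" and "Y = (\<lambda>n::nat. if n = 0 then y else 0)"
  have "summable (\<lambda>n. (norm (X n))\<^sup>2)" "summable (\<lambda>n. (norm (Y n))\<^sup>2)"
    by (rule summable_finite[of "{0}"]; simp add: X_def Y_def)+
  moreover have "(\<lambda>n. cinner (blinfun_apply T (X n)) (Y n)) sums cinner (blinfun_apply T x) y" for T
    using sums_finite[of "{0}" "\<lambda>n. cinner (blinfun_apply T (X n)) (Y n)"] by (simp add: X_def Y_def)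
  ultimately show ?thesis unfolding predual_def by blast
qed

text \<open>\<open>\<xi>\<close> lists all vectors occurring on the left in the series of a dense
  sequence of functionals. An operator killing them is annihilated by these functionals, hence by
  density has only zero coefficients.\<close>

lemma sepfac_exists:
  assumes "separable_factor M"
  shows "\<exists>\<Phi> \<xi>. sepfac (cops M) \<Phi> \<xi>"
proof -
  have M: "von_neumann_algebra M" and cent: "commutant M \<inter> M = range scalar_op" and sp: "separable_predual M"
    using assms by (auto simp: separable_factor_def factor_def)
  interpret vn "cops M" by (rule vn_cops[OF M])
  obtain D where D0: "countable D \<and> D \<subseteq> predual M \<and>
      (\<forall>\<phi>\<in>predual M. \<forall>e>0. \<exists>\<psi>\<in>D. \<forall>T\<in>M. cmod (\<phi> T - \<psi> T) \<le> e * norm T)"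
    using sp unfolding separable_predual_def by (rule exE)
  have D: "countable D" "D \<subseteq> predual M"
    "\<And>\<phi> e. \<phi> \<in> predual M \<Longrightarrow> e > 0 \<Longrightarrow> \<exists>\<psi>\<in>D. \<forall>T\<in>M. cmod (\<phi> T - \<psi> T) \<le> e * norm T"
    using D0 by simp_all
  have "D \<noteq> {}" using D(3)[OF vector_functional_in_predual zero_less_one] by blast
  define \<psi> where "\<psi> = from_nat_into D"
  have range: "range \<psi> = D" using D(1) \<open>D \<noteq> {}\<close> by (simp add: \<psi>_def)
  have approx: "\<exists>n. \<forall>T\<in>M. cmod (cinner (blinfun_apply T x) y - \<psi> n T) \<le> e * norm T" if "e > 0" for e x y
    using D(3)[OF vector_functional_in_predual that, of x y] range by (metis imageE)
  have "\<forall>n. \<exists>x y :: nat \<Rightarrow> 'a. \<forall>T\<in>M. (\<lambda>k. cinner (blinfun_apply T (x k)) (y k)) sums \<psi> n T"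
    using D(2) range unfolding predual_def by blast
  then obtain x y :: "nat \<Rightarrow> nat \<Rightarrow> 'a"
    where xy: "\<And>n T. T \<in> M \<Longrightarrow> (\<lambda>k. cinner (blinfun_apply T (x n k)) (y n k)) sums \<psi> n T" by metis
  define \<xi> where "\<xi> k = x (fst (prod_decode k)) (snd (prod_decode k))" for k
  have "sepfac (cops M) (\<lambda>T n. \<psi> n (op_of T)) \<xi>"
  proof
    fix T assume T: "T \<in> cops M" and c: "\<And>S. S \<in> cops M \<Longrightarrow> S * T = T * S"
    have "op_of T \<in> commutant M" unfolding commutant_def
    proof (intro CollectI conjI ballI op_of)
      fix S assume S: "S \<in> M"
      then have "op_of (Cop S) = S" by (intro op_of_Cop in_bounded_ops[OF M])
      then show "op_of T o\<^sub>L S = S o\<^sub>L op_of T" using c[of "Cop S"] S by (metis cops_def mem_Collect_eq times_cop.rep_eq)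
    qed
    then have "op_of T \<in> range scalar_op" using cent T by (auto simp: cops_def)
    then show "\<exists>c. T = csc c" by (metis csc.rep_eq op_of_inject rangeE)
  next
    fix e :: real and x y :: 'a
    assume "e > 0"
    then obtain n where n: "\<forall>T\<in>M. cmod (cinner (blinfun_apply T x) y - \<psi> n T) \<le> e * norm T" using approx by blast
    have "cmod (cinner (T \<cdot> x) y - \<psi> n (op_of T)) \<le> e" if "T \<in> cops M" "norm T \<le> 1" for T
    proof -
      have "cmod (cinner (T \<cdot> x) y - \<psi> n (op_of T)) \<le> e * norm T"
        using n that(1) by (simp add: cops_def app_def norm_cop.rep_eq)
      also have "\<dots> \<le> e" using that(2) \<open>e > 0\<close> by (simp add: mult_left_le)
      finally show ?thesis .
    qed
    then show "\<exists>n. \<forall>T\<in>cops M. norm T \<le> 1 \<longrightarrow> cmod (cinner (T \<cdot> x) y - \<psi> n (op_of T)) \<le> e" by blast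
  next
    fix T assume T: "T \<in> cops M" and z: "\<And>n. T \<cdot> \<xi> n = 0"
    have "T \<cdot> x n k = 0" for n k using z[of "prod_encode (n, k)"] by (simp add: \<xi>_def)
    then have \<psi>0: "\<psi> n (op_of T) = 0" for n
      using xy[of "op_of T" n] T by (simp add: cops_def app_def sums_iff)
    have le: "cmod (cinner (T \<cdot> u) v) \<le> 0 + d" if "d > 0" for u v d
    proof -
      have "d / (norm T + 1) > 0" using that by (simp add: add_nonneg_pos)
      then obtain n where n: "\<forall>S\<in>M. cmod (cinner (blinfun_apply S u) v - \<psi> n S) \<le> d / (norm T + 1) * norm S"
        using approx by blast
      have "op_of T \<in> M" using T by (simp add: cops_def)
      from bspec[OF n this] have "cmod (cinner (T \<cdot> u) v) \<le> d / (norm T + 1) * norm T"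
        by (simp add: \<psi>0 app_def norm_cop.rep_eq)
      also have "\<dots> \<le> d" using that by (simp add: divide_le_eq add_nonneg_pos distrib_left)
      finally show ?thesis by simp
    qed
    have "cinner (T \<cdot> u) (T \<cdot> u) = 0" for u
      using field_le_epsilon[OF le, of u "T \<cdot> u"] by simp
    then show "T = 0" by (intro cop_eqI) (simp add: cinner_self)
  qed
  then show ?thesis by blast
qed

lemma projection_op_of: "projection (op_of P) \<longleftrightarrow> pr P"
  using op_of[of P] by (simp add: projection_def pr_def op_of_inject[symmetric] op_of_rep)

lemma projection_Cop: "projection P \<Longrightarrow> pr (Cop P) \<and> op_of (Cop P) = P"
  using projection_op_of[of "Cop P"] by (simp add: projection_def op_of_Cop)

lemma range_projection_op_of:
  fixes T :: "'h::complex_hilbert_space cop"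
  shows "range_projection (op_of T) = op_of (rp T)"
  unfolding range_projection_def
proof (rule the_equality)
  have app: "blinfun_apply (op_of S) = (\<cdot>) S" for S :: "'h cop" by (simp add: app_def fun_eq_iff)
  show "projection (op_of (rp T)) \<and> range (blinfun_apply (op_of (rp T))) = closure (range (blinfun_apply (op_of T)))"
    unfolding projection_op_of app using pr_rp range_rp by (intro conjI)
  fix P assume P: "projection P \<and> range (blinfun_apply P) = closure (range (blinfun_apply (op_of T)))"
  define Q where "Q = Cop P"
  have Q: "pr Q" "op_of Q = P" using P projection_Cop by (auto simp: Q_def)
  have "range (blinfun_apply (op_of Q)) = closure (range (blinfun_apply (op_of T)))" using P Q(2) by simp
  then have r: "range ((\<cdot>) Q) = range ((\<cdot>) (rp T))" by (simp only: app range_rp)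
  have fixed: "S \<cdot> x = x \<longleftrightarrow> x \<in> range ((\<cdot>) S)" if "pr S" for S and x :: 'h
  proof
    show "S \<cdot> x = x" if "x \<in> range ((\<cdot>) S)" using that pr_app_idem[OF \<open>pr S\<close>] by auto
    show "x \<in> range ((\<cdot>) S)" if "S \<cdot> x = x" using that rangeI[of "(\<cdot>) S" x] by simp
  qed
  have "Q = rp T"
  proof (rule pr_eqI[OF Q(1) pr_rp])
    show "Q \<cdot> x = x \<longleftrightarrow> rp T \<cdot> x = x" for x
      unfolding fixed[OF Q(1)] fixed[OF pr_rp] r ..
  qed
  then show "P = op_of (rp T)" by (simp flip: Q(2))
qed

lemma mvn_le_op_of:
  assumes M: "von_neumann_algebra M" and P: "pr P" and Q: "pr Q"
  shows "mvn_le M (op_of P) (op_of Q) \<longleftrightarrow> ple (cops M) P Q"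
proof
  interpret vn "cops M" by (rule vn_cops[OF M])
  assume "mvn_le M (op_of P) (op_of Q)"
  then obtain Q0 V where Q0: "Q0 \<in> M" "projection Q0" "op_le Q0 (op_of Q)" and V: "V \<in> M"
    "adj V o\<^sub>L V = op_of P" "V o\<^sub>L adj V = Q0"
    by (auto simp: mvn_le_def mvn_equiv_def)
  define W where "W = Cop V"
  define R where "R = Cop Q0"
  have W: "op_of W = V" and R: "op_of R = Q0" "pr R"
    using V(1) Q0 projection_Cop in_bounded_ops[OF M] by (auto simp: W_def R_def op_of_Cop)
  have WP: "star W * W = P" and WR: "W * star W = R"
    using V(2,3) by (simp_all add: op_of_inject[symmetric] op_of_rep W R)
  have "Q * R = R"
  proof (rule cop_eqI)
    fix x
    define y where "y = R \<cdot> x"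
    have Ry: "R \<cdot> y = y" by (simp add: y_def pr_app_idem R)
    have "cinner ((Q - R) \<cdot> y) y \<in> \<real>\<^sub>\<ge>\<^sub>0"
      using Q0(3) by (simp add: op_le_def app_def minus_cop.rep_eq R(1))
    then have "Re (cinner (R \<cdot> y) y) \<le> Re (cinner (Q \<cdot> y) y)"
      by (simp add: cinner_simps complex_nonneg_Reals_iff)
    then have "(norm y)\<^sup>2 \<le> (norm (Q \<cdot> y))\<^sup>2"
      by (simp add: Ry pr_norm_sq[OF Q] cinner_self del: of_real_power)
    then have "norm (y - Q \<cdot> y) = 0" using pr_pythagoras[OF Q, of y] by simp
    then show "(Q * R) \<cdot> x = R \<cdot> x" by (simp add: y_def)
  qed
  moreover have "R * W = W" using isometry_right[OF P WP] WR WP by (metis mult.assoc)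
  ultimately have "Q * W = W" by (metis mult.assoc)
  then show "ple (cops M) P Q" using WP V(1) unfolding ple_def by (intro bexI[of _ W]) (auto simp: cops_def W)
next
  interpret vn "cops M" by (rule vn_cops[OF M])
  assume "ple (cops M) P Q"
  then obtain V where V: "V \<in> cops M" "star V * V = P" "Q * V = V" by (auto simp: ple_def)
  define R where "R = V * star V"
  have R: "pr R" "R \<in> cops M" "Q * R = R"
    using isometry_range[OF P V(2)] V by (auto simp: R_def mult.assoc[symmetric] intro!: ins)
  have VP: "V * P = V" by (rule isometry_right[OF P V(2)])
  have "op_le (op_of R) (op_of Q)" unfolding op_le_def
  proof
    fix x
    have "pr (Q - R)" by (rule pr_diff[OF Q R(1,3)])
    then have "cinner ((Q - R) \<cdot> x) x = cinner ((Q - R) \<cdot> x) ((Q - R) \<cdot> x)"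
      by (simp only: star_cinner'[of _ "Q - R"] pr_star pr_app_idem)
    then show "cinner (blinfun_apply (op_of Q - op_of R) x) x \<in> \<real>\<^sub>\<ge>\<^sub>0"
      by (simp add: cinner_self app_def minus_cop.rep_eq del: of_real_power)
  qed
  moreover have "partial_isometry (op_of V)" unfolding partial_isometry_def
  proof (intro conjI allI impI op_of)
    fix x assume x: "\<forall>z. blinfun_apply (op_of V) z = 0 \<longrightarrow> cinner x z = 0"
    have "V \<cdot> (x - P \<cdot> x) = (V - V * P) \<cdot> x" by (simp add: app_diff)
    then have "V \<cdot> (x - P \<cdot> x) = 0" by (simp add: VP)
    then have "cinner x ((1 - P) \<cdot> x) = 0" using x by (simp add: app_def op_of_rep blinfun.diff_left)
    then have "(norm ((1 - P) \<cdot> x))\<^sup>2 = 0"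
      using pr_norm_sq[OF pr_compl[OF P], of x] by (metis cinner_commute complex_cnj_zero zero_complex.sel(1))
    then have "P \<cdot> x = x" by simp
    then have "(norm (V \<cdot> x))\<^sup>2 = (norm x)\<^sup>2"
      using norm_app_sq[of V x] by (simp add: cinner_self del: of_real_power flip: V(2))
    then show "norm (blinfun_apply (op_of V) x) = norm x" by (simp add: app_def)
  qed
  moreover have "adj (op_of V) o\<^sub>L op_of V = op_of P" using arg_cong[OF V(2), of op_of] by (simp only: op_of_rep)
  moreover have "op_of V o\<^sub>L adj (op_of V) = op_of R" by (simp only: R_def op_of_rep)
  moreover have "op_of R \<in> M" "op_of V \<in> M" "projection (op_of R)"
    using R V(1) by (simp_all add: cops_def projection_op_of)
  ultimately show "mvn_le M (op_of P) (op_of Q)" unfolding mvn_le_def mvn_equiv_def by blast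
qed

text \<open>\<open>generated_vna\<close> is an intersection of algebras; the relative commutant of
  \<open>R\<close> is one of them as soon as \<open>R\<close> commutes with the generator.\<close>

lemma von_neumann_algebra_relative_commutant:
  assumes M: "von_neumann_algebra M" and R: "star R = R"
  shows "von_neumann_algebra {S \<in> M. S o\<^sub>L op_of R = op_of R o\<^sub>L S}"
proof -
  note d = M[unfolded von_neumann_algebra_def]
  have bo: "op_of (Cop S) = S" if "S \<in> M" for S by (rule op_of_Cop[OF in_bounded_ops[OF M that]])
  have eq: "S o\<^sub>L op_of R = op_of R o\<^sub>L S \<longleftrightarrow> Cop S * R = R * Cop S" if "S \<in> M" for S
    by (simp add: op_of_inject[symmetric] op_of_rep bo[OF that])
  have "adj S o\<^sub>L op_of R = op_of R o\<^sub>L adj S" if S: "S \<in> M" "S o\<^sub>L op_of R = op_of R o\<^sub>L S" for S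
  proof -
    have "Cop S * R = R * Cop S" using S eq by simp
    from arg_cong[OF this, of star] have "star (Cop S) * R = R * star (Cop S)" by (simp add: R)
    then show ?thesis by (simp add: op_of_inject[symmetric] op_of_rep bo[OF S(1)])
  qed
  moreover have "closedin strong_operator_topology {S \<in> M. S o\<^sub>L op_of R = op_of R o\<^sub>L S}"
  proof -
    have "closedin strong_operator_topology {S \<in> topspace strong_operator_topology.
        blinfun_apply S (R \<cdot> x) - R \<cdot> blinfun_apply S x \<in> {0}}" for x
    proof (rule closedin_continuous_map_preimage)
      have "continuous_map strong_operator_topology euclidean (\<lambda>S. R \<cdot> blinfun_apply S x)"
        using continuous_map_compose[OF strong_operator_topology_continuous_evaluation, of euclidean "(\<cdot>) R" x]
          bounded_linear.continuous_on[OF bounded_linear_app, of UNIV "\<lambda>x. x" R]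
        by (simp add: o_def)
      then show "continuous_map strong_operator_topology euclidean (\<lambda>S. blinfun_apply S (R \<cdot> x) - R \<cdot> blinfun_apply S x)"
        by (intro continuous_map_diff strong_operator_topology_continuous_evaluation)
    qed simp
    then have "closedin strong_operator_topology (\<Inter>x. {S. blinfun_apply S (R \<cdot> x) = R \<cdot> blinfun_apply S x})"
      by (intro closedin_Inter) (auto simp: strong_operator_topology_topspace)
    moreover have "{S \<in> M. S o\<^sub>L op_of R = op_of R o\<^sub>L S} =
        M \<inter> (\<Inter>x. {S. blinfun_apply S (R \<cdot> x) = R \<cdot> blinfun_apply S x})"
      by (auto simp: app_def blinfun_eq_iff)
    ultimately show ?thesis using d by (simp add: closedin_Int)
  qed
  moreover have "scaleC_op c S o\<^sub>L op_of R = op_of R o\<^sub>L scaleC_op c S"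
    if S: "S o\<^sub>L op_of R = op_of R o\<^sub>L S" for c S
  proof (rule blinfun_eqI)
    fix x
    have "blinfun_apply S (R \<cdot> x) = R \<cdot> blinfun_apply S x" using S by (simp add: blinfun_eq_iff app_def)
    then show "blinfun_apply (scaleC_op c S o\<^sub>L op_of R) x = blinfun_apply (op_of R o\<^sub>L scaleC_op c S) x"
      using app_scaleC[of R c "blinfun_apply S x"] by (simp add: scaleC_op_def scalar_op.rep_eq app_def)
  qed
  moreover have "(S + T) o\<^sub>L op_of R = op_of R o\<^sub>L (S + T)" "(S o\<^sub>L T) o\<^sub>L op_of R = op_of R o\<^sub>L (S o\<^sub>L T)"
    if "S o\<^sub>L op_of R = op_of R o\<^sub>L S" "T o\<^sub>L op_of R = op_of R o\<^sub>L T" for S T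
    using that by (auto simp: blinfun_eq_iff blinfun.add_left blinfun.add_right)
  ultimately show ?thesis using d unfolding von_neumann_algebra_def by (auto simp: blinfun_eq_iff)
qed

lemma irreducible_in_op_of:
  assumes sf: "sepfac (cops M) \<Phi> \<xi>" and M: "von_neumann_algebra M" and T: "T \<in> cops M"
  shows "irreducible_in M (op_of T) \<longleftrightarrow> irred (cops M) T"
proof
  interpret sepfac "cops M" \<Phi> \<xi> by (rule sf)
  have scal: "\<exists>c. R = csc c" if "op_of R \<in> range scalar_op" for R
    using that by (metis csc.rep_eq op_of_inject rangeE)
  assume irr: "irreducible_in M (op_of T)"
  show "irred (cops M) T" unfolding irred_def
  proof (intro conjI T ballI impI)
    fix R assume R: "R \<in> cops M" "star R = R" "R * T = T * R"
    have "op_of T o\<^sub>L op_of R = op_of R o\<^sub>L op_of T" using R(3) by (metis times_cop.rep_eq)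
    then have "generated_vna (op_of T) \<subseteq> {S \<in> M. S o\<^sub>L op_of R = op_of R o\<^sub>L S}"
      unfolding generated_vna_def using von_neumann_algebra_relative_commutant[OF M R(2)] T by (auto simp: cops_def)
    then have "op_of R \<in> commutant (generated_vna (op_of T))" by (auto simp: commutant_def op_of)
    then have "op_of R \<in> range scalar_op" using irr R(1) by (auto simp: irreducible_in_def cops_def)
    then show "\<exists>c. R = csc c" by (rule scal)
  qed
next
  interpret sepfac "cops M" \<Phi> \<xi> by (rule sf)
  assume irr: "irred (cops M) T"
  have gen: "op_of T \<in> generated_vna (op_of T)" "adj (op_of T) \<in> generated_vna (op_of T)"
    "generated_vna (op_of T) \<subseteq> M"
    using M T by (auto simp: generated_vna_def von_neumann_algebra_def cops_def)
  have "commutant (generated_vna (op_of T)) \<inter> M = range scalar_op"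
  proof (intro subset_antisym subsetI)
    fix S assume S: "S \<in> commutant (generated_vna (op_of T)) \<inter> M"
    define R where "R = Cop S"
    have RS: "op_of R = S" using S in_bounded_ops[OF M] by (simp add: R_def op_of_Cop)
    have "R \<in> cops M" using S by (simp add: cops_def RS)
    moreover have "R * T = T * R" "R * star T = star T * R"
      using S gen by (simp_all add: op_of_inject[symmetric] op_of_rep RS commutant_def)
    ultimately have "\<exists>c. R = csc c" by (rule irred_commutant[OF irr])
    then show "S \<in> range scalar_op" using RS by (auto simp: csc.rep_eq)
  next
    fix S :: "'a \<Rightarrow>\<^sub>L 'a" assume "S \<in> range scalar_op"
    then obtain c where c: "S = op_of (csc c)" by (auto simp: csc.rep_eq)
    have "S o\<^sub>L U = U o\<^sub>L S" if "U \<in> M" for U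
    proof -
      have "csc c * Cop U = Cop U * csc c" by (rule csc_commute[symmetric])
      then show ?thesis using op_of_Cop[OF in_bounded_ops[OF M that]] by (metis c times_cop.rep_eq)
    qed
    then show "S \<in> commutant (generated_vna (op_of T)) \<inter> M"
      using gen(3) csc_in[of c] by (auto simp: commutant_def c op_of cops_def)
  qed
  then show "irreducible_in M (op_of T)" using T by (simp add: irreducible_in_def cops_def)
qed

lemma complex_quadratic_roots:
  fixes a b c :: complex
  assumes "c \<noteq> 0" shows "\<exists>p q. a = c * (p * q) \<and> b = - c * (p + q)"
proof -
  define s where "s = csqrt ((b / c)\<^sup>2 - 4 * (a / c))"
  have s: "s * s = (b / c) * (b / c) - 4 * (a / c)" using power2_csqrt by (simp add: s_def power2_eq_square[symmetric])
  define p q where "p = (- (b / c) + s) / 2" and "q = (- (b / c) - s) / 2"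
  have sum: "p + q = - (b / c)" by (simp add: p_def q_def field_simps)
  have quarter: "((- u + v) / 2) * ((- u - v) / 2) = (u * u - v * v) / 4" for u v :: complex
    by (simp add: algebra_simps)
  have "p * q = ((b / c) * (b / c) - s * s) / 4" unfolding p_def q_def by (rule quarter)
  then have "p * q = a / c" unfolding s by simp
  then show ?thesis using assms sum by (intro exI[of _ p] exI[of _ q]) simp
qed

theorem theorem1p2:
  fixes M :: "('h::complex_hilbert_space \<Rightarrow>\<^sub>L 'h) set" and N :: "'h \<Rightarrow>\<^sub>L 'h"
  assumes "separable_factor M"
    and dim_gt_4: "\<exists>B\<subseteq>M. cop.independent B \<and> card B > 4"
    and "N \<in> M" and "normal_op N"
  shows "(\<exists>X\<in>M. \<exists>Y\<in>M. X o\<^sub>L Y = id_blinfun \<and> Y o\<^sub>L X = id_blinfun \<and>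
            irreducible_in M (X o\<^sub>L N o\<^sub>L Y)) \<longleftrightarrow>
         (\<forall>z. mvn_le M (id_blinfun - range_projection (scalar_op z - N))
                       (range_projection (scalar_op z - N))) \<and>
         (\<forall>a b c. scaleC_op a id_blinfun + scaleC_op b N + scaleC_op c (N o\<^sub>L N) = 0 \<longrightarrow>
            a = 0 \<and> b = 0 \<and> c = 0)"
proof -
  have M: "von_neumann_algebra M" using assms(1) by (simp add: separable_factor_def factor_def)
  obtain \<Phi> \<xi> where sf: "sepfac (cops M) \<Phi> \<xi>" using sepfac_exists[OF assms(1)] by blast
  interpret sepfac "cops M" \<Phi> \<xi> by (rule sf)
  have bo: "op_of (Cop S) = S" if "S \<in> M" for S by (rule op_of_Cop[OF in_bounded_ops[OF M that]])
  define n where "n = Cop N"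
  have n: "op_of n = N" using bo assms(3) by (simp add: n_def)
  have nM: "n \<in> cops M" using assms(3) by (simp add: cops_def n)
  have normal: "star n * n = n * star n"
    using assms(4) by (simp add: normal_op_def op_of_inject[symmetric] op_of_rep n)
  have opz: "scalar_op z - N = op_of (csc z - n)" for z by (simp add: op_of_rep n)
  have c1: "mvn_le M (id_blinfun - range_projection (scalar_op z - N)) (range_projection (scalar_op z - N)) \<longleftrightarrow>
      ple (cops M) (1 - rp (csc z - n)) (rp (csc z - n))" for z
    unfolding opz range_projection_op_of
    using mvn_le_op_of[OF M pr_compl[OF pr_rp] pr_rp, of "csc z - n" "csc z - n"] by (simp add: op_of_rep)
  have c2: "scaleC_op a id_blinfun + scaleC_op b N + scaleC_op c (N o\<^sub>L N) = 0 \<longleftrightarrow>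
      csc a + csc b * n + csc c * (n * n) = 0" for a b c
    by (simp add: op_of_inject[symmetric] op_of_rep n scaleC_op_def)
      (simp add: blinfun_eq_iff blinfun.add_left)
  have c0: "(\<exists>X\<in>M. \<exists>Y\<in>M. X o\<^sub>L Y = id_blinfun \<and> Y o\<^sub>L X = id_blinfun \<and> irreducible_in M (X o\<^sub>L N o\<^sub>L Y)) \<longleftrightarrow>
      (\<exists>X\<in>cops M. \<exists>Y\<in>cops M. X * Y = 1 \<and> Y * X = 1 \<and> irred (cops M) (X * n * Y))"
  proof
    assume "\<exists>X\<in>M. \<exists>Y\<in>M. X o\<^sub>L Y = id_blinfun \<and> Y o\<^sub>L X = id_blinfun \<and> irreducible_in M (X o\<^sub>L N o\<^sub>L Y)"
    then obtain X Y where XY: "X \<in> M" "Y \<in> M" "X o\<^sub>L Y = id_blinfun" "Y o\<^sub>L X = id_blinfun"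
      "irreducible_in M (X o\<^sub>L N o\<^sub>L Y)" by blast
    have m: "Cop X \<in> cops M" "Cop Y \<in> cops M" using XY bo by (simp_all add: cops_def)
    have "op_of (Cop X * n * Cop Y) = X o\<^sub>L N o\<^sub>L Y" using XY by (simp add: op_of_rep bo n)
    then have "irred (cops M) (Cop X * n * Cop Y)"
      using irreducible_in_op_of[OF sf M, of "Cop X * n * Cop Y"] XY(5) m nM by (auto intro: ins)
    moreover have "Cop X * Cop Y = 1" "Cop Y * Cop X = 1"
      using XY by (simp_all add: op_of_inject[symmetric] op_of_rep bo)
    ultimately show "\<exists>X\<in>cops M. \<exists>Y\<in>cops M. X * Y = 1 \<and> Y * X = 1 \<and> irred (cops M) (X * n * Y)"
      using m by blast
  next
    assume "\<exists>X\<in>cops M. \<exists>Y\<in>cops M. X * Y = 1 \<and> Y * X = 1 \<and> irred (cops M) (X * n * Y)"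
    then obtain X Y where XY: "X \<in> cops M" "Y \<in> cops M" "X * Y = 1" "Y * X = 1" "irred (cops M) (X * n * Y)"
      by blast
    have "irreducible_in M (op_of (X * n * Y))"
      using irreducible_in_op_of[OF sf M, of "X * n * Y"] XY nM by (auto intro: ins)
    then have "irreducible_in M (op_of X o\<^sub>L N o\<^sub>L op_of Y)" by (simp add: op_of_rep n)
    moreover have "op_of X o\<^sub>L op_of Y = id_blinfun" "op_of Y o\<^sub>L op_of X = id_blinfun"
      using arg_cong[OF XY(3), of op_of] arg_cong[OF XY(4), of op_of] by (simp_all add: op_of_rep)
    ultimately show "\<exists>X\<in>M. \<exists>Y\<in>M. X o\<^sub>L Y = id_blinfun \<and> Y o\<^sub>L X = id_blinfun \<and> irreducible_in M (X o\<^sub>L N o\<^sub>L Y)"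
      using XY(1,2) by (auto simp: cops_def)
  qed
  have small: False if F: "finite F" "card F \<le> 4" and sp: "\<And>S. S \<in> M \<Longrightarrow> S \<in> cop.span F" for F
  proof -
    obtain B where B: "B \<subseteq> M" "cop.independent B" "card B > 4" using dim_gt_4 by blast
    have "B \<subseteq> cop.span F" using B(1) sp by blast
    then show False using cop.independent_span_bound[OF F(1) B(2)] B(3) F(2) by simp
  qed
  have "\<exists>T0\<in>cops M. \<forall>c. T0 \<noteq> csc c"
  proof (rule ccontr)
    assume "\<not> ?thesis"
    then have sc: "\<And>T. T \<in> cops M \<Longrightarrow> \<exists>c. T = csc c" by blast
    show False
    proof (rule small[of "{id_blinfun}"])
      fix S assume S: "S \<in> M"
      then obtain c where "Cop S = csc c" using sc[of "Cop S"] bo by (auto simp: cops_def)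
      then have "S = op_of (csc c * 1)" using bo[OF S] by simp
      then have "S = scaleC_op c id_blinfun" by (simp only: op_of_csc_mult one_cop.rep_eq)
      then show "S \<in> cop.span {id_blinfun}" by (simp add: cop.span_scale cop.span_base)
    qed simp_all
  qed
  then obtain T0 where T0: "T0 \<in> cops M" "\<And>c. T0 \<noteq> csc c" by blast
  have fourdim: False
    if ex: "\<exists>P b. \<forall>m\<in>cops M. \<exists>s1 s2 s3 s4. m = csc s1 * P + csc s2 * b + csc s3 * star b + csc s4 * (1 - P)"
  proof -
    obtain P b where Pb: "\<forall>m\<in>cops M. \<exists>s1 s2 s3 s4. m = csc s1 * P + csc s2 * b + csc s3 * star b + csc s4 * (1 - P)"
      using ex by blast
    define F where "F = op_of ` set [P, b, star b, 1 - P]"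
    show False
    proof (rule small[of F])
      show "finite F" by (simp add: F_def)
      \<comment> \<open>Starting from a list gives the bound even if some of the four operators
        coincide.\<close>
      show "card F \<le> 4"
        using card_image_le[of "set [P, b, star b, 1 - P]" op_of] card_length[of "[P, b, star b, 1 - P]"]
        by (simp add: F_def del: set_simps)
      fix S assume S: "S \<in> M"
      then have "Cop S \<in> cops M" by (simp add: cops_def bo)
      then obtain s1 s2 s3 s4 where s: "Cop S = csc s1 * P + csc s2 * b + csc s3 * star b + csc s4 * (1 - P)"
        using Pb by blast
      have "S = scaleC_op s1 (op_of P) + scaleC_op s2 (op_of b) + scaleC_op s3 (op_of (star b)) + scaleC_op s4 (op_of (1 - P))"
        using arg_cong[OF s, of op_of] bo[OF S] by (simp only: plus_cop.rep_eq op_of_csc_mult)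
      moreover have "op_of P \<in> F" "op_of b \<in> F" "op_of (star b) \<in> F" "op_of (1 - P) \<in> F" by (simp_all add: F_def)
      ultimately show "S \<in> cop.span F"
        by (simp only: cop.span_add cop.span_scale cop.span_base)
    qed
  qed
  have quadratic: "(n - csc p) * (n - csc q) = csc (p * q) + csc (- (p + q)) * n + csc 1 * (n * n)" for p q
    by (simp add: left_diff_distrib right_diff_distrib csc_commute[of n] csc_mult distrib_right
        flip: csc_add csc_minus csc_diff)
  show ?thesis unfolding c0 c1 c2
  proof (intro iffI conjI allI)
    assume "\<exists>X\<in>cops M. \<exists>Y\<in>cops M. X * Y = 1 \<and> Y * X = 1 \<and> irred (cops M) (X * n * Y)"
    then obtain X Y where XY: "X \<in> cops M" "Y \<in> cops M" "X * Y = 1" "Y * X = 1" and irr: "irred (cops M) (X * n * Y)"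
      by blast
    show "ple (cops M) (1 - rp (csc z - n)) (rp (csc z - n))" for z
      by (rule irreducible_kernel_condition[OF XY nM normal irr T0])
    have noquad: "(n - csc p) * (n - csc q) \<noteq> 0" for p q
      using irreducible_quadratic[OF XY nM normal irr T0, of p q] fourdim by blast
    show "csc a + csc b * n + csc c * (n * n) = 0 \<longrightarrow> a = 0 \<and> b = 0 \<and> c = 0" for a b c
    proof
      assume z: "csc a + csc b * n + csc c * (n * n) = 0"
      have "c = 0"
      proof (rule ccontr)
        assume "c \<noteq> 0"
        then obtain p q where pq: "a = c * (p * q)" "b = - c * (p + q)" using complex_quadratic_roots by blast
        have "csc c * ((n - csc p) * (n - csc q)) = csc a + csc b * n + csc c * (n * n)"
          unfolding quadratic pq by (simp add: distrib_left right_diff_distrib csc_mult flip: mult.assoc)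
        then have "csc (1 / c) * (csc c * ((n - csc p) * (n - csc q))) = 0" by (simp add: z)
        then have "(n - csc p) * (n - csc q) = 0" using \<open>c \<noteq> 0\<close> by (simp add: csc_mult flip: mult.assoc[of "csc _" "csc _"])
        then show False using noquad by blast
      qed
      moreover have "b = 0"
      \<comment> \<open>A relation of degree one becomes a quadratic one by adding the root
        0.\<close>
      proof (rule ccontr)
        assume "b \<noteq> 0"
        have "csc (1 / b) * (csc a + csc b * n) = 0" using z \<open>c = 0\<close> by simp
        then have "csc (a / b) + n = 0" using \<open>b \<noteq> 0\<close>
          by (simp add: distrib_left csc_mult flip: mult.assoc)
        then have "n - csc (- (a / b)) = 0" by (simp add: add.commute flip: csc_minus)
        then show False using noquad[of "- (a / b)" 0] by simp
      qed
      moreover have "a = 0"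
      proof (rule ccontr)
        assume "a \<noteq> 0"
        have "csc a = (0 :: 'h cop)" using z \<open>c = 0\<close> \<open>b = 0\<close> by simp
        then have "csc (1 / a) * csc a = csc (1 / a) * (0 :: 'h cop)" by (rule arg_cong)
        then have "csc (1 / a * a) = (0 :: 'h cop)" by (simp only: csc_mult mult_zero_right)
        then have "(1 :: 'h cop) = 0" using \<open>a \<noteq> 0\<close> by simp
        then have "T0 = csc 0" by (metis csc_0 mult_1_left mult_zero_left)
        then show False using T0(2) by blast
      qed
      ultimately show "a = 0 \<and> b = 0 \<and> c = 0" by blast
    qed
  next
    assume cond: "(\<forall>z. ple (cops M) (1 - rp (csc z - n)) (rp (csc z - n))) \<and>
      (\<forall>a b c. csc a + csc b * n + csc c * (n * n) = 0 \<longrightarrow> a = 0 \<and> b = 0 \<and> c = 0)"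
    show "\<exists>X\<in>cops M. \<exists>Y\<in>cops M. X * Y = 1 \<and> Y * X = 1 \<and> irred (cops M) (X * n * Y)"
    proof (rule similar_to_irreducible[OF nM normal])
      show "(1 :: 'h cop) \<noteq> 0"
      proof
        assume "(1 :: 'h cop) = 0"
        then have "csc 1 + csc 0 * n + csc 0 * (n * n) = 0" by simp
        then show False using cond one_neq_zero by blast
      qed
      show "ple (cops M) (1 - rp (csc c - n)) (rp (csc c - n))" for c using cond by blast
      show "(n - csc a) * (n - csc b) \<noteq> 0" for a b unfolding quadratic using cond one_neq_zero by blast
    qed
  qed
qed

end
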